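(* For any $E$-module $\mathcal M$, there is an isomorphism $\mathcal M\to\mathcal M^E$ of based multicategories. In particular, for an $E$-module $\mathcal M$ there are isomorphisms $\mathcal M\wedge E\cong\mathcal M\cong\mathcal M^E$.
   Context: **Multicategories.** A (small, symmetric) multicategory $\mathcal M$ has a set of objects; for each finite sequence of objects $a_1,\dots,a_n$ ($n\ge 0$) and object $b$ a set $\mathcal M(a_1,\dots,a_n:b)$ of $n$-arrows; bijections $\sigma^*:\mathcal M(a_1,\dots,a_n:b)\to\mathcal M(a_{\sigma(1)},\dots,a_{\sigma(n)}:b)$ for $\sigma\in\Sigma_n$; composition maps $\mathcal M(b_1,\dots,b_n:c)\times\prod_i\mathcal M(a^i_1,\dots,a^i_{m_i}:b_i)\to\mathcal M(a^1_1,\dots,a^n_{m_n}:c)$; and units $1_a\in\mathcal M(a:a)$; composition is associative, unital and compatible with permutations. A multifunctor preserves all this structure. Let $*$ be the terminal multicategory (one object, exactly one $n$-arrow for each $n\ge0$). A based multicategory is a multicategory with a multifunctor $*\to\mathcal M$ (the basepoint); based multifunctors are multifunctors commuting with the basepoints; they form the category $\mathrm{Mult}_*$. **Internal hom and smash product.** For based multicategories $\mathcal N,\mathcal M$, the based multicategory $\mathcal M^{\mathcal N}$ has as objects the based multifunctors $\mathcal N\to\mathcal M$; a $k$-arrow $(F_1,\dots,F_k)\to G$ is a family of $k$-arrows $\varphi_a\in\mathcal M(F_1a,\dots,F_ka:Ga)$ such that for every $m$-arrow $f:(a_1,\dots,a_m)\to a$ of $\mathcal N$, $G(f)\circ(\varphi_{a_1},\dots,\varphi_{a_m})$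 and $\varphi_a\circ(F_1f,\dots,F_kf)$ agree up to the evident permutation of inputs, and whose component at the basepoint object is the image of the unique $k$-arrow of $*$. It is based at the constant multifunctor at the basepoint. The functor $-\wedge\mathcal N$ is left adjoint to $(-)^{\mathcal N}$; $\wedge$ makes $\mathrm{Mult}_*$ a closed symmetric monoidal category, with unit $u=*\amalg[0]$ ($[0]$ has one object and only its identity arrow). **$E$ and $E$-modules.** $E$ is the multicategory with objects $0,1$ and $E(a_1,\dots,a_n:b)$ a one-point set if $\sum a_i=b$ and empty otherwise, based at $0$. It is a commutative monoid in $(\mathrm{Mult}_*,\wedge,u)$ with multiplication $E\wedge E\to E$ given on objects by $(a,b)\mapsto ab$ and unit $u\to E$ picking out $1$. An $E$-module is a module over this monoid; the category $\mathrm{Mod}_E$ of $E$-modules is a full subcategory of $\mathrm{Mult}_*$ (Elmendorf–Mandell). *)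

theory Defs
  imports "HOL-Library.FuncSet" "HOL-Combinatorics.Permutations"
begin

section \<open>Permutations of input lists\<close>

text \<open>
  An element of \<open>\<Sigma>\<^sub>n\<close> is a function \<open>\<sigma>\<close> with \<open>\<sigma> permutes {..<n}\<close>; it is the identity
  outside \<open>{..<n}\<close>, so the representation is unique. The library function
  \<open>permute_list \<sigma> [a\<^sub>0, \<dots>, a\<^sub>n\<^sub>-\<^sub>1] = [a\<^bsub>\<sigma> 0\<^esub>, \<dots>, a\<^bsub>\<sigma> (n-1)\<^esub>]\<close> is a right action:
  \<open>permute_list (\<sigma> \<circ> \<tau>) xs = permute_list \<tau> (permute_list \<sigma> xs)\<close>.
\<close>

definition perm_of_list :: "nat list \<Rightarrow> nat \<Rightarrow> nat" where
  "perm_of_list is = (\<lambda>i. if i < length is then is ! i else i)"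

text \<open>\<open>blocks [m\<^sub>0, \<dots>, m\<^sub>n\<^sub>-\<^sub>1]\<close> cuts \<open>[0..<\<Sum>m\<^sub>i]\<close> into consecutive blocks of these lengths.\<close>

definition blocks :: "nat list \<Rightarrow> nat list list" where
  "blocks ms = map (\<lambda>i. [sum_list (take i ms)..<sum_list (take (Suc i) ms)]) [0..<length ms]"

text \<open>
  The three families of permutations are characterised by
  \<open>permute_list (block_perm \<sigma> ms) (concat xss) = concat (permute_list \<sigma> xss)\<close> and
  \<open>permute_list (sum_perm \<tau>s ms) (concat xss) = concat (map2 permute_list \<tau>s xss)\<close>,
  where \<open>ms = map length xss\<close>, and by the fact that \<open>transpose_perm m n\<close> takes
  \<open>x\<^sub>0\<^sub>,\<^sub>0, x\<^sub>0\<^sub>,\<^sub>1, \<dots>, x\<^bsub>m-1,n-1\<^esub>\<close> (second index running fastest) to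
  \<open>x\<^sub>0\<^sub>,\<^sub>0, x\<^sub>1\<^sub>,\<^sub>0, \<dots>, x\<^bsub>m-1,n-1\<^esub>\<close> (first index running fastest); see
  \<open>permute_list_block_perm\<close>, \<open>permute_list_sum_perm\<close> and \<open>permute_list_transpose_perm\<close>.
\<close>

definition block_perm :: "(nat \<Rightarrow> nat) \<Rightarrow> nat list \<Rightarrow> nat \<Rightarrow> nat" where
  "block_perm \<sigma> ms = perm_of_list (concat (permute_list \<sigma> (blocks ms)))"

definition sum_perm :: "(nat \<Rightarrow> nat) list \<Rightarrow> nat list \<Rightarrow> nat \<Rightarrow> nat" where
  "sum_perm \<tau>s ms = perm_of_list (concat (map2 permute_list \<tau>s (blocks ms)))"

definition transpose_perm :: "nat \<Rightarrow> nat \<Rightarrow> nat \<Rightarrow> nat" where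
  "transpose_perm m n = perm_of_list (concat (map (\<lambda>j. map (\<lambda>i. i * n + j) [0..<m]) [0..<n]))"


section \<open>Multicategories and multifunctors\<close>

text \<open>
  Every arrow carries its list of sources and its target, so \<open>\<M>(a\<^sub>1,\<dots>,a\<^sub>n : b)\<close> is the set of
  \<open>f \<in> mArr \<M>\<close> with \<open>mSrc \<M> f = [a\<^sub>1, \<dots>, a\<^sub>n]\<close> and \<open>mTgt \<M> f = b\<close>. In particular \<open>mSrc\<close>,
  \<open>mTgt\<close>, \<open>mId\<close>, \<open>mComp\<close> and \<open>mAct\<close> are meaningful only on the arguments allowed by the locale.
\<close>

record ('o, 'a) multicat =
  mObj :: "'o set"
  mArr :: "'a set"
  mSrc :: "'a \<Rightarrow> 'o list"
  mTgt :: "'a \<Rightarrow> 'o"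
  mId :: "'o \<Rightarrow> 'a"
  mComp :: "'a \<Rightarrow> 'a list \<Rightarrow> 'a"
  mAct :: "(nat \<Rightarrow> nat) \<Rightarrow> 'a \<Rightarrow> 'a"

definition arity :: "('o, 'a, 'z) multicat_scheme \<Rightarrow> 'a \<Rightarrow> nat" where
  "arity M f = length (mSrc M f)"

definition composable :: "('o, 'a, 'z) multicat_scheme \<Rightarrow> 'a \<Rightarrow> 'a list \<Rightarrow> bool" where
  "composable M g fs \<longleftrightarrow> g \<in> mArr M \<and> set fs \<subseteq> mArr M \<and> map (mTgt M) fs = mSrc M g"

locale multicategory =
  fixes M :: "('o, 'a, 'z) multicat_scheme"
  assumes src_closed: "f \<in> mArr M \<Longrightarrow> set (mSrc M f) \<subseteq> mObj M"
    and tgt_closed: "f \<in> mArr M \<Longrightarrow> mTgt M f \<in> mObj M"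
    and id_arr: "a \<in> mObj M \<Longrightarrow> mId M a \<in> mArr M"
    and id_src: "a \<in> mObj M \<Longrightarrow> mSrc M (mId M a) = [a]"
    and id_tgt: "a \<in> mObj M \<Longrightarrow> mTgt M (mId M a) = a"
    and comp_arr: "composable M g fs \<Longrightarrow> mComp M g fs \<in> mArr M"
    and comp_src: "composable M g fs \<Longrightarrow> mSrc M (mComp M g fs) = concat (map (mSrc M) fs)"
    and comp_tgt: "composable M g fs \<Longrightarrow> mTgt M (mComp M g fs) = mTgt M g"
    and act_arr: "\<lbrakk>f \<in> mArr M; \<sigma> permutes {..<arity M f}\<rbrakk> \<Longrightarrow> mAct M \<sigma> f \<in> mArr M"
    and act_src: "\<lbrakk>f \<in> mArr M; \<sigma> permutes {..<arity M f}\<rbrakk> \<Longrightarrow>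
        mSrc M (mAct M \<sigma> f) = permute_list \<sigma> (mSrc M f)"
    and act_tgt: "\<lbrakk>f \<in> mArr M; \<sigma> permutes {..<arity M f}\<rbrakk> \<Longrightarrow> mTgt M (mAct M \<sigma> f) = mTgt M f"
    and comp_assoc: "\<lbrakk>composable M h gs; length fss = length gs;
        \<And>i. i < length gs \<Longrightarrow> composable M (gs ! i) (fss ! i)\<rbrakk> \<Longrightarrow>
        mComp M (mComp M h gs) (concat fss) = mComp M h (map2 (mComp M) gs fss)"
    and comp_id_right: "f \<in> mArr M \<Longrightarrow> mComp M f (map (mId M) (mSrc M f)) = f"
    and comp_id_left: "f \<in> mArr M \<Longrightarrow> mComp M (mId M (mTgt M f)) [f] = f"
    and act_id: "f \<in> mArr M \<Longrightarrow> mAct M id f = f"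
    and act_comp: "\<lbrakk>f \<in> mArr M; \<sigma> permutes {..<arity M f}; \<tau> permutes {..<arity M f}\<rbrakk> \<Longrightarrow>
        mAct M (\<sigma> \<circ> \<tau>) f = mAct M \<tau> (mAct M \<sigma> f)"
    and comp_act_outer: "\<lbrakk>composable M g fs; \<sigma> permutes {..<length fs}\<rbrakk> \<Longrightarrow>
        mComp M (mAct M \<sigma> g) (permute_list \<sigma> fs) =
        mAct M (block_perm \<sigma> (map (arity M) fs)) (mComp M g fs)"
    and comp_act_inner: "\<lbrakk>composable M g fs; length \<tau>s = length fs;
        \<And>i. i < length fs \<Longrightarrow> (\<tau>s ! i) permutes {..<arity M (fs ! i)}\<rbrakk> \<Longrightarrow>
        mComp M g (map2 (mAct M) \<tau>s fs) =
        mAct M (sum_perm \<tau>s (map (arity M) fs)) (mComp M g fs)"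

record ('o, 'a, 'p, 'b) mfun =
  fObj :: "'o \<Rightarrow> 'p"
  fArr :: "'a \<Rightarrow> 'b"

locale multifunctor = source: multicategory M + target: multicategory N
  for M :: "('o, 'a, 'y) multicat_scheme" and N :: "('p, 'b, 'z) multicat_scheme" +
  fixes F :: "('o, 'a, 'p, 'b) mfun"
  assumes fun_obj: "a \<in> mObj M \<Longrightarrow> fObj F a \<in> mObj N"
    and fun_arr: "f \<in> mArr M \<Longrightarrow> fArr F f \<in> mArr N"
    and fun_src: "f \<in> mArr M \<Longrightarrow> mSrc N (fArr F f) = map (fObj F) (mSrc M f)"
    and fun_tgt: "f \<in> mArr M \<Longrightarrow> mTgt N (fArr F f) = fObj F (mTgt M f)"
    and fun_id: "a \<in> mObj M \<Longrightarrow> fArr F (mId M a) = mId N (fObj F a)"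
    and fun_comp: "composable M g fs \<Longrightarrow>
        fArr F (mComp M g fs) = mComp N (fArr F g) (map (fArr F) fs)"
    and fun_act: "\<lbrakk>f \<in> mArr M; \<sigma> permutes {..<arity M f}\<rbrakk> \<Longrightarrow>
        fArr F (mAct M \<sigma> f) = mAct N \<sigma> (fArr F f)"

definition mfun_id :: "('o, 'a, 'o, 'a) mfun" where
  "mfun_id = \<lparr>fObj = id, fArr = id\<rparr>"

definition mfun_comp ::
    "('p, 'b, 'q, 'c) mfun \<Rightarrow> ('o, 'a, 'p, 'b) mfun \<Rightarrow> ('o, 'a, 'q, 'c) mfun" (infixl \<open>\<circ>\<^sub>m\<close> 55) where
  "G \<circ>\<^sub>m F = \<lparr>fObj = fObj G \<circ> fObj F, fArr = fArr G \<circ> fArr F\<rparr>"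

text \<open>Equality of multifunctors out of \<open>M\<close>, ignoring values outside the carriers of \<open>M\<close>.\<close>

definition mfun_eq ::
    "('o, 'a, 'z) multicat_scheme \<Rightarrow> ('o, 'a, 'p, 'b) mfun \<Rightarrow> ('o, 'a, 'p, 'b) mfun \<Rightarrow> bool" where
  "mfun_eq M F G \<longleftrightarrow>
    (\<forall>a \<in> mObj M. fObj F a = fObj G a) \<and> (\<forall>f \<in> mArr M. fArr F f = fArr G f)"


section \<open>Based multicategories\<close>

text \<open>The unique \<open>n\<close>-arrow of the terminal multicategory \<open>*\<close> is the number \<open>n\<close>.\<close>

definition terminal_mc :: "(unit, nat) multicat" where
  "terminal_mc = \<lparr>mObj = UNIV, mArr = UNIV, mSrc = (\<lambda>n. replicate n ()), mTgt = (\<lambda>_. ()),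
     mId = (\<lambda>_. 1), mComp = (\<lambda>_ ms. sum_list ms), mAct = (\<lambda>_ n. n)\<rparr>"

record ('o, 'a) based_multicat = "('o, 'a) multicat" +
  base :: "(unit, nat, 'o, 'a) mfun"

definition base_obj :: "('o, 'a, 'z) based_multicat_scheme \<Rightarrow> 'o" where
  "base_obj M = fObj (base M) ()"

definition base_arr :: "('o, 'a, 'z) based_multicat_scheme \<Rightarrow> nat \<Rightarrow> 'a" where
  "base_arr M n = fArr (base M) n"

locale based_multicategory = multicategory M + basepoint: multifunctor terminal_mc M "base M"
  for M :: "('o, 'a, 'z) based_multicat_scheme"

locale based_multifunctor =
  source: based_multicategory M + target: based_multicategory N + multifunctor M N F
  for M :: "('o, 'a, 'y) based_multicat_scheme" and N :: "('p, 'b, 'z) based_multicat_scheme"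
    and F :: "('o, 'a, 'p, 'b) mfun" +
  assumes fun_base: "mfun_eq terminal_mc (F \<circ>\<^sub>m base M) (base N)"

definition based_iso ::
    "('o, 'a, 'y) based_multicat_scheme \<Rightarrow> ('p, 'b, 'z) based_multicat_scheme \<Rightarrow>
     ('o, 'a, 'p, 'b) mfun \<Rightarrow> bool" where
  "based_iso M N F \<longleftrightarrow> based_multifunctor M N F \<and>
    (\<exists>G. based_multifunctor N M G \<and> mfun_eq M (G \<circ>\<^sub>m F) mfun_id \<and> mfun_eq N (F \<circ>\<^sub>m G) mfun_id)"


section \<open>The internal hom\<close>

text \<open>
  The objects of \<open>hom_mc N M\<close>, written \<open>M\<^sup>N\<close> on paper, are the based multifunctors from \<open>N\<close> to \<open>M\<close>;
  extensionality makes equality of the representing records the equality of multifunctors.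
  A \<open>k\<close>-arrow is a triple of the list of its sources, its target and its family of components.
\<close>

definition based_multifunctors ::
    "('n, 'b, 'y) based_multicat_scheme \<Rightarrow> ('o, 'a, 'z) based_multicat_scheme \<Rightarrow>
     ('n, 'b, 'o, 'a) mfun set" where
  "based_multifunctors N M = {F. based_multifunctor N M F \<and>
     fObj F \<in> extensional (mObj N) \<and> fArr F \<in> extensional (mArr N)}"

type_synonym ('n, 'b, 'o, 'a) hom_arrow =
  "('n, 'b, 'o, 'a) mfun list \<times> ('n, 'b, 'o, 'a) mfun \<times> ('n \<Rightarrow> 'a)"

definition hom_arrows ::
    "('n, 'b, 'y) based_multicat_scheme \<Rightarrow> ('o, 'a, 'z) based_multicat_scheme \<Rightarrow>
     ('n, 'b, 'o, 'a) hom_arrow set" where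
  "hom_arrows N M = {(Fs, G, \<phi>).
     set Fs \<subseteq> based_multifunctors N M \<and> G \<in> based_multifunctors N M \<and>
     \<phi> \<in> extensional (mObj N) \<and>
     (\<forall>a \<in> mObj N. \<phi> a \<in> mArr M \<and> mSrc M (\<phi> a) = map (\<lambda>F. fObj F a) Fs \<and>
        mTgt M (\<phi> a) = fObj G a) \<and>
     (\<forall>f \<in> mArr N. mComp M (fArr G f) (map \<phi> (mSrc N f)) =
        mAct M (transpose_perm (length Fs) (arity N f))
          (mComp M (\<phi> (mTgt N f)) (map (\<lambda>F. fArr F f) Fs))) \<and>
     \<phi> (base_obj N) = base_arr M (length Fs)}"

definition const_base ::
    "('n, 'b, 'y) based_multicat_scheme \<Rightarrow> ('o, 'a, 'z) based_multicat_scheme \<Rightarrow>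
     ('n, 'b, 'o, 'a) mfun" where
  "const_base N M = \<lparr>fObj = (\<lambda>a \<in> mObj N. base_obj M),
     fArr = (\<lambda>f \<in> mArr N. base_arr M (arity N f))\<rparr>"

definition hom_mc ::
    "('n, 'b, 'y) based_multicat_scheme \<Rightarrow> ('o, 'a, 'z) based_multicat_scheme \<Rightarrow>
     (('n, 'b, 'o, 'a) mfun, ('n, 'b, 'o, 'a) hom_arrow) based_multicat" where
  "hom_mc N M = \<lparr>
     mObj = based_multifunctors N M,
     mArr = hom_arrows N M,
     mSrc = (\<lambda>(Fs, G, \<phi>). Fs),
     mTgt = (\<lambda>(Fs, G, \<phi>). G),
     mId = (\<lambda>F. ([F], F, \<lambda>a \<in> mObj N. mId M (fObj F a))),
     mComp = (\<lambda>(Gs, H, \<psi>) \<phi>s. (concat (map fst \<phi>s), H,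
        \<lambda>a \<in> mObj N. mComp M (\<psi> a) (map (\<lambda>(Fs, G, \<phi>). \<phi> a) \<phi>s))),
     mAct = (\<lambda>\<sigma> (Fs, G, \<phi>). (permute_list \<sigma> Fs, G, \<lambda>a \<in> mObj N. mAct M \<sigma> (\<phi> a))),
     base = \<lparr>fObj = (\<lambda>_. const_base N M),
        fArr = (\<lambda>k. (replicate k (const_base N M), const_base N M,
          \<lambda>a \<in> mObj N. base_arr M k))\<rparr>\<rparr>"


section \<open>The smash product\<close>

text \<open>
  Unwinding the definition of \<open>hom_mc\<close>, a based multifunctor from \<open>M\<close> to \<open>hom_mc N Q\<close> is a
  bilinear map from \<open>M\<close> and \<open>N\<close> to \<open>Q\<close>: values on pairs of objects, on pairs of an arrow of \<open>M\<close>
  and an object of \<open>N\<close>, and on pairs of an object of \<open>M\<close> and an arrow of \<open>N\<close>, as below.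
\<close>

record ('o, 'a, 'p, 'b, 'q, 'c) bimap =
  bObj :: "'o \<Rightarrow> 'p \<Rightarrow> 'q"
  bArrL :: "'a \<Rightarrow> 'p \<Rightarrow> 'c"
  bArrR :: "'o \<Rightarrow> 'b \<Rightarrow> 'c"

locale bilinear =
  left: based_multicategory M + right: based_multicategory N + target: based_multicategory Q
  for M :: "('o, 'a, 'x) based_multicat_scheme" and N :: "('p, 'b, 'y) based_multicat_scheme"
    and Q :: "('q, 'c, 'z) based_multicat_scheme" +
  fixes h :: "('o, 'a, 'p, 'b, 'q, 'c) bimap"
  assumes bil_left: "b \<in> mObj N \<Longrightarrow>
        based_multifunctor M Q \<lparr>fObj = (\<lambda>a. bObj h a b), fArr = (\<lambda>\<phi>. bArrL h \<phi> b)\<rparr>"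
    and bil_right: "a \<in> mObj M \<Longrightarrow>
        based_multifunctor N Q \<lparr>fObj = (\<lambda>b. bObj h a b), fArr = (\<lambda>\<psi>. bArrR h a \<psi>)\<rparr>"
    and bil_base_left: "\<psi> \<in> mArr N \<Longrightarrow> bArrR h (base_obj M) \<psi> = base_arr Q (arity N \<psi>)"
    and bil_base_right: "\<phi> \<in> mArr M \<Longrightarrow> bArrL h \<phi> (base_obj N) = base_arr Q (arity M \<phi>)"
    and bil_interchange: "\<lbrakk>\<phi> \<in> mArr M; \<psi> \<in> mArr N\<rbrakk> \<Longrightarrow>
        mComp Q (bArrR h (mTgt M \<phi>) \<psi>) (map (bArrL h \<phi>) (mSrc N \<psi>)) =
        mAct Q (transpose_perm (arity M \<phi>) (arity N \<psi>))
          (mComp Q (bArrL h \<phi> (mTgt N \<psi>)) (map (\<lambda>a. bArrR h a \<psi>) (mSrc M \<phi>)))"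

text \<open>
  The smash product is the target of the universal bilinear map, presented by generators and
  relations: its objects are the pairs of objects with all pairs having a basepoint entry
  identified, and its arrows are formal composites and permutations of the generating arrows
  \<open>GenL \<phi> b\<close>, \<open>GenR a \<psi>\<close>, units and basepoint arrows, modulo the multicategory axioms and the
  requirement that the generators form a bilinear map. That \<open>smash M N\<close> represents bilinear maps,
  and hence based multifunctors from \<open>M\<close> to \<open>hom_mc N Q\<close>, is the content of
  \<open>smash_univ_bilinear\<close>, \<open>smash_lift_based_multifunctor\<close>, \<open>smash_lift_univ\<close> and
  \<open>smash_univ_unique\<close> below.
\<close>

definition smash_obj ::
    "('o, 'a, 'y) based_multicat_scheme \<Rightarrow> ('p, 'b, 'z) based_multicat_scheme \<Rightarrow>
     'o \<Rightarrow> 'p \<Rightarrow> 'o \<times> 'p" where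
  "smash_obj M N a b =
     (if a = base_obj M \<or> b = base_obj N then (base_obj M, base_obj N) else (a, b))"

datatype ('o, 'a, 'p, 'b) smash_term =
    GenL 'a 'p
  | GenR 'o 'b
  | UnitT "'o \<times> 'p"
  | BaseT nat
  | CompT "('o, 'a, 'p, 'b) smash_term" "('o, 'a, 'p, 'b) smash_term list"
  | PermT "nat \<Rightarrow> nat" "('o, 'a, 'p, 'b) smash_term"

context
  fixes M :: "('o, 'a, 'y) based_multicat_scheme" and N :: "('p, 'b, 'z) based_multicat_scheme"
begin

primrec st_src :: "('o, 'a, 'p, 'b) smash_term \<Rightarrow> ('o \<times> 'p) list" where
  "st_src (GenL \<phi> b) = map (\<lambda>a. smash_obj M N a b) (mSrc M \<phi>)"
| "st_src (GenR a \<psi>) = map (\<lambda>b. smash_obj M N a b) (mSrc N \<psi>)"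
| "st_src (UnitT x) = [x]"
| "st_src (BaseT n) = replicate n (base_obj M, base_obj N)"
| "st_src (CompT g fs) = concat (map st_src fs)"
| "st_src (PermT \<sigma> f) = permute_list \<sigma> (st_src f)"

primrec st_tgt :: "('o, 'a, 'p, 'b) smash_term \<Rightarrow> 'o \<times> 'p" where
  "st_tgt (GenL \<phi> b) = smash_obj M N (mTgt M \<phi>) b"
| "st_tgt (GenR a \<psi>) = smash_obj M N a (mTgt N \<psi>)"
| "st_tgt (UnitT x) = x"
| "st_tgt (BaseT n) = (base_obj M, base_obj N)"
| "st_tgt (CompT g fs) = st_tgt g"
| "st_tgt (PermT \<sigma> f) = st_tgt f"

abbreviation st_arity :: "('o, 'a, 'p, 'b) smash_term \<Rightarrow> nat" where
  "st_arity f \<equiv> length (st_src f)"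

inductive st_wf :: "('o, 'a, 'p, 'b) smash_term \<Rightarrow> bool" where
  wf_GenL: "\<lbrakk>\<phi> \<in> mArr M; b \<in> mObj N\<rbrakk> \<Longrightarrow> st_wf (GenL \<phi> b)"
| wf_GenR: "\<lbrakk>a \<in> mObj M; \<psi> \<in> mArr N\<rbrakk> \<Longrightarrow> st_wf (GenR a \<psi>)"
| wf_UnitT: "\<lbrakk>a \<in> mObj M; b \<in> mObj N\<rbrakk> \<Longrightarrow> st_wf (UnitT (smash_obj M N a b))"
| wf_BaseT: "st_wf (BaseT n)"
| wf_CompT: "\<lbrakk>st_wf g; \<forall>f \<in> set fs. st_wf f; map st_tgt fs = st_src g\<rbrakk> \<Longrightarrow> st_wf (CompT g fs)"
| wf_PermT: "\<lbrakk>st_wf f; \<sigma> permutes {..<st_arity f}\<rbrakk> \<Longrightarrow> st_wf (PermT \<sigma> f)"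

inductive st_eq :: "('o, 'a, 'p, 'b) smash_term \<Rightarrow> ('o, 'a, 'p, 'b) smash_term \<Rightarrow> bool" where
  eq_refl: "st_wf t \<Longrightarrow> st_eq t t"
| eq_sym: "st_eq s t \<Longrightarrow> st_eq t s"
| eq_trans: "\<lbrakk>st_eq s t; st_eq t u\<rbrakk> \<Longrightarrow> st_eq s u"
| cong_CompT: "\<lbrakk>st_eq g g'; list_all2 st_eq fs fs'; st_wf (CompT g fs)\<rbrakk> \<Longrightarrow>
    st_eq (CompT g fs) (CompT g' fs')"
| cong_PermT: "\<lbrakk>st_eq f f'; \<sigma> permutes {..<st_arity f}\<rbrakk> \<Longrightarrow> st_eq (PermT \<sigma> f) (PermT \<sigma> f')"
| eq_assoc: "\<lbrakk>st_wf (CompT h gs); length fss = length gs;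
    \<forall>i < length gs. st_wf (CompT (gs ! i) (fss ! i))\<rbrakk> \<Longrightarrow>
    st_eq (CompT (CompT h gs) (concat fss)) (CompT h (map2 CompT gs fss))"
| eq_id_right: "st_wf f \<Longrightarrow> st_eq (CompT f (map UnitT (st_src f))) f"
| eq_id_left: "st_wf f \<Longrightarrow> st_eq (CompT (UnitT (st_tgt f)) [f]) f"
| eq_act_id: "st_wf f \<Longrightarrow> st_eq (PermT id f) f"
| eq_act_comp: "\<lbrakk>st_wf f; \<sigma> permutes {..<st_arity f}; \<tau> permutes {..<st_arity f}\<rbrakk> \<Longrightarrow>
    st_eq (PermT (\<sigma> \<circ> \<tau>) f) (PermT \<tau> (PermT \<sigma> f))"
| eq_act_outer: "\<lbrakk>st_wf (CompT g fs); \<sigma> permutes {..<length fs}\<rbrakk> \<Longrightarrow>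
    st_eq (CompT (PermT \<sigma> g) (permute_list \<sigma> fs))
      (PermT (block_perm \<sigma> (map st_arity fs)) (CompT g fs))"
| eq_act_inner: "\<lbrakk>st_wf (CompT g fs); length \<tau>s = length fs;
    \<forall>i < length fs. (\<tau>s ! i) permutes {..<st_arity (fs ! i)}\<rbrakk> \<Longrightarrow>
    st_eq (CompT g (map2 PermT \<tau>s fs))
      (PermT (sum_perm \<tau>s (map st_arity fs)) (CompT g fs))"
| eq_GenL_id: "\<lbrakk>a \<in> mObj M; b \<in> mObj N\<rbrakk> \<Longrightarrow>
    st_eq (GenL (mId M a) b) (UnitT (smash_obj M N a b))"
| eq_GenL_comp: "\<lbrakk>composable M \<phi> \<chi>s; b \<in> mObj N\<rbrakk> \<Longrightarrow>
    st_eq (GenL (mComp M \<phi> \<chi>s) b) (CompT (GenL \<phi> b) (map (\<lambda>\<chi>. GenL \<chi> b) \<chi>s))"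
| eq_GenL_act: "\<lbrakk>\<phi> \<in> mArr M; \<sigma> permutes {..<arity M \<phi>}; b \<in> mObj N\<rbrakk> \<Longrightarrow>
    st_eq (GenL (mAct M \<sigma> \<phi>) b) (PermT \<sigma> (GenL \<phi> b))"
| eq_GenR_id: "\<lbrakk>a \<in> mObj M; b \<in> mObj N\<rbrakk> \<Longrightarrow>
    st_eq (GenR a (mId N b)) (UnitT (smash_obj M N a b))"
| eq_GenR_comp: "\<lbrakk>a \<in> mObj M; composable N \<psi> \<chi>s\<rbrakk> \<Longrightarrow>
    st_eq (GenR a (mComp N \<psi> \<chi>s)) (CompT (GenR a \<psi>) (map (GenR a) \<chi>s))"
| eq_GenR_act: "\<lbrakk>a \<in> mObj M; \<psi> \<in> mArr N; \<sigma> permutes {..<arity N \<psi>}\<rbrakk> \<Longrightarrow>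
    st_eq (GenR a (mAct N \<sigma> \<psi>)) (PermT \<sigma> (GenR a \<psi>))"
| eq_interchange: "\<lbrakk>\<phi> \<in> mArr M; \<psi> \<in> mArr N\<rbrakk> \<Longrightarrow>
    st_eq (CompT (GenR (mTgt M \<phi>) \<psi>) (map (GenL \<phi>) (mSrc N \<psi>)))
      (PermT (transpose_perm (arity M \<phi>) (arity N \<psi>))
        (CompT (GenL \<phi> (mTgt N \<psi>)) (map (\<lambda>a. GenR a \<psi>) (mSrc M \<phi>))))"
| eq_GenL_base: "b \<in> mObj N \<Longrightarrow> st_eq (GenL (base_arr M n) b) (BaseT n)"
| eq_GenR_base: "a \<in> mObj M \<Longrightarrow> st_eq (GenR a (base_arr N n)) (BaseT n)"
| eq_GenL_base_obj: "\<phi> \<in> mArr M \<Longrightarrow> st_eq (GenL \<phi> (base_obj N)) (BaseT (arity M \<phi>))"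
| eq_GenR_base_obj: "\<psi> \<in> mArr N \<Longrightarrow> st_eq (GenR (base_obj M) \<psi>) (BaseT (arity N \<psi>))"

definition st_class :: "('o, 'a, 'p, 'b) smash_term \<Rightarrow> ('o, 'a, 'p, 'b) smash_term set" where
  "st_class t = {s. st_eq s t}"

end

definition st_rep :: "('o, 'a, 'p, 'b) smash_term set \<Rightarrow> ('o, 'a, 'p, 'b) smash_term" where
  "st_rep A = (SOME t. t \<in> A)"

definition smash ::
    "('o, 'a, 'y) based_multicat_scheme \<Rightarrow> ('p, 'b, 'z) based_multicat_scheme \<Rightarrow>
     ('o \<times> 'p, ('o, 'a, 'p, 'b) smash_term set) based_multicat" where
  "smash M N = \<lparr>
     mObj = {smash_obj M N a b | a b. a \<in> mObj M \<and> b \<in> mObj N},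
     mArr = {st_class M N t | t. st_wf M N t},
     mSrc = (\<lambda>A. st_src M N (st_rep A)),
     mTgt = (\<lambda>A. st_tgt M N (st_rep A)),
     mId = (\<lambda>x. st_class M N (UnitT x)),
     mComp = (\<lambda>G Fs. st_class M N (CompT (st_rep G) (map st_rep Fs))),
     mAct = (\<lambda>\<sigma> F. st_class M N (PermT \<sigma> (st_rep F))),
     base = \<lparr>fObj = (\<lambda>_. (base_obj M, base_obj N)), fArr = (\<lambda>n. st_class M N (BaseT n))\<rparr>\<rparr>"

definition smash_univ ::
    "('o, 'a, 'y) based_multicat_scheme \<Rightarrow> ('p, 'b, 'z) based_multicat_scheme \<Rightarrow>
     ('o, 'a, 'p, 'b, 'o \<times> 'p, ('o, 'a, 'p, 'b) smash_term set) bimap" where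
  "smash_univ M N = \<lparr>bObj = smash_obj M N, bArrL = (\<lambda>\<phi> b. st_class M N (GenL \<phi> b)),
     bArrR = (\<lambda>a \<psi>. st_class M N (GenR a \<psi>))\<rparr>"

text \<open>The based multifunctor out of a smash product that corresponds to a bilinear map.\<close>

primrec st_eval ::
    "('q, 'c, 'z) based_multicat_scheme \<Rightarrow> ('o, 'a, 'p, 'b, 'q, 'c) bimap \<Rightarrow>
     ('o, 'a, 'p, 'b) smash_term \<Rightarrow> 'c" where
  "st_eval Q h (GenL \<phi> b) = bArrL h \<phi> b"
| "st_eval Q h (GenR a \<psi>) = bArrR h a \<psi>"
| "st_eval Q h (UnitT x) = mId Q (bObj h (fst x) (snd x))"
| "st_eval Q h (BaseT n) = base_arr Q n"
| "st_eval Q h (CompT g fs) = mComp Q (st_eval Q h g) (map (st_eval Q h) fs)"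
| "st_eval Q h (PermT \<sigma> f) = mAct Q \<sigma> (st_eval Q h f)"

definition smash_lift ::
    "('q, 'c, 'z) based_multicat_scheme \<Rightarrow> ('o, 'a, 'p, 'b, 'q, 'c) bimap \<Rightarrow>
     ('o \<times> 'p, ('o, 'a, 'p, 'b) smash_term set, 'q, 'c) mfun" where
  "smash_lift Q h = \<lparr>fObj = (\<lambda>(a, b). bObj h a b), fArr = (\<lambda>A. st_eval Q h (st_rep A))\<rparr>"

text \<open>
  The multifunctor \<open>F \<and> G\<close>, the associator \<open>(M \<and> N) \<and> P \<rightarrow> M \<and> (N \<and> P)\<close> and, for the unit object
  \<open>u = * \<amalg> [0]\<close>, the right unitor \<open>M \<and> u \<rightarrow> M\<close>.
\<close>

definition smash_map ::
    "('o2, 'a2, 'y) based_multicat_scheme \<Rightarrow> ('p2, 'b2, 'z) based_multicat_scheme \<Rightarrow>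
     ('o1, 'a1, 'o2, 'a2) mfun \<Rightarrow> ('p1, 'b1, 'p2, 'b2) mfun \<Rightarrow>
     ('o1 \<times> 'p1, ('o1, 'a1, 'p1, 'b1) smash_term set,
      'o2 \<times> 'p2, ('o2, 'a2, 'p2, 'b2) smash_term set) mfun" where
  "smash_map M' N' F G = smash_lift (smash M' N')
     \<lparr>bObj = (\<lambda>a b. smash_obj M' N' (fObj F a) (fObj G b)),
      bArrL = (\<lambda>\<phi> b. bArrL (smash_univ M' N') (fArr F \<phi>) (fObj G b)),
      bArrR = (\<lambda>a \<psi>. bArrR (smash_univ M' N') (fObj F a) (fArr G \<psi>))\<rparr>"

definition smash_assoc ::
    "('o, 'a, 'x) based_multicat_scheme \<Rightarrow> ('p, 'b, 'y) based_multicat_scheme \<Rightarrow>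
     ('q, 'c, 'z) based_multicat_scheme \<Rightarrow>
     (('o \<times> 'p) \<times> 'q, ('o \<times> 'p, ('o, 'a, 'p, 'b) smash_term set, 'q, 'c) smash_term set,
      'o \<times> ('p \<times> 'q), ('o, 'a, 'p \<times> 'q, ('p, 'b, 'q, 'c) smash_term set) smash_term set) mfun" where
  "smash_assoc M N P =
    (let T = smash M (smash N P); \<iota> = smash_univ M (smash N P); \<kappa> = smash_univ N P in
     smash_lift T
       \<lparr>bObj = (\<lambda>(a, b) c. bObj \<iota> a (bObj \<kappa> b c)),
        bArrL = (\<lambda>A c. fArr (smash_lift T
           \<lparr>bObj = (\<lambda>a b. bObj \<iota> a (bObj \<kappa> b c)),
            bArrL = (\<lambda>\<phi> b. bArrL \<iota> \<phi> (bObj \<kappa> b c)),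
            bArrR = (\<lambda>a \<psi>. bArrR \<iota> a (bArrL \<kappa> \<psi> c))\<rparr>) A),
        bArrR = (\<lambda>(a, b) \<chi>. bArrR \<iota> a (bArrR \<kappa> b \<chi>))\<rparr>)"

text \<open>\<open>coprod_mc\<close> is the disjoint union of multicategories and \<open>point_mc\<close> is \<open>[0]\<close>.\<close>

definition coprod_mc ::
    "('o, 'a) multicat \<Rightarrow> ('p, 'b) multicat \<Rightarrow> ('o + 'p, 'a + 'b) multicat" where
  "coprod_mc M N = \<lparr>
     mObj = mObj M <+> mObj N,
     mArr = mArr M <+> mArr N,
     mSrc = case_sum (\<lambda>f. map Inl (mSrc M f)) (\<lambda>f. map Inr (mSrc N f)),
     mTgt = map_sum (mTgt M) (mTgt N),
     mId = map_sum (mId M) (mId N),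
     mComp = (\<lambda>g fs. map_sum (\<lambda>g. mComp M g (map projl fs)) (\<lambda>g. mComp N g (map projr fs)) g),
     mAct = (\<lambda>\<sigma>. map_sum (mAct M \<sigma>) (mAct N \<sigma>))\<rparr>"

definition point_mc :: "(unit, unit) multicat" where
  "point_mc = \<lparr>mObj = UNIV, mArr = UNIV, mSrc = (\<lambda>_. [()]), mTgt = (\<lambda>_. ()), mId = (\<lambda>_. ()),
     mComp = (\<lambda>_ _. ()), mAct = (\<lambda>_ _. ())\<rparr>"

definition unit_mc :: "(unit + unit, nat + unit) based_multicat" where
  "unit_mc = multicat.extend (coprod_mc terminal_mc point_mc)
     (based_multicat.fields \<lparr>fObj = Inl, fArr = Inl\<rparr>)"

definition smash_unitor ::
    "('o, 'a, 'z) based_multicat_scheme \<Rightarrow>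
     ('o \<times> (unit + unit), ('o, 'a, unit + unit, nat + unit) smash_term set, 'o, 'a) mfun" where
  "smash_unitor M = smash_lift M
     \<lparr>bObj = (\<lambda>a. case_sum (\<lambda>_. base_obj M) (\<lambda>_. a)),
      bArrL = (\<lambda>\<phi>. case_sum (\<lambda>_. base_arr M (arity M \<phi>)) (\<lambda>_. \<phi>)),
      bArrR = (\<lambda>a. case_sum (\<lambda>n. base_arr M n) (\<lambda>_. mId M a))\<rparr>"


section \<open>Modules and the multicategory E\<close>

text \<open>
  A module over a monoid \<open>(R, m, e)\<close> of based multicategories, the action being on the right.
\<close>

locale smash_module = action: based_multifunctor "smash M R" M \<mu>
  for R :: "('p, 'b, 'y) based_multicat_scheme"
    and m :: "('p \<times> 'p, ('p, 'b, 'p, 'b) smash_term set, 'p, 'b) mfun"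
    and e :: "(unit + unit, nat + unit, 'p, 'b) mfun"
    and M :: "('o, 'a, 'z) based_multicat_scheme"
    and \<mu> :: "('o \<times> 'p, ('o, 'a, 'p, 'b) smash_term set, 'o, 'a) mfun" +
  assumes action_assoc: "mfun_eq (smash (smash M R) R)
      (\<mu> \<circ>\<^sub>m smash_map M R \<mu> mfun_id)
      (\<mu> \<circ>\<^sub>m smash_map M R mfun_id m \<circ>\<^sub>m smash_assoc M R R)"
    and action_unit: "mfun_eq (smash M unit_mc)
      (\<mu> \<circ>\<^sub>m smash_map M R mfun_id e) (smash_unitor M)"

text \<open>
  The pair \<open>(as, b)\<close> is the unique arrow in \<open>E(as : b)\<close>, which exists if and only if \<open>\<Sum> as = b\<close>.
\<close>

definition E_mc :: "(nat, nat list \<times> nat) based_multicat" where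
  "E_mc = \<lparr>
     mObj = {0, 1},
     mArr = {(as, b). set as \<subseteq> {0, 1} \<and> b \<in> {0, 1} \<and> sum_list as = b},
     mSrc = fst,
     mTgt = snd,
     mId = (\<lambda>a. ([a], a)),
     mComp = (\<lambda>g fs. (concat (map fst fs), snd g)),
     mAct = (\<lambda>\<sigma> f. (permute_list \<sigma> (fst f), snd f)),
     base = \<lparr>fObj = (\<lambda>_. 0), fArr = (\<lambda>n. (replicate n 0, 0))\<rparr>\<rparr>"

definition E_mult ::
    "(nat \<times> nat, (nat, nat list \<times> nat, nat, nat list \<times> nat) smash_term set, nat, nat list \<times> nat) mfun" where
  "E_mult = smash_lift E_mc
     \<lparr>bObj = (\<lambda>a b. a * b),
      bArrL = (\<lambda>\<phi> b. (map (\<lambda>a. a * b) (fst \<phi>), snd \<phi> * b)),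
      bArrR = (\<lambda>a \<psi>. (map (\<lambda>b. a * b) (fst \<psi>), a * snd \<psi>))\<rparr>"

definition E_unit :: "(unit + unit, nat + unit, nat, nat list \<times> nat) mfun" where
  "E_unit = \<lparr>fObj = case_sum (\<lambda>_. 0) (\<lambda>_. 1),
     fArr = case_sum (\<lambda>n. (replicate n 0, 0)) (\<lambda>_. ([1], 1))\<rparr>"

abbreviation E_module ::
    "('o, 'a, 'z) based_multicat_scheme \<Rightarrow>
     ('o \<times> nat, ('o, 'a, nat, nat list \<times> nat) smash_term set, 'o, 'a) mfun \<Rightarrow> bool" where
  "E_module \<equiv> smash_module E_mc E_mult E_unit"


section \<open>Properties of the permutations\<close>

lemma perm_of_list_permutes:
  assumes "mset is = mset [0..<n]"
  shows "perm_of_list is permutes {..<n}"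
proof -
  have len: "length is = n" using arg_cong[OF assms, of size] by simp
  have set: "set is = {..<n}" using arg_cong[OF assms, of set_mset] by (simp add: lessThan_atLeast0)
  have dist: "distinct is" using mset_eq_imp_distinct_iff[OF assms] by simp
  show ?thesis
  proof (rule bij_imp_permutes)
    have "inj_on (perm_of_list is) {..<n}"
      by (rule inj_onI) (use dist in \<open>simp add: perm_of_list_def len nth_eq_iff_index_eq\<close>)
    moreover have "perm_of_list is ` {..<n} \<subseteq> {..<n}"
    proof
      fix k assume "k \<in> perm_of_list is ` {..<n}"
      then obtain i where "i < n" "k = is ! i" by (auto simp: perm_of_list_def len)
      then show "k \<in> {..<n}" unfolding set[symmetric] by (simp add: len)
    qed
    ultimately show "bij_betw (perm_of_list is) {..<n} {..<n}"
      by (simp add: bij_betw_def endo_inj_surj)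
  qed (simp add: perm_of_list_def len)
qed

lemma permute_list_perm_of_list:
  assumes "length is = length xs"
  shows "permute_list (perm_of_list is) xs = map ((!) xs) is"
  using assms by (intro nth_equalityI) (auto simp: permute_list_def perm_of_list_def)

lemma length_blocks [simp]: "length (blocks ms) = length ms"
  by (simp add: blocks_def)

lemma blocks_snoc: "blocks (ms @ [m]) = blocks ms @ [[sum_list ms..<sum_list ms + m]]"
  by (simp add: blocks_def)

lemma blocks_Nil [simp]: "blocks [] = []"
  by (simp add: blocks_def)

lemma concat_blocks: "concat (blocks ms) = [0..<sum_list ms]"
proof (induction ms rule: rev_induct)
  case (snoc m ms)
  have "[0..<sum_list ms + m] = [0..<sum_list ms] @ [sum_list ms..<sum_list ms + m]"
    by (rule upt_add_eq_append) simp
  then show ?case using snoc by (simp add: blocks_snoc)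
qed simp

lemma map_length_blocks [simp]: "map length (blocks ms) = ms"
  by (induction ms rule: rev_induct) (simp_all add: blocks_snoc)

lemma length_nth_blocks: "i < length ms \<Longrightarrow> length (blocks ms ! i) = ms ! i"
  by (metis map_length_blocks length_blocks nth_map)

lemma map_nth_blocks: "map (map ((!) (concat xss))) (blocks (map length xss)) = xss"
proof (induction xss rule: rev_induct)
  case Nil
  then show ?case by simp
next
  case (snoc xs xss)
  have set: "k < length (concat xss)" if "B \<in> set (blocks (map length xss))" "k \<in> set B" for B k
  proof -
    have "k \<in> set (concat (blocks (map length xss)))" using that by auto
    then show ?thesis by (simp add: concat_blocks length_concat)
  qed
  have "map (map ((!) (concat xss @ xs))) (blocks (map length xss)) =
      map (map ((!) (concat xss))) (blocks (map length xss))"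
    using set by (intro map_cong refl) (simp add: nth_append)
  moreover have "map ((!) (concat xss @ xs))
      [sum_list (map length xss)..<sum_list (map length xss) + length xs] = xs"
    by (intro nth_equalityI) (simp_all flip: length_concat add: nth_append)
  ultimately show ?case using snoc by (simp add: blocks_snoc)
qed

lemma mset_concat_cong: "mset xss = mset yss \<Longrightarrow> mset (concat xss) = mset (concat yss)"
  by (metis mset_concat mset_map sum_mset_sum_list)

lemma mset_block_list:
  assumes "\<sigma> permutes {..<length ms}"
  shows "mset (concat (permute_list \<sigma> (blocks ms))) = mset [0..<sum_list ms]"
  unfolding concat_blocks[symmetric]
  by (rule mset_concat_cong) (use assms in simp)

lemma block_perm_permutes:
  "\<sigma> permutes {..<length ms} \<Longrightarrow> block_perm \<sigma> ms permutes {..<sum_list ms}"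
  unfolding block_perm_def by (intro perm_of_list_permutes mset_block_list)

lemma permute_list_block_perm:
  assumes "\<sigma> permutes {..<length xss}"
  shows "permute_list (block_perm \<sigma> (map length xss)) (concat xss) = concat (permute_list \<sigma> xss)"
proof -
  let ?l = "concat (permute_list \<sigma> (blocks (map length xss)))"
  have "length ?l = length (concat xss)"
    using arg_cong[OF mset_block_list[of \<sigma> "map length xss"], of size] assms
    by (simp add: length_concat)
  then show ?thesis
    unfolding block_perm_def using assms
    by (simp add: permute_list_perm_of_list map_concat flip: permute_list_map)
       (simp add: map_nth_blocks)
qed

lemma mset_map2_permute_list:
  assumes "length \<tau>s = length xss" "\<And>i. i < length xss \<Longrightarrow> (\<tau>s ! i) permutes {..<length (xss ! i)}"
  shows "mset (concat (map2 permute_list \<tau>s xss)) = mset (concat xss)"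
  using assms
proof (induction \<tau>s xss rule: list_induct2)
  case (Cons \<tau> \<tau>s xs xss)
  have "\<tau> permutes {..<length xs}" using Cons.prems[of 0] by simp
  moreover have "(\<tau>s ! i) permutes {..<length (xss ! i)}" if "i < length xss" for i
    using Cons.prems[of "Suc i"] that by simp
  ultimately show ?case using Cons.IH by simp
qed simp

lemma mset_sum_list:
  assumes "length \<tau>s = length ms" "\<And>i. i < length ms \<Longrightarrow> (\<tau>s ! i) permutes {..<ms ! i}"
  shows "mset (concat (map2 permute_list \<tau>s (blocks ms))) = mset [0..<sum_list ms]"
proof -
  have "length (blocks ms ! i) = ms ! i" if "i < length ms" for i
    using that by (rule length_nth_blocks)
  then show ?thesis
    using assms by (subst mset_map2_permute_list) (simp_all add: concat_blocks)
qed

lemma sum_perm_permutes: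
  "\<lbrakk>length \<tau>s = length ms; \<And>i. i < length ms \<Longrightarrow> (\<tau>s ! i) permutes {..<ms ! i}\<rbrakk> \<Longrightarrow>
    sum_perm \<tau>s ms permutes {..<sum_list ms}"
  unfolding sum_perm_def by (intro perm_of_list_permutes mset_sum_list)

lemma permute_list_sum_perm:
  assumes "length \<tau>s = length xss" "\<And>i. i < length xss \<Longrightarrow> (\<tau>s ! i) permutes {..<length (xss ! i)}"
  shows "permute_list (sum_perm \<tau>s (map length xss)) (concat xss) =
    concat (map2 permute_list \<tau>s xss)"
proof -
  let ?ms = "map length xss" and ?f = "(!) (concat xss)"
  have len: "length (concat (map2 permute_list \<tau>s (blocks ?ms))) = length (concat xss)"
    using arg_cong[OF mset_sum_list[of \<tau>s ?ms], of size] assms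
    by (simp add: length_concat)
  have bl: "length (blocks ?ms ! i) = length (xss ! i)" if "i < length xss" for i
    using length_nth_blocks[of i ?ms] that by simp
  have "map (map ?f) (map2 permute_list \<tau>s (blocks ?ms)) =
      map2 permute_list \<tau>s (map (map ?f) (blocks ?ms))"
    using assms bl by (intro nth_equalityI) (simp_all add: permute_list_map)
  also have "\<dots> = map2 permute_list \<tau>s xss" by (simp only: map_nth_blocks)
  finally show ?thesis
    unfolding sum_perm_def using len by (simp add: permute_list_perm_of_list map_concat)
qed

lemma mset_transpose_list:
  "mset (concat (map (\<lambda>j. map (\<lambda>i. i * n + j) [0..<m]) [0..<n])) = mset [0..<m * n]"
proof -
  let ?l = "concat (map (\<lambda>j. map (\<lambda>i. i * n + j) [0..<m]) [0..<n])"
  have *: "k = (k div n) * n + k mod n \<and> k div n < m \<and> k mod n < n" if "k < m * n" for k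
  proof -
    have "n > 0" using that by (cases n) auto
    then show ?thesis using that by (simp add: less_mult_imp_div_less)
  qed
  have lt: "i * n + j < m * n" if "i < m" "j < n" for i j
  proof -
    have "i * n + j < Suc i * n" using that by simp
    also have "\<dots> \<le> m * n" using that by (intro mult_le_mono) auto
    finally show ?thesis .
  qed
  have set: "set ?l = {..<m * n}"
  proof (intro equalityI subsetI)
    fix k assume "k \<in> {..<m * n}"
    then have k: "k = (k div n) * n + k mod n" "k div n < m" "k mod n < n" using *[of k] by simp_all
    then have "k \<in> set (map (\<lambda>i. i * n + k mod n) [0..<m])"
      unfolding set_map by (intro image_eqI[of _ _ "k div n"]) simp_all
    then show "k \<in> set ?l" unfolding set_concat set_map using k(3)
      by (intro UN_I[of "map (\<lambda>i. i * n + k mod n) [0..<m]"] image_eqI[of _ _ "k mod n"]) simp_all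
  qed (auto intro: lt)
  have len: "length ?l = m * n"
    by (simp add: length_concat o_def sum_list_triv)
  have "distinct ?l" by (rule card_distinct) (simp only: set len card_lessThan)
  then show ?thesis
    using set set_eq_iff_mset_eq_distinct[of ?l "[0..<m * n]"] by (simp add: lessThan_atLeast0)
qed

lemma transpose_perm_permutes: "transpose_perm m n permutes {..<m * n}"
  unfolding transpose_perm_def by (intro perm_of_list_permutes mset_transpose_list)

lemma nth_concat_map_upt:
  "\<lbrakk>i < m; j < n\<rbrakk> \<Longrightarrow> concat (map (\<lambda>i. map (x i) [0..<n]) [0..<m]) ! (i * n + j) = x i j"
proof (induction m)
  case (Suc m)
  let ?c = "concat (map (\<lambda>i. map (x i) [0..<n]) [0..<m])"
  have len: "length ?c = m * n" by (simp add: length_concat o_def sum_list_triv)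
  show ?case
  proof (cases "i < m")
    case True
    have "i * n + j < Suc i * n" using Suc.prems by simp
    also have "\<dots> \<le> m * n" using True by (intro mult_le_mono) auto
    finally show ?thesis using Suc True len by (simp add: nth_append)
  next
    case False
    then have "i = m" using Suc.prems by simp
    then show ?thesis using Suc.prems len by (simp add: nth_append)
  qed
qed simp

lemma permute_list_transpose_perm:
  "permute_list (transpose_perm m n) (concat (map (\<lambda>i. map (x i) [0..<n]) [0..<m])) =
   concat (map (\<lambda>j. map (\<lambda>i. x i j) [0..<m]) [0..<n])"
proof -
  let ?c = "concat (map (\<lambda>i. map (x i) [0..<n]) [0..<m])"
  let ?l = "concat (map (\<lambda>j. map (\<lambda>i. i * n + j) [0..<m]) [0..<n])"
  have "length ?l = length ?c" by (simp add: length_concat o_def sum_list_triv mult.commute)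
  then have "permute_list (transpose_perm m n) ?c = map ((!) ?c) ?l"
    unfolding transpose_perm_def by (rule permute_list_perm_of_list)
  also have "\<dots> = concat (map (\<lambda>j. map (\<lambda>i. ?c ! (i * n + j)) [0..<m]) [0..<n])"
    by (simp add: map_concat o_def)
  also have "\<dots> = concat (map (\<lambda>j. map (\<lambda>i. x i j) [0..<m]) [0..<n])"
    by (intro arg_cong[where f = concat] map_cong refl) (simp add: nth_concat_map_upt)
  finally show ?thesis .
qed

lemma map_map_upt:
  fixes f :: "'o \<Rightarrow> 'p \<Rightarrow> 'q"
  shows "map (\<lambda>x. map (f x) ys) xs =
    map (\<lambda>i. map (\<lambda>j. f (xs ! i) (ys ! j)) [0..<length ys]) [0..<length xs]"
proof -
  have 1: "map g zs = map (\<lambda>i. g (zs ! i)) [0..<length zs]" for g :: "'p \<Rightarrow> 'q" and zs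
    by (rule nth_equalityI) simp_all
  have 2: "map g zs = map (\<lambda>i. g (zs ! i)) [0..<length zs]" for g :: "'o \<Rightarrow> 'q list" and zs
    by (rule nth_equalityI) simp_all
  show ?thesis by (subst 2) (rule map_cong[OF refl], rule 1)
qed

lemma permute_list_transpose_perm_lists:
  "permute_list (transpose_perm (length xs) (length ys)) (concat (map (\<lambda>x. map (f x) ys) xs)) =
   concat (map (\<lambda>y. map (\<lambda>x. f x y) xs) ys)"
  by (subst map_map_upt[of f ys xs], subst map_map_upt[of "\<lambda>y x. f x y" xs ys],
      subst permute_list_transpose_perm, rule refl)


section \<open>The terminal multicategory and E\<close>

lemma unit_list_eq: "length xs = length ys \<Longrightarrow> xs = (ys :: unit list)"
  by (rule nth_equalityI) simp_all

lemma sum_list_concat: "sum_list (concat xss) = sum_list (map sum_list (xss :: nat list list))"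
  by (induction xss) simp_all

lemma terminal_multicategory: "multicategory terminal_mc"
proof
  show "mComp terminal_mc (mComp terminal_mc h gs) (concat fss) =
      mComp terminal_mc h (map2 (mComp terminal_mc) gs fss)"
    if "length fss = length gs" for h gs and fss :: "nat list list"
    using that[symmetric] unfolding terminal_mc_def sum_list_concat
    by (simp, induction gs fss rule: list_induct2) simp_all
  show "mComp terminal_mc (mAct terminal_mc \<sigma> g) (permute_list \<sigma> fs) =
      mAct terminal_mc (block_perm \<sigma> (map (arity terminal_mc) fs)) (mComp terminal_mc g fs)"
    if "\<sigma> permutes {..<length fs}" for g \<sigma> fs
    using mset_permute_list[OF that] by (simp add: terminal_mc_def flip: sum_mset_sum_list)
  show "mComp terminal_mc g (map2 (mAct terminal_mc) \<tau>s fs) =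
      mAct terminal_mc (sum_perm \<tau>s (map (arity terminal_mc) fs)) (mComp terminal_mc g fs)"
    if "length \<tau>s = length fs" for g \<tau>s fs
    using that unfolding terminal_mc_def by (simp, induction \<tau>s fs rule: list_induct2) simp_all
qed (auto simp: terminal_mc_def arity_def length_concat o_def sum_list_triv map_replicate_const
    sum_list_replicate intro!: unit_list_eq)

lemma E_comp_sum:
  assumes "\<And>f. f \<in> set fs \<Longrightarrow> sum_list (fst f) = snd f" "map snd fs = as"
  shows "sum_list (concat (map fst fs)) = (sum_list as :: nat)"
  using assms(1) unfolding assms(2)[symmetric] sum_list_concat by (induction fs) simp_all

lemma E_multicategory: "multicategory E_mc"
proof
  fix g and fs :: "(nat list \<times> nat) list"
  assume "composable E_mc g fs"
  then have *: "set fs \<subseteq> mArr E_mc" "map snd fs = fst g" "g \<in> mArr E_mc"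
    by (auto simp: composable_def E_mc_def)
  have "sum_list (concat (map fst fs)) = sum_list (fst g)"
    by (rule E_comp_sum) (use * in \<open>auto simp: E_mc_def\<close>)
  then show "mComp E_mc g fs \<in> mArr E_mc"
    using *(1,3) by (fastforce simp: E_mc_def)
next
  fix f :: "nat list \<times> nat" and \<sigma>
  assume f: "f \<in> mArr E_mc" "\<sigma> permutes {..<arity E_mc f}"
  then have m: "mset (permute_list \<sigma> (fst f)) = mset (fst f)"
    by (auto simp: E_mc_def arity_def)
  show "mAct E_mc \<sigma> f \<in> mArr E_mc"
    using f(1) arg_cong[OF m, of sum_mset] arg_cong[OF m, of set_mset]
    unfolding sum_mset_sum_list by (auto simp: E_mc_def)
next
  fix h and gs :: "(nat list \<times> nat) list" and fss :: "(nat list \<times> nat) list list"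
  assume "length fss = length gs"
  then have "length gs = length fss" by simp
  then show "mComp E_mc (mComp E_mc h gs) (concat fss) = mComp E_mc h (map2 (mComp E_mc) gs fss)"
    unfolding E_mc_def by (simp, induction gs fss rule: list_induct2) simp_all
next
  fix g \<sigma> and fs :: "(nat list \<times> nat) list"
  assume "\<sigma> permutes {..<length fs}"
  then show "mComp E_mc (mAct E_mc \<sigma> g) (permute_list \<sigma> fs) =
      mAct E_mc (block_perm \<sigma> (map (arity E_mc) fs)) (mComp E_mc g fs)"
    using permute_list_block_perm[of \<sigma> "map fst fs"]
    by (simp add: E_mc_def arity_def[abs_def] o_def permute_list_map)
next
  fix g \<tau>s and fs :: "(nat list \<times> nat) list"
  assume *: "length \<tau>s = length fs" "\<And>i. i < length fs \<Longrightarrow> \<tau>s ! i permutes {..<arity E_mc (fs ! i)}"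
  have "map fst (map2 (\<lambda>\<sigma> f. (permute_list \<sigma> (fst f), snd f)) \<tau>s fs) = map2 permute_list \<tau>s (map fst fs)"
    using *(1) by (induction \<tau>s fs rule: list_induct2) simp_all
  then show "mComp E_mc g (map2 (mAct E_mc) \<tau>s fs) =
      mAct E_mc (sum_perm \<tau>s (map (arity E_mc) fs)) (mComp E_mc g fs)"
    using * permute_list_sum_perm[of \<tau>s "map fst fs"]
    by (simp add: E_mc_def arity_def[abs_def] o_def)
qed (auto simp: E_mc_def arity_def composable_def permute_list_compose[unfolded o_def] o_def)

lemma permute_list_replicate:
  "\<sigma> permutes {..<n} \<Longrightarrow> permute_list \<sigma> (replicate n x) = replicate n x"
  using permutes_in_image[of \<sigma> "{..<n}"] by (intro nth_equalityI) (simp_all add: permute_list_def)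

lemma E_based: "based_multicategory E_mc"
proof -
  interpret T: multicategory terminal_mc by (rule terminal_multicategory)
  interpret E: multicategory E_mc by (rule E_multicategory)
  show ?thesis
  proof
    fix g and fs :: "nat list"
    show "fArr (base E_mc) (mComp terminal_mc g fs) =
          mComp E_mc (fArr (base E_mc) g) (map (fArr (base E_mc)) fs)"
      by (simp add: E_mc_def terminal_mc_def o_def, induction fs) (simp_all add: replicate_add)
  qed (auto simp: E_mc_def terminal_mc_def arity_def permute_list_replicate)
qed


section \<open>The universal property of the smash product\<close>

lemma (in based_multicategory) base_obj_in: "base_obj M \<in> mObj M"
  using basepoint.fun_obj[of "()"] by (simp add: base_obj_def terminal_mc_def)

lemma (in based_multicategory) base_arr:
  "base_arr M n \<in> mArr M" "mSrc M (base_arr M n) = replicate n (base_obj M)"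
  "mTgt M (base_arr M n) = base_obj M" "arity M (base_arr M n) = n"
  using basepoint.fun_arr[of n] basepoint.fun_src[of n] basepoint.fun_tgt[of n]
  by (simp_all add: base_obj_def base_arr_def terminal_mc_def arity_def)

inductive_simps st_wf_simps:
  "st_wf M N (GenL \<phi> b)" "st_wf M N (GenR a \<psi>)" "st_wf M N (UnitT x)" "st_wf M N (BaseT n)"
  "st_wf M N (CompT g fs)" "st_wf M N (PermT \<sigma> f)"

locale smash_factors = M: based_multicategory M + N: based_multicategory N
  for M :: "('o, 'a, 'y) based_multicat_scheme" and N :: "('p, 'b, 'z) based_multicat_scheme"
begin

abbreviation "wft \<equiv> st_wf M N"
abbreviation "src \<equiv> st_src M N"
abbreviation "tgt \<equiv> st_tgt M N"
abbreviation "obj \<equiv> smash_obj M N"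
abbreviation eqv (infix \<open>\<sim>\<close> 50) where "s \<sim> t \<equiv> st_eq M N s t"

lemma obj_base [simp]: "obj (base_obj M) b = (base_obj M, base_obj N)"
  "obj a (base_obj N) = (base_obj M, base_obj N)"
  by (simp_all add: smash_obj_def)

lemma src_obj: "wft t \<Longrightarrow> set (src t) \<subseteq> mObj (smash M N) \<and> tgt t \<in> mObj (smash M N)"
proof (induction rule: st_wf.induct)
  case (wf_BaseT n)
  have "(base_obj M, base_obj N) = obj (base_obj M) (base_obj N)" by simp
  then have "(base_obj M, base_obj N) \<in> mObj (smash M N)"
    unfolding smash_def using M.base_obj_in N.base_obj_in by (simp del: obj_base) blast
  then show ?case by auto
next
  case (wf_PermT f \<sigma>) then show ?case by simp
next
  case (wf_GenL \<phi> b)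
  then show ?case using M.src_closed[of \<phi>] M.tgt_closed[of \<phi>] by (fastforce simp: smash_def)
next
  case (wf_GenR a \<psi>)
  then show ?case using N.src_closed[of \<psi>] N.tgt_closed[of \<psi>] by (fastforce simp: smash_def)
qed (auto simp: smash_def)

lemma wf_UnitT_obj: "x \<in> mObj (smash M N) \<Longrightarrow> wft (UnitT x)"
  by (auto simp: smash_def intro: wf_UnitT)

lemma eqv_props: "s \<sim> t \<Longrightarrow> wft s \<and> wft t \<and> src s = src t \<and> tgt s = tgt t"
proof (induction rule: st_eq.induct)
  case (cong_CompT g g' fs fs')
  have l: "length fs = length fs'" and p: "\<And>i. i < length fs \<Longrightarrow>
      wft (fs ! i) \<and> wft (fs' ! i) \<and> src (fs ! i) = src (fs' ! i) \<and> tgt (fs ! i) = tgt (fs' ! i)"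
    using cong_CompT.IH(2) by (auto simp: list_all2_conv_all_nth)
  have "map src fs = map src fs'" "map tgt fs = map tgt fs'"
    using l p by (auto intro: nth_equalityI)
  moreover have "\<forall>f \<in> set fs'. wft f" using l p by (auto simp: in_set_conv_nth)
  ultimately show ?case using cong_CompT by (auto simp: st_wf_simps)
next
  case (cong_PermT f f' \<sigma>)
  then show ?case by (auto simp: st_wf_simps)
next
  case (eq_assoc h gs fss)
  then have l: "length gs = length fss" by simp
  have w: "map tgt gs = src h" "\<forall>g\<in>set gs. wft g" "wft h"
    using eq_assoc by (auto simp: st_wf_simps)
  have p: "\<And>i. i < length gs \<Longrightarrow> (\<forall>f\<in>set (fss ! i). wft f) \<and> map tgt (fss ! i) = src (gs ! i)"
    using eq_assoc by (auto simp: st_wf_simps)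
  have "map (map tgt) fss = map src gs" using l p by (auto intro: nth_equalityI)
  then have 1: "map tgt (concat fss) = concat (map src gs)" by (simp add: map_concat)
  have 2: "\<forall>f \<in> set (concat fss). wft f" 
  proof -
    have "\<forall>fs \<in> set fss. \<forall>f \<in> set fs. wft f" using p l by (metis in_set_conv_nth)
    then show ?thesis by simp
  qed
  have 3: "map tgt (map2 CompT gs fss) = map tgt gs" using l by (auto intro: nth_equalityI)
  have 4: "\<forall>f \<in> set (map2 CompT gs fss). wft f"
    using eq_assoc.hyps(3) l by (auto simp: set_zip)
  have 5: "map src (map2 CompT gs fss) = map (\<lambda>fs. concat (map src fs)) fss"
    using l by (auto intro: nth_equalityI)
  have 6: "concat (map src (concat fss)) = concat (map (\<lambda>fs. concat (map src fs)) fss)"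
    by (induction fss) simp_all
  show ?case using 1 2 3 4 5 6 w by (auto simp: st_wf_simps)
next
  case (eq_id_right f)
  then show ?case using src_obj[of f] by (auto simp: st_wf_simps(5) o_def intro!: wf_UnitT_obj)
next
  case (eq_id_left f)
  then show ?case using src_obj[of f] by (auto simp: st_wf_simps(5) intro!: wf_UnitT_obj)
next
  case (eq_act_id f)
  then show ?case by (simp add: st_wf_simps permutes_id)
next
  case (eq_act_comp f \<sigma> \<tau>)
  then show ?case by (simp add: st_wf_simps permutes_compose permute_list_compose)
next
  case (eq_act_outer g fs \<sigma>)
  then have w: "map tgt fs = src g" "\<forall>f\<in>set fs. wft f" "wft g" by (auto simp: st_wf_simps)
  have l: "length (src g) = length fs" using w(1) by (metis length_map)
  have b: "block_perm \<sigma> (map (\<lambda>f. length (src f)) fs) permutes {..<length (concat (map src fs))}"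
    using block_perm_permutes[of \<sigma> "map (\<lambda>f. length (src f)) fs"] eq_act_outer.hyps(2)
    by (simp add: length_concat o_def)
  have "permute_list (block_perm \<sigma> (map (\<lambda>f. length (src f)) fs)) (concat (map src fs)) =
      concat (map src (permute_list \<sigma> fs))"
    using permute_list_block_perm[of \<sigma> "map src fs"] eq_act_outer.hyps(2)
    by (simp add: o_def permute_list_map)
  then show ?case using w l b eq_act_outer.hyps
    by (auto simp: st_wf_simps permute_list_map simp flip: w(1))
next
  case (eq_act_inner g fs \<tau>s)
  then have w: "map tgt fs = src g" "\<forall>f\<in>set fs. wft f" "wft g" by (auto simp: st_wf_simps)
  have t: "map tgt (map2 PermT \<tau>s fs) = map tgt fs"
    using eq_act_inner.hyps(2) by (auto intro: nth_equalityI)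
  have s: "map src (map2 PermT \<tau>s fs) = map2 permute_list \<tau>s (map src fs)"
    using eq_act_inner.hyps(2) by (auto intro: nth_equalityI)
  have b: "sum_perm \<tau>s (map (\<lambda>f. length (src f)) fs) permutes {..<length (concat (map src fs))}"
    using sum_perm_permutes[of \<tau>s "map (\<lambda>f. length (src f)) fs"] eq_act_inner.hyps(2,3)
    by (simp add: length_concat o_def)
  have "permute_list (sum_perm \<tau>s (map (\<lambda>f. length (src f)) fs)) (concat (map src fs)) =
      concat (map2 permute_list \<tau>s (map src fs))"
    using permute_list_sum_perm[of \<tau>s "map src fs"] eq_act_inner.hyps(2,3) by (simp add: o_def)
  moreover have "\<forall>f \<in> set (map2 PermT \<tau>s fs). wft f"
    using eq_act_inner.hyps(2,3) w(2) by (auto simp: set_zip st_wf_simps)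
  ultimately show ?case using w t s b by (simp add: st_wf_simps)
next
  case (eq_GenL_comp \<phi> \<chi>s b)
  then have c: "map (mTgt M) \<chi>s = mSrc M \<phi>" "set \<chi>s \<subseteq> mArr M" "\<phi> \<in> mArr M"
    by (auto simp: composable_def)
  show ?case using eq_GenL_comp.hyps c M.comp_arr[OF eq_GenL_comp.hyps(1)]
      M.comp_src[OF eq_GenL_comp.hyps(1)] M.comp_tgt[OF eq_GenL_comp.hyps(1)]
    by (auto simp: st_wf_simps map_concat o_def simp flip: c(1))
next
  case (eq_GenR_comp a \<psi> \<chi>s)
  then have c: "map (mTgt N) \<chi>s = mSrc N \<psi>" "set \<chi>s \<subseteq> mArr N" "\<psi> \<in> mArr N"
    by (auto simp: composable_def)
  show ?case using eq_GenR_comp.hyps c N.comp_arr[OF eq_GenR_comp.hyps(2)]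
      N.comp_src[OF eq_GenR_comp.hyps(2)] N.comp_tgt[OF eq_GenR_comp.hyps(2)]
    by (auto simp: st_wf_simps map_concat o_def simp flip: c(1))
next
  case (eq_GenL_act \<phi> \<sigma> b)
  then show ?case
    by (auto simp: st_wf_simps M.act_arr M.act_src M.act_tgt permute_list_map arity_def)
next
  case (eq_GenR_act a \<psi> \<sigma>)
  then show ?case
    by (auto simp: st_wf_simps N.act_arr N.act_src N.act_tgt permute_list_map arity_def)
next
  case (eq_interchange \<phi> \<psi>)
  let ?as = "mSrc M \<phi>" and ?bs = "mSrc N \<psi>"
  have "length (concat (map (\<lambda>a. map (obj a) ?bs) ?as)) = arity M \<phi> * arity N \<psi>"
    by (simp add: arity_def length_concat o_def sum_list_triv)
  then have "transpose_perm (arity M \<phi>) (arity N \<psi>) permutes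
      {..<length (concat (map (\<lambda>a. map (obj a) ?bs) ?as))}"
    using transpose_perm_permutes by simp
  moreover have "permute_list (transpose_perm (arity M \<phi>) (arity N \<psi>))
      (concat (map (\<lambda>a. map (obj a) ?bs) ?as)) = concat (map (\<lambda>b. map (\<lambda>a. obj a b) ?as) ?bs)"
    unfolding arity_def by (rule permute_list_transpose_perm_lists)
  ultimately show ?case
    using eq_interchange M.src_closed[of \<phi>] M.tgt_closed[of \<phi>] N.src_closed[of \<psi>] N.tgt_closed[of \<psi>]
    by (auto simp: st_wf_simps o_def)
next
  case (eq_GenL_id a b)
  then show ?case by (auto simp: M.id_arr M.id_src M.id_tgt intro: st_wf.intros)
next
  case (eq_GenR_id a b)
  then show ?case by (auto simp: N.id_arr N.id_src N.id_tgt intro: st_wf.intros)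
qed (auto simp: st_wf_simps M.base_arr N.base_arr M.base_obj_in N.base_obj_in arity_def
    map_replicate_const)

abbreviation "cls \<equiv> st_class M N"
abbreviation "S \<equiv> smash M N"

lemma cls_eqI: "s \<sim> t \<Longrightarrow> cls s = cls t"
  unfolding st_class_def by (blast intro: eq_sym eq_trans)

lemma rep_cls: "wft t \<Longrightarrow> st_rep (cls t) \<sim> t"
  unfolding st_rep_def st_class_def by (metis (mono_tags) eq_refl mem_Collect_eq someI)

lemma arr_cls: "F \<in> mArr S \<Longrightarrow> \<exists>f. wft f \<and> F = cls f"
  by (auto simp: smash_def)

lemma cls_arr: "wft f \<Longrightarrow> cls f \<in> mArr S"
  by (auto simp: smash_def)

lemma src_cls: "wft f \<Longrightarrow> mSrc S (cls f) = src f"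
  and tgt_cls: "wft f \<Longrightarrow> mTgt S (cls f) = tgt f"
  using eqv_props[OF rep_cls[of f]] by (simp_all add: smash_def)

lemma arity_cls: "wft f \<Longrightarrow> arity S (cls f) = length (src f)"
  by (simp add: arity_def src_cls)

lemma comp_cls: "wft (CompT g fs) \<Longrightarrow> mComp S (cls g) (map cls fs) = cls (CompT g fs)"
proof -
  assume w: "wft (CompT g fs)"
  then have "st_rep (cls g) \<sim> g" "\<forall>f\<in>set fs. st_rep (cls f) \<sim> f"
    by (auto simp: st_wf_simps rep_cls)
  then have "CompT g fs \<sim> CompT (st_rep (cls g)) (map (st_rep \<circ> cls) fs)"
    using w by (intro cong_CompT) (auto simp: list_all2_conv_all_nth intro: eq_sym)
  then show ?thesis by (simp add: smash_def cls_eqI)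
qed

lemma act_cls: "wft (PermT \<sigma> f) \<Longrightarrow> mAct S \<sigma> (cls f) = cls (PermT \<sigma> f)"
proof -
  assume w: "wft (PermT \<sigma> f)"
  then have "st_rep (cls f) \<sim> f" by (auto simp: st_wf_simps rep_cls)
  then have "PermT \<sigma> f \<sim> PermT \<sigma> (st_rep (cls f))"
    using w by (intro cong_PermT) (auto simp: st_wf_simps intro: eq_sym)
  then show ?thesis by (simp add: smash_def cls_eqI)
qed

lemma arrs_cls: "set Fs \<subseteq> mArr S \<Longrightarrow> \<exists>fs. (\<forall>f\<in>set fs. wft f) \<and> Fs = map cls fs"
proof (induction Fs)
  case (Cons F Fs)
  then obtain fs where "(\<forall>f\<in>set fs. wft f) \<and> Fs = map cls fs" by auto
  moreover obtain f where "wft f" "F = cls f" using Cons.prems arr_cls by auto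
  ultimately show ?case by (intro exI[of _ "f # fs"]) auto
qed simp

lemma composable_cls:
  assumes "\<forall>f \<in> set fs. wft f" "wft g"
  shows "composable S (cls g) (map cls fs) \<longleftrightarrow> wft (CompT g fs)"
proof -
  have "map (mTgt S) (map cls fs) = map tgt fs" using assms by (auto simp: tgt_cls)
  moreover have "set (map cls fs) \<subseteq> mArr S" using assms cls_arr by auto
  ultimately show ?thesis
    unfolding composable_def st_wf_simps using assms by (simp only: src_cls cls_arr) auto
qed

lemma composable_obtain:
  assumes "composable S G Fs"
  obtains g fs where "G = cls g" "Fs = map cls fs" "wft (CompT g fs)" "wft g" "\<forall>f\<in>set fs. wft f"
proof -
  obtain g where g: "wft g" "G = cls g" using assms arr_cls by (auto simp: composable_def)
  obtain fs where fs: "\<forall>f\<in>set fs. wft f" "Fs = map cls fs"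
    using assms arrs_cls[of Fs] by (auto simp: composable_def)
  show ?thesis using that[OF g(2) fs(2) _ g(1) fs(1)] assms composable_cls[OF fs(1) g(1)] g fs by simp
qed

lemma id_cls: "mId S x = cls (UnitT x)"
  by (simp add: smash_def)

lemma smash_multicategory: "multicategory S"
proof
  fix F assume "F \<in> mArr S"
  then obtain f where f: "wft f" "F = cls f" using arr_cls by blast
  show "set (mSrc S F) \<subseteq> mObj S" "mTgt S F \<in> mObj S"
    using f src_obj[of f] by (simp_all add: src_cls tgt_cls)
  have "\<forall>x\<in>set (src f). wft (UnitT x)" using src_obj[OF f(1)] wf_UnitT_obj by auto
  then have w: "wft (CompT f (map UnitT (src f)))" using f by (auto simp: st_wf_simps(5) o_def)
  have "map (mId S) (mSrc S F) = map cls (map UnitT (src f))" using f by (simp add: src_cls id_cls)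
  then show "mComp S F (map (mId S) (mSrc S F)) = F"
    using f comp_cls[OF w] cls_eqI[OF eq_id_right[OF f(1)]] by simp
  have "wft (UnitT (tgt f))" using src_obj[OF f(1)] wf_UnitT_obj by auto
  then have "wft (CompT (UnitT (tgt f)) [f])" using f by (simp add: st_wf_simps(5))
  then show "mComp S (mId S (mTgt S F)) [F] = F"
    using f comp_cls[of "UnitT (tgt f)" "[f]"] cls_eqI[OF eq_id_left[OF f(1)]]
    by (simp add: tgt_cls id_cls)
  have "wft (PermT id f)" using f by (simp add: st_wf_simps permutes_id)
  then show "mAct S id F = F" using f act_cls[of id f] cls_eqI[OF eq_act_id[OF f(1)]] by simp
  {
    fix \<sigma> assume s: "\<sigma> permutes {..<arity S F}"
    then have w: "wft (PermT \<sigma> f)" using f by (simp add: st_wf_simps arity_cls)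
    show "mAct S \<sigma> F \<in> mArr S" "mSrc S (mAct S \<sigma> F) = permute_list \<sigma> (mSrc S F)"
      "mTgt S (mAct S \<sigma> F) = mTgt S F"
      using w f by (simp_all add: act_cls cls_arr src_cls tgt_cls)
    fix \<tau> assume t: "\<tau> permutes {..<arity S F}"
    have w2: "wft (PermT \<tau> (PermT \<sigma> f))" "wft (PermT (\<sigma> \<circ> \<tau>) f)"
      using f s t by (simp_all add: st_wf_simps arity_cls permutes_compose)
    show "mAct S (\<sigma> \<circ> \<tau>) F = mAct S \<tau> (mAct S \<sigma> F)"
      using w w2 f s t eq_act_comp[of M N f \<sigma> \<tau>] by (simp add: act_cls arity_cls cls_eqI)
  }
next
  fix x assume "x \<in> mObj S"
  then show "mId S x \<in> mArr S" "mSrc S (mId S x) = [x]" "mTgt S (mId S x) = x"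
    using wf_UnitT_obj by (simp_all add: id_cls cls_arr src_cls tgt_cls)
next
  fix G Fs assume "composable S G Fs"
  then obtain g fs where *: "G = cls g" "Fs = map cls fs" "wft (CompT g fs)" "wft g" "\<forall>f\<in>set fs. wft f"
    by (rule composable_obtain)
  have ms: "map (mSrc S) Fs = map src fs" using * by (simp add: src_cls)
  have ma: "map (arity S) Fs = map (\<lambda>f. length (src f)) fs" using * by (simp add: arity_cls)
  show "mComp S G Fs \<in> mArr S" "mSrc S (mComp S G Fs) = concat (map (mSrc S) Fs)"
    "mTgt S (mComp S G Fs) = mTgt S G"
    unfolding ms using * by (simp_all add: comp_cls cls_arr src_cls tgt_cls)
  {
    fix \<sigma> assume s: "\<sigma> permutes {..<length Fs}"
    have e: "CompT (PermT \<sigma> g) (permute_list \<sigma> fs) \<sim>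
        PermT (block_perm \<sigma> (map (\<lambda>f. length (src f)) fs)) (CompT g fs)"
      using * s by (intro eq_act_outer) simp_all
    have "arity S G = length Fs" using * by (metis arity_cls length_map st_wf_simps(5))
    then have "mAct S \<sigma> G = cls (PermT \<sigma> g)" using * s by (simp add: act_cls st_wf_simps arity_cls)
    moreover have "permute_list \<sigma> Fs = map cls (permute_list \<sigma> fs)"
      using * s by (simp add: permute_list_map)
    ultimately show "mComp S (mAct S \<sigma> G) (permute_list \<sigma> Fs) =
        mAct S (block_perm \<sigma> (map (arity S) Fs)) (mComp S G Fs)"
      unfolding ma using eqv_props[OF e] cls_eqI[OF e] * by (simp add: comp_cls act_cls)
  next
    fix \<tau>s assume t: "length \<tau>s = length Fs" "\<And>i. i < length Fs \<Longrightarrow> \<tau>s ! i permutes {..<arity S (Fs ! i)}"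
    have t2: "\<forall>i<length fs. \<tau>s ! i permutes {..<length (src (fs ! i))}"
      using t * by (auto simp: arity_cls)
    have e: "CompT g (map2 PermT \<tau>s fs) \<sim>
        PermT (sum_perm \<tau>s (map (\<lambda>f. length (src f)) fs)) (CompT g fs)"
      using * t t2 by (intro eq_act_inner) simp_all
    have "map2 (mAct S) \<tau>s Fs = map cls (map2 PermT \<tau>s fs)"
      using t t2 * by (intro nth_equalityI) (simp_all add: act_cls st_wf_simps)
    then show "mComp S G (map2 (mAct S) \<tau>s Fs) =
        mAct S (sum_perm \<tau>s (map (arity S) Fs)) (mComp S G Fs)"
      unfolding ma using eqv_props[OF e] cls_eqI[OF e] *
      by (simp add: comp_cls act_cls del: map_map)
  }
next
  fix H Gs Fss
  assume c: "composable S H Gs" and l: "length Fss = length Gs"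
    and c2: "\<And>i. i < length Gs \<Longrightarrow> composable S (Gs ! i) (Fss ! i)"
  obtain h gs where *: "H = cls h" "Gs = map cls gs" "wft (CompT h gs)" "wft h" "\<forall>f\<in>set gs. wft f"
    using c by (rule composable_obtain)
  have "\<exists>fs. (\<forall>f\<in>set fs. wft f) \<and> Fss ! i = map cls fs" if "i < length Gs" for i
    using c2[OF that] by (intro arrs_cls) (auto simp: composable_def)
  then obtain f where f: "\<And>i. i < length Gs \<Longrightarrow> (\<forall>t\<in>set (f i). wft t) \<and> Fss ! i = map cls (f i)"
    by metis
  define fss where "fss = map f [0..<length Gs]"
  have F: "Fss = map (map cls) fss" using f l by (intro nth_equalityI) (simp_all add: fss_def)
  have w: "\<forall>i<length gs. wft (CompT (gs ! i) (fss ! i))"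
    using f c2 composable_cls * by (auto simp: fss_def)
  have e: "CompT (CompT h gs) (concat fss) \<sim> CompT h (map2 CompT gs fss)"
    by (rule eq_assoc) (use * w in \<open>simp_all add: fss_def\<close>)
  have "map2 (mComp S) Gs Fss = map cls (map2 CompT gs fss)"
    unfolding F using * w by (intro nth_equalityI) (simp_all add: fss_def comp_cls)
  then show "mComp S (mComp S H Gs) (concat Fss) = mComp S H (map2 (mComp S) Gs Fss)"
    using eqv_props[OF e] cls_eqI[OF e] *
    by (simp add: F comp_cls del: map_map flip: map_concat)
qed

lemma baseS: "base_arr S n = cls (BaseT n)" "base_obj S = (base_obj M, base_obj N)"
  by (simp_all add: base_arr_def base_obj_def smash_def)

lemma BaseT_comp: "CompT (BaseT n) (map BaseT ms) \<sim> BaseT (sum_list ms)" if "length ms = n"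
proof -
  have "mComp M (base_arr M n) (map (base_arr M) ms) = base_arr M (sum_list ms)"
    using M.basepoint.fun_comp[of n ms] that
    by (simp add: base_arr_def composable_def terminal_mc_def o_def map_replicate_const base_arr_def[abs_def])
  moreover have c: "composable M (base_arr M n) (map (base_arr M) ms)"
    using that by (auto simp: composable_def M.base_arr o_def map_replicate_const)
  moreover have "CompT (GenL (base_arr M n) (base_obj N))
      (map (\<lambda>\<chi>. GenL \<chi> (base_obj N)) (map (base_arr M) ms)) \<sim> CompT (BaseT n) (map BaseT ms)"
    using eqv_props[OF eq_GenL_comp[OF c N.base_obj_in]]
    by (intro cong_CompT) (auto simp: list_all2_conv_all_nth N.base_obj_in intro: eq_GenL_base)
  ultimately show ?thesis
    using eq_GenL_comp[OF c N.base_obj_in] eq_GenL_base[OF N.base_obj_in, of M "sum_list ms"]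
    by (metis eq_sym eq_trans)
qed

lemma smash_based: "based_multicategory S"
proof -
  interpret T: multicategory terminal_mc by (rule M.basepoint.source.multicategory_axioms)
  interpret S: multicategory S by (rule smash_multicategory)
  have arr: "fArr (base S) = (\<lambda>n. cls (BaseT n))" "fObj (base S) = (\<lambda>_. (base_obj M, base_obj N))"
    by (simp_all add: smash_def)
  have wB: "wft (BaseT n)" for n by (rule wf_BaseT)
  show ?thesis
  proof
    show "fObj (base S) a \<in> mObj S" for a :: unit
      using src_obj[OF wB[of 0]] by (simp add: arr)
    show "fArr (base S) (mId terminal_mc a) = mId S (fObj (base S) a)" for a
    proof -
      have "mId M (base_obj M) = base_arr M 1"
        using M.basepoint.fun_id[of "()"] by (simp add: base_arr_def base_obj_def terminal_mc_def)
      then show ?thesis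
        using cls_eqI[OF eq_GenL_id[OF M.base_obj_in N.base_obj_in]]
          cls_eqI[OF eq_GenL_base[OF N.base_obj_in, of M 1]]
        by (simp add: arr terminal_mc_def id_cls)
    qed
    show "fArr (base S) (mComp terminal_mc g fs) = mComp S (fArr (base S) g) (map (fArr (base S)) fs)"
      if "composable terminal_mc g fs" for g fs
    proof -
      have l: "length fs = g" using that
        by (simp add: composable_def terminal_mc_def) (metis length_map length_replicate)
      note e = BaseT_comp[OF l]
      show ?thesis using comp_cls[of "BaseT g" "map BaseT fs"] eqv_props[OF e] cls_eqI[OF e]
        by (simp add: arr terminal_mc_def o_def)
    qed
    show "fArr (base S) (mAct terminal_mc \<sigma> f) = mAct S \<sigma> (fArr (base S) f)"
      if "\<sigma> permutes {..<arity terminal_mc f}" for f \<sigma>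
    proof -
      have s: "\<sigma> permutes {..<arity M (base_arr M f)}"
        using that by (simp add: M.base_arr) (simp add: terminal_mc_def arity_def)
      have 1: "mAct M \<sigma> (base_arr M f) = base_arr M f"
        using M.basepoint.fun_act[OF _ that] by (simp add: base_arr_def terminal_mc_def)
      have 2: "PermT \<sigma> (GenL (base_arr M f) (base_obj N)) \<sim> PermT \<sigma> (BaseT f)"
        using s by (intro cong_PermT eq_GenL_base N.base_obj_in) (simp add: M.base_arr)
      have "GenL (mAct M \<sigma> (base_arr M f)) (base_obj N) \<sim> PermT \<sigma> (GenL (base_arr M f) (base_obj N))"
        by (rule eq_GenL_act[OF M.base_arr(1) s N.base_obj_in])
      then have "BaseT f \<sim> PermT \<sigma> (BaseT f)"
        using 2
          eq_GenL_base[OF N.base_obj_in, of M f] unfolding 1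
        by (metis eq_sym eq_trans)
      then have "mAct S \<sigma> (cls (BaseT f)) = cls (BaseT f)"
        using act_cls[of \<sigma> "BaseT f"] eqv_props cls_eqI by metis
      then show ?thesis by (simp add: arr terminal_mc_def)
    qed
  qed (auto simp: arr cls_arr src_cls tgt_cls wB terminal_mc_def map_replicate_const)
qed

end

sublocale bilinear \<subseteq> smash_factors M N ..

context bilinear begin

abbreviation "ob \<equiv> (\<lambda>x. bObj h (fst x) (snd x))"
abbreviation "ev \<equiv> st_eval Q h"

lemma bObj_base: "b \<in> mObj N \<Longrightarrow> bObj h (base_obj M) b = base_obj Q"
  "a \<in> mObj M \<Longrightarrow> bObj h a (base_obj N) = base_obj Q"
proof -
  assume "b \<in> mObj N"
  then interpret L: based_multifunctor M Q "\<lparr>fObj = (\<lambda>a. bObj h a b), fArr = (\<lambda>\<phi>. bArrL h \<phi> b)\<rparr>"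
    by (rule bil_left)
  show "bObj h (base_obj M) b = base_obj Q" using L.fun_base
    by (simp add: mfun_eq_def base_obj_def mfun_comp_def terminal_mc_def)
next
  assume "a \<in> mObj M"
  then interpret L: based_multifunctor N Q "\<lparr>fObj = (\<lambda>b. bObj h a b), fArr = (\<lambda>\<psi>. bArrR h a \<psi>)\<rparr>"
    by (rule bil_right)
  show "bObj h a (base_obj N) = base_obj Q" using L.fun_base
    by (simp add: mfun_eq_def base_obj_def mfun_comp_def terminal_mc_def)
qed

lemma bArr_base: "b \<in> mObj N \<Longrightarrow> bArrL h (base_arr M n) b = base_arr Q n"
  "a \<in> mObj M \<Longrightarrow> bArrR h a (base_arr N n) = base_arr Q n"
proof -
  assume "b \<in> mObj N"
  then interpret L: based_multifunctor M Q "\<lparr>fObj = (\<lambda>a. bObj h a b), fArr = (\<lambda>\<phi>. bArrL h \<phi> b)\<rparr>"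
    by (rule bil_left)
  show "bArrL h (base_arr M n) b = base_arr Q n" using L.fun_base
    by (simp add: mfun_eq_def base_arr_def mfun_comp_def terminal_mc_def)
next
  assume "a \<in> mObj M"
  then interpret L: based_multifunctor N Q "\<lparr>fObj = (\<lambda>b. bObj h a b), fArr = (\<lambda>\<psi>. bArrR h a \<psi>)\<rparr>"
    by (rule bil_right)
  show "bArrR h a (base_arr N n) = base_arr Q n" using L.fun_base
    by (simp add: mfun_eq_def base_arr_def mfun_comp_def terminal_mc_def)
qed

lemmas bl = based_multifunctor.axioms(3)[OF bil_left]
lemmas br = based_multifunctor.axioms(3)[OF bil_right]

lemma ob_obj: "\<lbrakk>a \<in> mObj M; b \<in> mObj N\<rbrakk> \<Longrightarrow> ob (obj a b) = bObj h a b"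
  by (auto simp: smash_obj_def bObj_base left.base_obj_in right.base_obj_in)

lemma ob_base: "bObj h (base_obj M) (base_obj N) = base_obj Q"
  by (simp add: bObj_base left.base_obj_in)

lemma ob_in: "x \<in> mObj S \<Longrightarrow> ob x \<in> mObj Q"
  using multifunctor.fun_obj[OF bl] by (auto simp: smash_def ob_obj)

lemma ev_props: "wft t \<Longrightarrow> ev t \<in> mArr Q \<and> mSrc Q (ev t) = map ob (src t) \<and> mTgt Q (ev t) = ob (tgt t)"
proof (induction rule: st_wf.induct)
  case (wf_GenL \<phi> b)
  then show ?case using multifunctor.fun_arr[OF bl, of b \<phi>] multifunctor.fun_src[OF bl, of b \<phi>]
      multifunctor.fun_tgt[OF bl, of b \<phi>] left.src_closed[of \<phi>] left.tgt_closed[of \<phi>] by (auto simp: ob_obj)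
next
  case (wf_GenR a \<psi>)
  then show ?case using multifunctor.fun_arr[OF br, of a \<psi>] multifunctor.fun_src[OF br, of a \<psi>]
      multifunctor.fun_tgt[OF br, of a \<psi>] right.src_closed[of \<psi>] right.tgt_closed[of \<psi>] by (auto simp: ob_obj)
next
  case (wf_UnitT a b)
  then have "bObj h a b \<in> mObj Q" using multifunctor.fun_obj[OF bl, of b a] by simp
  then show ?case using wf_UnitT by (simp add: ob_obj target.id_arr target.id_src target.id_tgt)
next
  case (wf_BaseT n)
  then show ?case by (simp add: target.base_arr ob_base)
next
  case (wf_CompT g fs)
  then have "map (mTgt Q) (map ev fs) = map (\<lambda>f. ob (tgt f)) fs" by simp
  also have "\<dots> = map ob (map tgt fs)" by simp
  finally have c: "composable Q (ev g) (map ev fs)" using wf_CompT by (auto simp: composable_def)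
  have s: "map (mSrc Q) (map ev fs) = map (map ob) (map src fs)" using wf_CompT by simp
  show ?case using target.comp_arr[OF c] target.comp_src[OF c] target.comp_tgt[OF c] wf_CompT s
    by (simp add: map_concat del: map_map)
next
  case (wf_PermT f \<sigma>)
  then have "\<sigma> permutes {..<arity Q (ev f)}" by (simp add: arity_def)
  then show ?case using wf_PermT by (simp add: target.act_arr target.act_src target.act_tgt permute_list_map)
qed

lemma ev_arity: "wft t \<Longrightarrow> arity Q (ev t) = length (src t)"
  by (simp add: arity_def ev_props)

lemma ev_composable: "wft (CompT g fs) \<Longrightarrow> composable Q (ev g) (map ev fs)"
proof -
  assume w: "wft (CompT g fs)"
  then have "map (mTgt Q) (map ev fs) = map (\<lambda>f. ob (tgt f)) fs" by (simp add: st_wf_simps ev_props)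
  also have "\<dots> = map ob (map tgt fs)" by simp
  also have "\<dots> = map ob (src g)" using w unfolding st_wf_simps by metis
  finally show ?thesis using w by (auto simp: composable_def st_wf_simps ev_props)
qed

lemma ev_eqv: "s \<sim> t \<Longrightarrow> ev s = ev t"
proof (induction rule: st_eq.induct)
  case (cong_CompT g g' fs fs')
  then have "map ev fs = map ev fs'"
    by (intro nth_equalityI) (auto simp: list_all2_conv_all_nth)
  then show ?case using cong_CompT by simp
next
  case (eq_assoc h' gs fss)
  have "mComp Q (mComp Q (ev h') (map ev gs)) (concat (map (map ev) fss)) =
      mComp Q (ev h') (map2 (mComp Q) (map ev gs) (map (map ev) fss))"
    by (rule target.comp_assoc) (use eq_assoc ev_composable in \<open>simp_all\<close>)
  moreover have "map2 (mComp Q) (map ev gs) (map (map ev) fss) = map ev (map2 CompT gs fss)"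
    using eq_assoc by (intro nth_equalityI) simp_all
  ultimately show ?case by (simp add: map_concat)
next
  case (eq_id_right f)
  then show ?case using target.comp_id_right[of "ev f"] by (simp add: ev_props o_def)
next
  case (eq_id_left f)
  then show ?case using target.comp_id_left[of "ev f"] by (simp add: ev_props)
next
  case (eq_act_id f)
  then show ?case using target.act_id[of "ev f"] by (simp add: ev_props)
next
  case (eq_act_comp f \<sigma> \<tau>)
  then show ?case using target.act_comp[of "ev f" \<sigma> \<tau>] by (simp add: ev_props ev_arity)
next
  case (eq_act_outer g fs \<sigma>)
  have "map (arity Q) (map ev fs) = map (\<lambda>f. length (src f)) fs"
    using eq_act_outer by (simp add: st_wf_simps ev_arity)
  then show ?case using target.comp_act_outer[OF ev_composable[OF eq_act_outer(1)], of \<sigma>] eq_act_outer(2)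
    by (simp add: permute_list_map del: map_map)
next
  case (eq_act_inner g fs \<tau>s)
  have a: "map (arity Q) (map ev fs) = map (\<lambda>f. length (src f)) fs"
    using eq_act_inner by (simp add: st_wf_simps ev_arity)
  have m: "map ev (map2 PermT \<tau>s fs) = map2 (mAct Q) \<tau>s (map ev fs)"
    using eq_act_inner by (intro nth_equalityI) simp_all
  have "mComp Q (ev g) (map2 (mAct Q) \<tau>s (map ev fs)) =
    mAct Q (sum_perm \<tau>s (map (arity Q) (map ev fs))) (mComp Q (ev g) (map ev fs))"
    by (rule target.comp_act_inner[OF ev_composable[OF eq_act_inner(1)]])
      (use eq_act_inner in \<open>auto simp: st_wf_simps ev_arity\<close>)
  then show ?case using m a by (simp del: map_map)
next
  case (eq_GenL_id a b)
  then show ?case using multifunctor.fun_id[OF bl, of b a] by (simp add: ob_obj)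
next
  case (eq_GenL_comp \<phi> \<chi>s b)
  then show ?case using multifunctor.fun_comp[OF bl, of b \<phi> \<chi>s] by (simp add: o_def)
next
  case (eq_GenL_act \<phi> \<sigma> b)
  then show ?case using multifunctor.fun_act[OF bl, of b \<phi> \<sigma>] by simp
next
  case (eq_GenR_id a b)
  then show ?case using multifunctor.fun_id[OF br, of a b] by (simp add: ob_obj)
next
  case (eq_GenR_comp a \<psi> \<chi>s)
  then show ?case using multifunctor.fun_comp[OF br, of a \<psi> \<chi>s] by (simp add: o_def)
next
  case (eq_GenR_act a \<psi> \<sigma>)
  then show ?case using multifunctor.fun_act[OF br, of a \<psi> \<sigma>] by simp
next
  case (eq_interchange \<phi> \<psi>)
  then show ?case using bil_interchange[of \<phi> \<psi>] by (simp add: o_def)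
qed (simp_all add: bArr_base bil_base_left bil_base_right)

lemma lift_cls: "wft t \<Longrightarrow> fArr (smash_lift Q h) (cls t) = ev t"
  using ev_eqv[OF rep_cls[of t]] by (simp add: smash_lift_def)

lemma lift_obj: "fObj (smash_lift Q h) = ob"
  by (auto simp: smash_lift_def)

theorem smash_lift_based_multifunctor: "based_multifunctor (smash M N) Q (smash_lift Q h)"
proof -
  interpret S: based_multicategory S by (rule smash_based)
  show ?thesis
  proof
    fix F assume "F \<in> mArr S"
    then obtain f where f: "wft f" "F = cls f" using arr_cls by blast
    show "fArr (smash_lift Q h) F \<in> mArr Q"
      "mSrc Q (fArr (smash_lift Q h) F) = map (fObj (smash_lift Q h)) (mSrc S F)"
      "mTgt Q (fArr (smash_lift Q h) F) = fObj (smash_lift Q h) (mTgt S F)"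
      using f by (simp_all add: lift_cls lift_obj ev_props src_cls tgt_cls)
    fix \<sigma> assume "\<sigma> permutes {..<arity S F}"
    then have "wft (PermT \<sigma> f)" using f by (simp add: st_wf_simps arity_cls)
    then show "fArr (smash_lift Q h) (mAct S \<sigma> F) = mAct Q \<sigma> (fArr (smash_lift Q h) F)"
      using f by (simp add: lift_cls act_cls)
  next
    fix G Fs assume "composable S G Fs"
    then obtain g fs where *: "G = cls g" "Fs = map cls fs" "wft (CompT g fs)" "wft g" "\<forall>f\<in>set fs. wft f"
      by (rule composable_obtain)
    then have "map (fArr (smash_lift Q h)) Fs = map ev fs" by (simp add: lift_cls)
    then show "fArr (smash_lift Q h) (mComp S G Fs) = mComp Q (fArr (smash_lift Q h) G) (map (fArr (smash_lift Q h)) Fs)"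
      using * by (simp add: lift_cls comp_cls del: map_map)
  next
    fix x assume "x \<in> mObj S"
    then show "fObj (smash_lift Q h) x \<in> mObj Q"
      "fArr (smash_lift Q h) (mId S x) = mId Q (fObj (smash_lift Q h) x)"
      using ob_in wf_UnitT_obj by (simp_all add: lift_obj id_cls lift_cls)
  next
    show "mfun_eq terminal_mc (smash_lift Q h \<circ>\<^sub>m base S) (base Q)"
      using baseS lift_obj ob_base lift_cls[OF wf_BaseT]
      by (simp add: mfun_eq_def mfun_comp_def base_obj_def base_arr_def)
  qed
qed

theorem smash_lift_univ:
  "\<lbrakk>a \<in> mObj M; b \<in> mObj N\<rbrakk> \<Longrightarrow> fObj (smash_lift Q h) (bObj (smash_univ M N) a b) = bObj h a b"
  "\<lbrakk>\<phi> \<in> mArr M; b \<in> mObj N\<rbrakk> \<Longrightarrow> fArr (smash_lift Q h) (bArrL (smash_univ M N) \<phi> b) = bArrL h \<phi> b"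
  "\<lbrakk>a \<in> mObj M; \<psi> \<in> mArr N\<rbrakk> \<Longrightarrow> fArr (smash_lift Q h) (bArrR (smash_univ M N) a \<psi>) = bArrR h a \<psi>"
  by (simp_all add: smash_univ_def lift_cls lift_obj st_wf_simps ob_obj)

end


lemma (in smash_factors) interchange_src: "\<lbrakk>\<phi> \<in> mArr M; \<psi> \<in> mArr N\<rbrakk> \<Longrightarrow>
   wft (CompT (GenL \<phi> (mTgt N \<psi>)) (map (\<lambda>a. GenR a \<psi>) (mSrc M \<phi>)))"
  using M.src_closed[of \<phi>] N.tgt_closed[of \<psi>] by (auto simp: st_wf_simps)

theorem (in smash_factors) smash_univ_bilinear: "bilinear M N (smash M N) (smash_univ M N)"
proof -
  interpret S: based_multicategory S by (rule smash_based)
  have o: "obj a b \<in> mObj S" if "a \<in> mObj M" "b \<in> mObj N" for a b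
    using that by (auto simp: smash_def)
  have gl: "cls (GenL (mId M a) b) = cls (UnitT (obj a b))" "cls (GenR a (mId N b)) = cls (UnitT (obj a b))"
    if "a \<in> mObj M" "b \<in> mObj N" for a b
    using that by (auto intro!: cls_eqI intro: st_eq.intros)
  have gb: "b \<in> mObj N \<Longrightarrow> cls (GenL (base_arr M n) b) = cls (BaseT n)"
    "a \<in> mObj M \<Longrightarrow> cls (GenR a (base_arr N n)) = cls (BaseT n)" for a b n
    by (auto intro!: cls_eqI intro: st_eq.intros)
  show ?thesis
  proof (intro bilinear.intro bilinear_axioms.intro)
    fix b assume b: "b \<in> mObj N"
    let ?F = "\<lparr>fObj = \<lambda>a. bObj (smash_univ M N) a b, fArr = \<lambda>\<phi>. bArrL (smash_univ M N) \<phi> b\<rparr>"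
    show "based_multifunctor M S ?F"
    proof
      fix g fs assume c: "composable M g fs"
      have e: "GenL (mComp M g fs) b \<sim> CompT (GenL g b) (map (\<lambda>f. GenL f b) fs)"
        using c b by (rule eq_GenL_comp)
      show "fArr ?F (mComp M g fs) = mComp S (fArr ?F g) (map (fArr ?F) fs)"
        using eqv_props[OF e] cls_eqI[OF e] comp_cls[of "GenL g b" "map (\<lambda>f. GenL f b) fs"]
        by (simp add: smash_univ_def o_def)
    next
      fix f \<sigma> assume "f \<in> mArr M" "\<sigma> permutes {..<arity M f}"
      then have e: "GenL (mAct M \<sigma> f) b \<sim> PermT \<sigma> (GenL f b)" using b by (rule eq_GenL_act)
      show "fArr ?F (mAct M \<sigma> f) = mAct S \<sigma> (fArr ?F f)"
        using eqv_props[OF e] cls_eqI[OF e] by (simp add: smash_univ_def act_cls)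
    qed (auto simp: b gl gb smash_univ_def o st_wf_simps cls_arr src_cls tgt_cls id_cls
         mfun_eq_def mfun_comp_def baseS simp flip: base_obj_def base_arr_def)
  next
    fix a assume a: "a \<in> mObj M"
    let ?F = "\<lparr>fObj = bObj (smash_univ M N) a, fArr = bArrR (smash_univ M N) a\<rparr>"
    show "based_multifunctor N S ?F"
    proof
      fix g fs assume c: "composable N g fs"
      have e: "GenR a (mComp N g fs) \<sim> CompT (GenR a g) (map (GenR a) fs)"
        using a c by (rule eq_GenR_comp)
      show "fArr ?F (mComp N g fs) = mComp S (fArr ?F g) (map (fArr ?F) fs)"
        using eqv_props[OF e] cls_eqI[OF e] comp_cls[of "GenR a g" "map (GenR a) fs"]
        by (simp add: smash_univ_def o_def)
    next
      fix f \<sigma> assume "f \<in> mArr N" "\<sigma> permutes {..<arity N f}"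
      with a have e: "GenR a (mAct N \<sigma> f) \<sim> PermT \<sigma> (GenR a f)" by (rule eq_GenR_act)
      show "fArr ?F (mAct N \<sigma> f) = mAct S \<sigma> (fArr ?F f)"
        using eqv_props[OF e] cls_eqI[OF e] by (simp add: smash_univ_def act_cls)
    qed (auto simp: a gl gb smash_univ_def o st_wf_simps cls_arr src_cls tgt_cls id_cls
         mfun_eq_def mfun_comp_def baseS simp flip: base_obj_def base_arr_def)
  next
    fix \<phi> \<psi> assume p: "\<phi> \<in> mArr M" "\<psi> \<in> mArr N"
    note e = eq_interchange[OF p]
    have w: "wft (CompT (GenL \<phi> (mTgt N \<psi>)) (map (\<lambda>a. GenR a \<psi>) (mSrc M \<phi>)))"
      using p by (rule interchange_src)
    show "mComp S (bArrR (smash_univ M N) (mTgt M \<phi>) \<psi>) (map (bArrL (smash_univ M N) \<phi>) (mSrc N \<psi>)) =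
        mAct S (transpose_perm (arity M \<phi>) (arity N \<psi>))
          (mComp S (bArrL (smash_univ M N) \<phi> (mTgt N \<psi>)) (map (\<lambda>a. bArrR (smash_univ M N) a \<psi>) (mSrc M \<phi>)))"
      using eqv_props[OF e] cls_eqI[OF e] act_cls comp_cls[OF w]
        comp_cls[of "GenR (mTgt M \<phi>) \<psi>" "map (GenL \<phi>) (mSrc N \<psi>)"]
      by (simp add: smash_univ_def o_def)
  qed (auto simp: smash_univ_def baseS M.based_multicategory_axioms N.based_multicategory_axioms
      smash_based intro!: cls_eqI intro: st_eq.intros)
qed

theorem (in smash_factors) smash_univ_unique:
  assumes "based_multifunctor (smash M N) Q F" "based_multifunctor (smash M N) Q G"
    and L: "\<And>\<phi> b. \<lbrakk>\<phi> \<in> mArr M; b \<in> mObj N\<rbrakk> \<Longrightarrow>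
      fArr F (bArrL (smash_univ M N) \<phi> b) = fArr G (bArrL (smash_univ M N) \<phi> b)"
    and R: "\<And>a \<psi>. \<lbrakk>a \<in> mObj M; \<psi> \<in> mArr N\<rbrakk> \<Longrightarrow>
      fArr F (bArrR (smash_univ M N) a \<psi>) = fArr G (bArrR (smash_univ M N) a \<psi>)"
  shows "mfun_eq (smash M N) F G"
proof -
  interpret F: based_multifunctor "smash M N" Q F by fact
  interpret G: based_multifunctor "smash M N" Q G by fact
  have o: "fObj F x = fObj G x" if x: "x \<in> mObj S" for x
  proof -
    obtain a b where ab: "x = obj a b" "a \<in> mObj M" "b \<in> mObj N" using x by (auto simp: smash_def)
    have w: "wft (GenL (mId M a) b)" using ab by (simp add: st_wf_simps M.id_arr)
    have t: "mTgt S (cls (GenL (mId M a) b)) = x" using ab w by (simp add: tgt_cls M.id_tgt)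
    show ?thesis using F.fun_tgt[OF cls_arr[OF w]] G.fun_tgt[OF cls_arr[OF w]] t
        L[of "mId M a" b] ab by (simp add: smash_univ_def M.id_arr)
  qed
  have "fArr F (cls t) = fArr G (cls t)" if "wft t" for t
    using that
  proof (induction rule: st_wf.induct)
    case (wf_GenL \<phi> b) then show ?case using L by (simp add: smash_univ_def)
  next
    case (wf_GenR a \<psi>) then show ?case using R by (simp add: smash_univ_def)
  next
    case (wf_UnitT a b)
    then have "obj a b \<in> mObj S" by (auto simp: smash_def)
    then show ?case using o F.fun_id G.fun_id by (metis id_cls)
  next
    case (wf_BaseT n)
    then show ?case using F.fun_base G.fun_base
      by (simp add: mfun_eq_def mfun_comp_def terminal_mc_def baseS flip: base_arr_def)
  next
    case (wf_CompT g fs)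
    then have w: "wft (CompT g fs)" by (auto intro: st_wf.intros)
    have c: "composable S (cls g) (map cls fs)" using w wf_CompT composable_cls by blast
    have m: "map (fArr F) (map cls fs) = map (fArr G) (map cls fs)" using wf_CompT by simp
    have g: "fArr F (cls g) = fArr G (cls g)" using wf_CompT by simp
    show ?case using F.fun_comp[OF c] G.fun_comp[OF c] by (simp only: comp_cls[OF w] m g)
  next
    case (wf_PermT f \<sigma>)
    then show ?case using F.fun_act[of "cls f" \<sigma>] G.fun_act[of "cls f" \<sigma>] act_cls[of \<sigma> f]
      by (simp add: cls_arr arity_cls st_wf.wf_PermT)
  qed
  then show ?thesis using o arr_cls unfolding mfun_eq_def by blast
qed

end

theory Submission
  imports Defs
begin

text \<open>
  Everything rests on a form of the Eckmann--Hilton argument. A based multifunctor out of \<open>E\<close> sends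
  an arrow \<open>\<psi> = (0, \<dots>, 1, \<dots>, 0) \<rightarrow> 1\<close> to an operation for which the nullary arrow of the basepoint
  is a unit. If two such multifunctors \<open>F\<close> and \<open>G\<close> have the same value at \<open>1\<close> and \<open>F \<psi>\<close> commutes with
  \<open>G \<psi>\<close>, then both sides of the interchange law are \<open>n\<^sup>2\<close>-ary; substituting the nullary basepoint arrow
  for all off-diagonal inputs turns it into \<open>F \<psi> = G \<psi>\<close>. Consequently, for a bilinear map \<open>h\<close> from \<open>M\<close>
  and \<open>E\<close> to \<open>Q\<close> and a based multifunctor \<open>K\<close> from \<open>E\<close> to \<open>M\<close>, the interchange of \<open>K \<psi>\<close> with \<open>\<psi>\<close> gives
  \<open>h (K 1) \<psi> = h (K \<psi>) 1\<close>.

  The unit axiom of a module says that the bilinear action \<open>h\<close> satisfies \<open>h a 1 = a\<close> and \<open>h \<phi> 1 = \<phi>\<close>.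
  Applied to \<open>h\<close>, the principle says that a based multifunctor \<open>K\<close> from \<open>E\<close> to \<open>M\<close> is determined by \<open>K 1\<close>,
  so that the transpose of the action is bijective onto the internal hom, with evaluation at \<open>1\<close>
  as inverse. Applied to the universal bilinear map, with \<open>K = h a\<close>, it says that \<open>a \<mapsto> a \<and> 1\<close> is
  inverse to the action on the smash product.
\<close>

section \<open>Composites of multifunctors, transport of structure, and inverses\<close>

section \<open>Multifunctors\<close>

context multifunctor begin

lemma fun_composable: "composable M g fs \<Longrightarrow> composable N (fArr F g) (map (fArr F) fs)"
proof -
  assume c: "composable M g fs"
  then have "set fs \<subseteq> mArr M" by (simp add: composable_def)
  then have "map (mTgt N) (map (fArr F) fs) = map (fObj F) (map (mTgt M) fs)"
    by (induction fs) (simp_all add: fun_tgt)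
  also have "\<dots> = mSrc N (fArr F g)"
    using c by (simp add: composable_def fun_src)
  finally show ?thesis using c by (auto simp: composable_def fun_arr)
qed

lemma fun_arity: "f \<in> mArr M \<Longrightarrow> arity N (fArr F f) = arity M f"
  by (simp add: arity_def fun_src)

end

lemma mfun_comp_simps [simp]:
  "fObj (G \<circ>\<^sub>m F) = (\<lambda>a. fObj G (fObj F a))" "fArr (G \<circ>\<^sub>m F) = (\<lambda>f. fArr G (fArr F f))"
  by (simp_all add: mfun_comp_def o_def)

lemma mfun_id_simps [simp]: "fObj mfun_id = (\<lambda>a. a)" "fArr mfun_id = (\<lambda>f. f)"
  by (simp_all add: mfun_id_def id_def)

lemma mfun_eq_base_iff:
  "mfun_eq terminal_mc (F \<circ>\<^sub>m base M) (base N) \<longleftrightarrow>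
    fObj F (base_obj M) = base_obj N \<and> (\<forall>n. fArr F (base_arr M n) = base_arr N n)"
  by (auto simp: mfun_eq_def terminal_mc_def base_obj_def base_arr_def)

lemma (in based_multifunctor) fun_base_obj: "fObj F (base_obj M) = base_obj N"
  and fun_base_arr: "fArr F (base_arr M n) = base_arr N n"
  using fun_base by (simp_all add: mfun_eq_base_iff)

lemma multifunctor_comp:
  assumes "multifunctor M N F" "multifunctor N P G"
  shows "multifunctor M P (G \<circ>\<^sub>m F)"
proof -
  interpret F: multifunctor M N F by fact
  interpret G: multifunctor N P G by fact
  show ?thesis
  proof
    show "fArr (G \<circ>\<^sub>m F) (mComp M g fs) = mComp P (fArr (G \<circ>\<^sub>m F) g) (map (fArr (G \<circ>\<^sub>m F)) fs)"
      if "composable M g fs" for g fs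
      using that G.fun_comp[OF F.fun_composable[OF that]] by (simp add: F.fun_comp o_def)
  qed (simp_all add: F.fun_obj G.fun_obj F.fun_arr G.fun_arr F.fun_src G.fun_src F.fun_tgt
      G.fun_tgt F.fun_id G.fun_id F.fun_act G.fun_act F.fun_arity)
qed

lemma based_multifunctor_comp:
  assumes "based_multifunctor M N F" "based_multifunctor N P G"
  shows "based_multifunctor M P (G \<circ>\<^sub>m F)"
proof -
  interpret F: based_multifunctor M N F by fact
  interpret G: based_multifunctor N P G by fact
  interpret multifunctor M P "G \<circ>\<^sub>m F"
    by (rule multifunctor_comp) unfold_locales
  show ?thesis
    by unfold_locales
      (simp add: mfun_eq_base_iff F.fun_base_obj F.fun_base_arr G.fun_base_obj G.fun_base_arr)
qed

lemma based_multifunctor_id: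
  assumes "based_multicategory M"
  shows "based_multifunctor M M mfun_id"
proof -
  interpret based_multicategory M by fact
  show ?thesis by unfold_locales (simp_all add: mfun_eq_base_iff id_def)
qed

text \<open>The axioms evaluate a multifunctor only on the carriers, since sources, targets, units,
  composites and permuted arrows stay there. This lets restricted records replace unrestricted ones
  in \<open>curry_obj_in\<close>.\<close>

lemma based_multifunctor_cong:
  assumes "based_multifunctor M N F" "mfun_eq M F G"
  shows "based_multifunctor M N G"
proof -
  interpret F: based_multifunctor M N F by fact
  have o: "fObj G a = fObj F a" if "a \<in> mObj M" for a using that assms(2) by (simp add: mfun_eq_def)
  have r: "fArr G f = fArr F f" if "f \<in> mArr M" for f using that assms(2) by (simp add: mfun_eq_def)
  show ?thesis
  proof
    fix f assume f: "f \<in> mArr M"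
    show "mSrc N (fArr G f) = map (fObj G) (mSrc M f)"
      using f F.source.src_closed[OF f] by (auto simp: r F.fun_src o)
  next
    fix g fs assume c: "composable M g fs"
    then have "map (fArr G) fs = map (fArr F) fs"
      by (intro map_cong) (auto simp: composable_def r)
    moreover have "g \<in> mArr M" using c by (simp add: composable_def)
    ultimately show "fArr G (mComp M g fs) = mComp N (fArr G g) (map (fArr G) fs)"
      using F.source.comp_arr[OF c] F.fun_comp[OF c] by (simp only: r)
  qed (simp_all add: o r F.fun_obj F.fun_arr F.fun_tgt F.source.tgt_closed F.source.id_arr F.fun_id
      F.source.act_arr F.fun_act mfun_eq_base_iff F.source.base_obj_in F.source.base_arr
      F.fun_base_obj F.fun_base_arr)
qed

text \<open>
  Only \<open>M\<close> is known to be a multicategory; the axioms for \<open>N\<close> are carried over along \<open>F\<close>. This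
  replaces a direct verification of the axioms for the internal hom.
\<close>

lemma multifunctor_transport:
  assumes "multicategory M"
    and obj: "bij_betw (fObj F) (mObj M) (mObj N)" and arr: "fArr F ` mArr M = mArr N"
    and src: "\<And>f. f \<in> mArr M \<Longrightarrow> mSrc N (fArr F f) = map (fObj F) (mSrc M f)"
    and tgt: "\<And>f. f \<in> mArr M \<Longrightarrow> mTgt N (fArr F f) = fObj F (mTgt M f)"
    and ident: "\<And>a. a \<in> mObj M \<Longrightarrow> fArr F (mId M a) = mId N (fObj F a)"
    and comp: "\<And>g fs. composable M g fs \<Longrightarrow>
      fArr F (mComp M g fs) = mComp N (fArr F g) (map (fArr F) fs)"
    and act: "\<And>f \<sigma>. \<lbrakk>f \<in> mArr M; \<sigma> permutes {..<arity M f}\<rbrakk> \<Longrightarrow>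
      fArr F (mAct M \<sigma> f) = mAct N \<sigma> (fArr F f)"
  shows "multifunctor M N F"
proof -
  interpret M: multicategory M by fact
  have inj: "inj_on (fObj F) (mObj M)" using obj by (rule bij_betw_imp_inj_on)
  have objN: "\<exists>a \<in> mObj M. x = fObj F a" if "x \<in> mObj N" for x
    using that obj by (auto simp: bij_betw_def)
  have objM: "fObj F a \<in> mObj N" if "a \<in> mObj M" for a
    using that obj by (auto simp: bij_betw_def)
  have arrN: "\<exists>f \<in> mArr M. x = fArr F f" if "x \<in> mArr N" for x
    using that arr by auto
  have arrM: "fArr F f \<in> mArr N" if "f \<in> mArr M" for f
    using that arr by auto
  have arrsN: "\<exists>fs. set fs \<subseteq> mArr M \<and> xs = map (fArr F) fs" if "set xs \<subseteq> mArr N" for xs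
  proof -
    have "xs \<in> lists (fArr F ` mArr M)" using that arr by auto
    then show ?thesis unfolding lists_image by auto
  qed
  have arity: "arity N (fArr F f) = arity M f" if "f \<in> mArr M" for f
    using that by (simp add: arity_def src)
  have maps: "map (mSrc N) (map (fArr F) fs) = map (map (fObj F)) (map (mSrc M) fs)"
    "map (mTgt N) (map (fArr F) fs) = map (fObj F) (map (mTgt M) fs)"
    "map (arity N) (map (fArr F) fs) = map (arity M) fs"
    if "set fs \<subseteq> mArr M" for fs
    using that by (induction fs) (simp_all add: src tgt arity)
  \<comment> \<open>Composability compares lists of objects, so injectivity of \<open>F\<close> on
    objects reflects it. On arrows, surjectivity is enough.\<close>
  have composable: "composable N (fArr F g) (map (fArr F) fs) \<longleftrightarrow> composable M g fs"
    if "g \<in> mArr M" "set fs \<subseteq> mArr M" for g fs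
  proof -
    have "set (map (mTgt M) fs) \<union> set (mSrc M g) \<subseteq> mObj M"
      using that M.tgt_closed M.src_closed by auto
    then have "map (fObj F) (map (mTgt M) fs) = map (fObj F) (mSrc M g) \<longleftrightarrow>
        map (mTgt M) fs = mSrc M g"
      by (intro inj_on_map_eq_map inj_on_subset[OF inj])
    then show ?thesis
      unfolding composable_def maps(2)[OF that(2)] using that arrM by (auto simp: src)
  qed
  have obtain_composable: "\<exists>g fs. composable M g fs \<and> set fs \<subseteq> mArr M \<and> g \<in> mArr M \<and>
      y = fArr F g \<and> ys = map (fArr F) fs"
    if c: "composable N y ys" for y ys
  proof -
    obtain g where g: "g \<in> mArr M" "y = fArr F g" using c arrN by (auto simp: composable_def)
    obtain fs where fs: "set fs \<subseteq> mArr M" "ys = map (fArr F) fs"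
      using c arrsN[of ys] by (auto simp: composable_def)
    show ?thesis using c composable[OF g(1) fs(1)] g fs by blast
  qed
  interpret N: multicategory N
  proof
    fix y assume "y \<in> mArr N"
    then obtain f where f: "f \<in> mArr M" "y = fArr F f" using arrN by blast
    show "set (mSrc N y) \<subseteq> mObj N" "mTgt N y \<in> mObj N"
      using f M.src_closed[of f] M.tgt_closed[of f] objM by (auto simp: src tgt)
    have "map (mId N) (mSrc N y) = map (fArr F) (map (mId M) (mSrc M f))"
      using M.src_closed[OF f(1)] by (auto simp: f src ident)
    moreover have "composable M f (map (mId M) (mSrc M f))"
      using M.src_closed[OF f(1)] f(1)
      by (auto simp: composable_def M.id_arr M.id_tgt subset_iff intro: map_idI)
    ultimately show "mComp N y (map (mId N) (mSrc N y)) = y"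
      using comp M.comp_id_right[OF f(1)] by (metis f(2))
    have "composable M (mId M (mTgt M f)) [f]"
      using f(1) by (simp add: composable_def M.id_arr M.id_src M.tgt_closed)
    then show "mComp N (mId N (mTgt N y)) [y] = y"
      using comp[of "mId M (mTgt M f)" "[f]"] M.comp_id_left[OF f(1)] f
      by (simp add: tgt M.tgt_closed ident)
    show "mAct N id y = y"
      using act[OF f(1), of id] f by (simp add: M.act_id permutes_id)
    fix \<sigma> assume "\<sigma> permutes {..<arity N y}"
    then have s: "\<sigma> permutes {..<arity M f}" using f by (simp add: arity)
    note [simp] = M.act_arr[OF f(1) s]
    have y: "mAct N \<sigma> y = fArr F (mAct M \<sigma> f)" using act[OF f(1) s] f by simp
    show "mAct N \<sigma> y \<in> mArr N" "mSrc N (mAct N \<sigma> y) = permute_list \<sigma> (mSrc N y)"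
      "mTgt N (mAct N \<sigma> y) = mTgt N y"
      unfolding y using f s
      by (simp_all add: arrM src tgt M.act_src M.act_tgt permute_list_map arity_def)
    fix \<tau> assume "\<tau> permutes {..<arity N y}"
    then have t: "\<tau> permutes {..<arity M f}" using f by (simp add: arity)
    then have "\<tau> permutes {..<arity M (mAct M \<sigma> f)}"
      using f(1) s by (simp add: arity_def M.act_src)
    then show "mAct N (\<sigma> \<circ> \<tau>) y = mAct N \<tau> (mAct N \<sigma> y)"
      unfolding y using act[OF f(1) permutes_compose[OF t s]] M.act_comp[OF f(1) s t] f
        act[of "mAct M \<sigma> f" \<tau>] by simp
  next
    fix x assume "x \<in> mObj N"
    then obtain a where "a \<in> mObj M" "x = fObj F a" using objN by blast
    then show "mId N x \<in> mArr N" "mSrc N (mId N x) = [x]" "mTgt N (mId N x) = x"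
      by (simp_all flip: ident add: arrM src tgt M.id_arr M.id_src M.id_tgt)
  next
    fix y ys assume "composable N y ys"
    then obtain g fs where c: "composable M g fs" and gfs: "set fs \<subseteq> mArr M" "g \<in> mArr M"
      and y: "y = fArr F g" "ys = map (fArr F) fs" using obtain_composable by meson
    have e: "mComp N y ys = fArr F (mComp M g fs)" using comp[OF c] y by simp
    note m = maps[OF gfs(1)]
    note [simp] = M.comp_arr[OF c]
    have n: "arity M (mComp M g fs) = sum_list (map (arity M) fs)"
      by (simp add: arity_def[abs_def] M.comp_src[OF c] length_concat o_def)
    show "mComp N y ys \<in> mArr N" "mTgt N (mComp N y ys) = mTgt N y"
      unfolding e by (simp_all add: y gfs arrM tgt M.comp_tgt[OF c])
    show "mSrc N (mComp N y ys) = concat (map (mSrc N) ys)"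
      unfolding e unfolding y m by (simp add: src M.comp_src[OF c] map_concat)
    {
      fix \<sigma> assume "\<sigma> permutes {..<length ys}"
      then have s: "\<sigma> permutes {..<length fs}" by (simp add: y)
      have "arity M g = length fs" using c by (metis composable_def arity_def length_map)
      then have s2: "\<sigma> permutes {..<arity M g}" using s by simp
      have b: "block_perm \<sigma> (map (arity M) fs) permutes {..<arity M (mComp M g fs)}"
        unfolding n using s by (intro block_perm_permutes) simp
      have pc: "composable M (mAct M \<sigma> g) (permute_list \<sigma> fs)"
        using c s s2 gfs by (simp add: composable_def M.act_arr M.act_src flip: permute_list_map)
      have "mComp N (mAct N \<sigma> y) (permute_list \<sigma> ys) =
          fArr F (mComp M (mAct M \<sigma> g) (permute_list \<sigma> fs))"
        using comp[OF pc] act[OF gfs(2) s2] s by (simp add: y permute_list_map)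
      then show "mComp N (mAct N \<sigma> y) (permute_list \<sigma> ys) =
          mAct N (block_perm \<sigma> (map (arity N) ys)) (mComp N y ys)"
        unfolding e unfolding y m M.comp_act_outer[OF c s] using act[OF _ b] by simp
    next
      fix \<tau>s assume l: "length \<tau>s = length ys"
        and p: "\<And>i. i < length ys \<Longrightarrow> \<tau>s ! i permutes {..<arity N (ys ! i)}"
      have l': "length \<tau>s = length fs" using l by (simp add: y)
      have fi: "fs ! i \<in> mArr M" if "i < length fs" for i using that gfs(1) by auto
      have p': "\<tau>s ! i permutes {..<arity M (fs ! i)}" if "i < length fs" for i
        using p[of i] that fi[OF that] by (simp add: y arity)
      have b: "sum_perm \<tau>s (map (arity M) fs) permutes {..<arity M (mComp M g fs)}"
        unfolding n using l' p' by (intro sum_perm_permutes) simp_all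
      have "map (mTgt M) (map2 (mAct M) \<tau>s fs) = map (mTgt M) fs"
        using l' p' fi by (intro nth_equalityI) (simp_all add: M.act_tgt)
      moreover have "set (map2 (mAct M) \<tau>s fs) \<subseteq> mArr M"
        using l' p' fi by (auto simp: set_zip M.act_arr)
      ultimately have pc: "composable M g (map2 (mAct M) \<tau>s fs)"
        using c by (simp add: composable_def del: map_map)
      have "map2 (mAct N) \<tau>s ys = map (fArr F) (map2 (mAct M) \<tau>s fs)"
        using l' p' fi by (intro nth_equalityI) (simp_all add: y act)
      moreover have "mComp M g (map2 (mAct M) \<tau>s fs) =
          mAct M (sum_perm \<tau>s (map (arity M) fs)) (mComp M g fs)"
        using c l' p' by (rule M.comp_act_inner)
      ultimately show "mComp N y (map2 (mAct N) \<tau>s ys) =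
          mAct N (sum_perm \<tau>s (map (arity N) ys)) (mComp N y ys)"
        unfolding e using comp[OF pc] act[OF _ b] unfolding y m by (simp del: map_map)
    }
  next
    fix z ys xss
    assume c: "composable N z ys" and l: "length xss = length ys"
      and c2: "\<And>i. i < length ys \<Longrightarrow> composable N (ys ! i) (xss ! i)"
    obtain h gs where hgs: "composable M h gs" "set gs \<subseteq> mArr M" "h \<in> mArr M"
      and z: "z = fArr F h" "ys = map (fArr F) gs" using obtain_composable[OF c] by (elim exE conjE) (rule that)
    have "\<exists>fs. set fs \<subseteq> mArr M \<and> xss ! i = map (fArr F) fs" if "i < length ys" for i
      using c2[OF that] by (intro arrsN) (simp add: composable_def)
    then obtain f where f: "\<And>i. i < length ys \<Longrightarrow>
        set (f i) \<subseteq> mArr M \<and> xss ! i = map (fArr F) (f i)" by metis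
    define fss where "fss = map f [0..<length ys]"
    have x: "xss = map (map (fArr F)) fss"
      using f l by (intro nth_equalityI) (simp_all add: fss_def)
    have l': "length fss = length gs" by (simp add: fss_def z)
    have c3: "composable M (gs ! i) (fss ! i)" if i: "i < length gs" for i
    proof -
      have "gs ! i \<in> mArr M" "set (fss ! i) \<subseteq> mArr M"
        using i hgs(2) f[of i] by (auto simp: fss_def z)
      then show ?thesis using c2[of i] i l' by (simp add: z x composable)
    qed
    have i: "gs ! i \<in> mArr M" if "i < length gs" for i using that hgs(2) by auto
    have "map (mTgt M) (map2 (mComp M) gs fss) = map (mTgt M) gs"
      using l' c3 by (intro nth_equalityI) (simp_all add: M.comp_tgt)
    moreover have "set (map2 (mComp M) gs fss) \<subseteq> mArr M"
      using l' c3 by (auto simp: set_zip M.comp_arr)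
    ultimately have c4: "composable M h (map2 (mComp M) gs fss)"
      using hgs(1) by (simp add: composable_def del: map_map)
    have c5: "composable M (mComp M h gs) (concat fss)"
    proof -
      have "map (map (mTgt M)) fss = map (mSrc M) gs"
        using c3 l' by (intro nth_equalityI) (simp_all add: composable_def)
      moreover have "\<forall>fs \<in> set fss. set fs \<subseteq> mArr M"
        using c3 l' by (metis composable_def in_set_conv_nth)
      ultimately show ?thesis using M.comp_arr[OF hgs(1)] M.comp_src[OF hgs(1)]
        by (auto simp: composable_def map_concat)
    qed
    have "map2 (mComp N) ys xss = map (fArr F) (map2 (mComp M) gs fss)"
      using l' c3 by (intro nth_equalityI) (simp_all add: z x comp)
    then show "mComp N (mComp N z ys) (concat xss) = mComp N z (map2 (mComp N) ys xss)"
      using comp[OF c4] comp[OF c5] comp[OF hgs(1)] M.comp_assoc[OF hgs(1) l' c3]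
      by (simp add: z x flip: map_concat)
  qed
  show ?thesis by unfold_locales (simp_all add: objM arrM src tgt ident comp act)
qed

text \<open>Each law for the inverse follows by performing the operation in \<open>M\<close> on the
  preimages: \<open>F\<close> preserves it, and \<open>G\<close> then undoes
  \<open>F\<close>.\<close>

lemma based_iso_bij_betw:
  assumes "based_multifunctor M N F"
    and obj: "bij_betw (fObj F) (mObj M) (mObj N)" and arr: "bij_betw (fArr F) (mArr M) (mArr N)"
  shows "based_iso M N F"
proof -
  interpret F: based_multifunctor M N F by fact
  define G where "G = \<lparr>fObj = inv_into (mObj M) (fObj F), fArr = inv_into (mArr M) (fArr F)\<rparr>"
  have GF: "a \<in> mObj M \<Longrightarrow> fObj G (fObj F a) = a" "f \<in> mArr M \<Longrightarrow> fArr G (fArr F f) = f" for a f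
    using obj arr by (simp_all add: G_def bij_betw_inv_into_left)
  have FG: "x \<in> mObj N \<Longrightarrow> fObj F (fObj G x) = x" "y \<in> mArr N \<Longrightarrow> fArr F (fArr G y) = y" for x y
    using obj arr by (simp_all add: G_def bij_betw_inv_into_right)
  have G_in: "x \<in> mObj N \<Longrightarrow> fObj G x \<in> mObj M" "y \<in> mArr N \<Longrightarrow> fArr G y \<in> mArr M" for x y
    using obj arr by (auto simp: G_def bij_betw_def inv_into_into)
  have src: "mSrc M (fArr G y) = map (fObj G) (mSrc N y)"
    and tgt: "mTgt M (fArr G y) = fObj G (mTgt N y)" if y: "y \<in> mArr N" for y
  proof -
    obtain f where f: "f \<in> mArr M" "y = fArr F f" using y FG(2) G_in(2) by metis
    show "mSrc M (fArr G y) = map (fObj G) (mSrc N y)"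
      using f F.source.src_closed[OF f(1)]
      by (auto simp: GF F.fun_src subset_iff intro!: map_idI[symmetric])
    show "mTgt M (fArr G y) = fObj G (mTgt N y)"
      using f F.source.tgt_closed[OF f(1)] by (simp add: GF F.fun_tgt)
  qed
  have "based_multifunctor N M G"
  proof
    fix y \<sigma> assume y: "y \<in> mArr N" and s: "\<sigma> permutes {..<arity N y}"
    have s': "\<sigma> permutes {..<arity M (fArr G y)}" using s y by (simp add: arity_def src)
    then show "fArr G (mAct N \<sigma> y) = mAct M \<sigma> (fArr G y)"
      using F.fun_act[OF G_in(2)[OF y] s'] GF(2)[of "mAct M \<sigma> (fArr G y)"]
        F.source.act_arr[OF G_in(2)[OF y] s'] by (simp add: FG y)
  next
    fix y ys assume c: "composable N y ys"
    then have ys: "set ys \<subseteq> mArr N" and y: "y \<in> mArr N" by (simp_all add: composable_def)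
    have t: "map (mTgt M) (map (fArr G) ys) = map (fObj G) (map (mTgt N) ys)"
      using ys by (induction ys) (simp_all add: tgt)
    have c': "composable M (fArr G y) (map (fArr G) ys)"
      unfolding composable_def t using c ys y by (auto simp: composable_def src G_in)
    have "map (fArr F) (map (fArr G) ys) = ys"
      using ys by (induction ys) (simp_all add: FG)
    then show "fArr G (mComp N y ys) = mComp M (fArr G y) (map (fArr G) ys)"
      using F.fun_comp[OF c'] GF(2)[OF F.source.comp_arr[OF c']] y by (simp add: FG del: map_map)
  next
    show "fArr G (mId N x) = mId M (fObj G x)" if "x \<in> mObj N" for x
      using that F.fun_id[OF G_in(1)[OF that]] GF(2)[of "mId M (fObj G x)"]
      by (simp add: FG F.source.id_arr G_in)
    show "mfun_eq terminal_mc (G \<circ>\<^sub>m base N) (base M)"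
      using GF(1)[OF F.source.base_obj_in] GF(2)[OF F.source.base_arr(1)]
      by (simp add: mfun_eq_base_iff F.fun_base_obj F.fun_base_arr)
  qed (simp_all add: G_in src tgt)
  then show ?thesis
    using assms(1) GF FG by (auto simp: based_iso_def mfun_eq_def)
qed


section \<open>Calculus of basepoint arrows, and bilinear maps composed with multifunctors\<close>

section \<open>Bilinear maps\<close>

context based_multicategory begin

lemma base_id: "mId M (base_obj M) = base_arr M 1"
  using basepoint.fun_id[of "()"] by (simp add: base_arr_def base_obj_def terminal_mc_def)

lemma base_comp: "mComp M (base_arr M (length ms)) (map (base_arr M) ms) = base_arr M (sum_list ms)"
  using basepoint.fun_comp[of "length ms" ms]
  by (simp add: base_arr_def[abs_def] composable_def terminal_mc_def o_def map_replicate_const)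

lemma base_act: "\<sigma> permutes {..<n} \<Longrightarrow> mAct M \<sigma> (base_arr M n) = base_arr M n"
  using basepoint.fun_act[of n \<sigma>] by (simp add: base_arr_def terminal_mc_def arity_def)

text \<open>Supplies the slice at the basepoint of \<open>u\<close> in
  \<open>unitor_bilinear\<close>. Arities add under composition, just as basepoint arrows do by
  \<open>base_comp\<close>.\<close>

lemma const_based_multifunctor:
  assumes "based_multicategory N"
  shows "based_multifunctor N M \<lparr>fObj = \<lambda>_. base_obj M, fArr = \<lambda>f. base_arr M (arity N f)\<rparr>"
    (is "based_multifunctor _ _ ?F")
proof -
  interpret N: based_multicategory N by fact
  show ?thesis
  proof
    fix g fs assume c: "composable N g fs"
    have "arity N g = length (map (arity N) fs)" using c by (metis composable_def arity_def length_map)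
    moreover have "arity N (mComp N g fs) = sum_list (map (arity N) fs)"
      by (simp add: arity_def[abs_def] N.comp_src[OF c] length_concat o_def)
    ultimately show "fArr ?F (mComp N g fs) =
        mComp M (fArr ?F g)
          (map (fArr ?F) fs)"
      using base_comp[of "map (arity N) fs"] by (simp add: o_def)
  next
    fix f \<sigma> assume f: "f \<in> mArr N" "\<sigma> permutes {..<arity N f}"
    then have "arity N (mAct N \<sigma> f) = arity N f" by (simp add: arity_def N.act_src)
    then show "fArr ?F (mAct N \<sigma> f) =
        mAct M \<sigma> (fArr ?F f)"
      using f by (simp add: base_act)
  qed (simp_all add: base_obj_in base_arr N.id_src arity_def map_replicate_const base_id
      mfun_eq_base_iff N.base_arr)
qed

end

text \<open>Both sides of the interchange relation are well-formed smash terms by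
  \<open>eqv_props\<close>, and evaluating a well-formed composite along \<open>h\<close> gives a
  composable family in \<open>Q\<close>.\<close>

lemma (in bilinear) interchange_composable:
  assumes "\<phi> \<in> mArr M" "\<psi> \<in> mArr N"
  shows "composable Q (bArrR h (mTgt M \<phi>) \<psi>) (map (bArrL h \<phi>) (mSrc N \<psi>))"
    and "composable Q (bArrL h \<phi> (mTgt N \<psi>)) (map (\<lambda>a. bArrR h a \<psi>) (mSrc M \<phi>))"
    and "transpose_perm (arity M \<phi>) (arity N \<psi>) permutes
      {..<arity Q (mComp Q (bArrL h \<phi> (mTgt N \<psi>)) (map (\<lambda>a. bArrR h a \<psi>) (mSrc M \<phi>)))}"
proof -
  note p = eqv_props[OF eq_interchange[OF assms]]
  then have w: "wft (CompT (GenL \<phi> (mTgt N \<psi>)) (map (\<lambda>a. GenR a \<psi>) (mSrc M \<phi>)))"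
    by (simp add: st_wf_simps(6))
  show "composable Q (bArrR h (mTgt M \<phi>) \<psi>) (map (bArrL h \<phi>) (mSrc N \<psi>))"
    using ev_composable p by (fastforce simp: o_def)
  show "composable Q (bArrL h \<phi> (mTgt N \<psi>)) (map (\<lambda>a. bArrR h a \<psi>) (mSrc M \<phi>))"
    using ev_composable[OF w] by (simp add: o_def)
  have "transpose_perm (arity M \<phi>) (arity N \<psi>) permutes
      {..<length (src (CompT (GenL \<phi> (mTgt N \<psi>)) (map (\<lambda>a. GenR a \<psi>) (mSrc M \<phi>))))}"
    using p by (simp only: st_wf_simps(6))
  then show "transpose_perm (arity M \<phi>) (arity N \<psi>) permutes
      {..<arity Q (mComp Q (bArrL h \<phi> (mTgt N \<psi>)) (map (\<lambda>a. bArrR h a \<psi>) (mSrc M \<phi>)))}"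
    unfolding ev_arity[OF w, symmetric] by (simp add: o_def)
qed

text \<open>Applied to the universal bilinear map, this turns a module action into a bilinear map.
  Interchange survives because \<open>F\<close> preserves both composites and the
  permutation.\<close>

lemma bilinear_postcomp:
  assumes "bilinear M N Q h" "based_multifunctor Q P F"
  shows "bilinear M N P \<lparr>bObj = \<lambda>a b. fObj F (bObj h a b),
    bArrL = \<lambda>\<phi> b. fArr F (bArrL h \<phi> b), bArrR = \<lambda>a \<psi>. fArr F (bArrR h a \<psi>)\<rparr>" (is "bilinear _ _ _ ?h")
proof -
  interpret h: bilinear M N Q h by fact
  interpret F: based_multifunctor Q P F by fact
  show ?thesis
  proof (intro bilinear.intro bilinear_axioms.intro)
    fix \<phi> \<psi> assume p: "\<phi> \<in> mArr M" "\<psi> \<in> mArr N"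
    note c = h.interchange_composable[OF p]
    show "mComp P (bArrR ?h (mTgt M \<phi>) \<psi>)
        (map (bArrL ?h \<phi>) (mSrc N \<psi>)) =
      mAct P (transpose_perm (arity M \<phi>) (arity N \<psi>))
        (mComp P (bArrL ?h \<phi> (mTgt N \<psi>))
        (map (\<lambda>a. bArrR ?h a \<psi>) (mSrc M \<phi>)))"
      using F.fun_comp[OF c(1)] F.fun_comp[OF c(2)] h.bil_interchange[OF p]
        F.fun_act[OF h.target.comp_arr[OF c(2)] c(3)] by (simp add: o_def)
  next
    fix b assume "b \<in> mObj N"
    from based_multifunctor_comp[OF h.bil_left[OF this] assms(2)]
    show "based_multifunctor M P \<lparr>fObj = \<lambda>a. bObj ?h a b,
      fArr = \<lambda>\<phi>. bArrL ?h \<phi> b\<rparr>"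
      by (simp add: mfun_comp_def o_def)
  next
    fix a assume "a \<in> mObj M"
    from based_multifunctor_comp[OF h.bil_right[OF this] assms(2)]
    show "based_multifunctor N P \<lparr>fObj = bObj ?h a,
      fArr = bArrR ?h a\<rparr>"
      by (simp add: mfun_comp_def o_def)
  qed (simp_all add: h.bil_base_left h.bil_base_right F.fun_base_arr
      h.left.based_multicategory_axioms h.right.based_multicategory_axioms
      F.target.based_multicategory_axioms)
qed

text \<open>Used with \<open>E_unit\<close> in the second variable, to evaluate the unit axiom of a
  module. Interchange at \<open>\<psi>\<close> is that of \<open>h\<close> at
  \<open>fArr F \<psi>\<close>, which has the same arity.\<close>

lemma bilinear_precomp_right:
  assumes "bilinear M N Q h" "based_multifunctor P N F"
  shows "bilinear M P Q \<lparr>bObj = \<lambda>a b. bObj h a (fObj F b),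
    bArrL = \<lambda>\<phi> b. bArrL h \<phi> (fObj F b), bArrR = \<lambda>a \<psi>. bArrR h a (fArr F \<psi>)\<rparr>" (is "bilinear _ _ _ ?h")
proof -
  interpret h: bilinear M N Q h by fact
  interpret F: based_multifunctor P N F by fact
  show ?thesis
  proof (intro bilinear.intro bilinear_axioms.intro)
    fix a assume "a \<in> mObj M"
    from based_multifunctor_comp[OF assms(2) h.bil_right[OF this]]
    show "based_multifunctor P Q \<lparr>fObj = bObj ?h a,
      fArr = bArrR ?h a\<rparr>"
      by (simp add: mfun_comp_def o_def)
  next
    fix \<phi> \<psi> assume p: "\<phi> \<in> mArr M" "\<psi> \<in> mArr P"
    then show "mComp Q (bArrR ?h (mTgt M \<phi>) \<psi>)
        (map (bArrL ?h \<phi>) (mSrc P \<psi>)) =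
      mAct Q (transpose_perm (arity M \<phi>) (arity P \<psi>))
        (mComp Q (bArrL ?h \<phi> (mTgt P \<psi>))
        (map (\<lambda>a. bArrR ?h a \<psi>) (mSrc M \<phi>)))"
      using h.bil_interchange[OF p(1) F.fun_arr[OF p(2)]]
      by (simp add: o_def F.fun_src F.fun_tgt F.fun_arity)
  qed (simp_all add: h.bil_left h.bil_base_left h.bil_base_right F.fun_obj F.fun_arr F.fun_arity
      F.fun_base_obj h.left.based_multicategory_axioms F.source.based_multicategory_axioms
      h.target.based_multicategory_axioms)
qed


section \<open>The Eckmann-Hilton argument for operations coming from \<open>E\<close>\<close>

section \<open>Multifunctors out of E\<close>

lemma E_mc_simps [simp]:
  "mObj E_mc = {0, 1}" "mSrc E_mc \<psi> = fst \<psi>" "mTgt E_mc \<psi> = snd \<psi>" "mId E_mc a = ([a], a)"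
  "mComp E_mc \<psi> \<chi>s = (concat (map fst \<chi>s), snd \<psi>)"
  "mAct E_mc \<sigma> \<psi> = (permute_list \<sigma> (fst \<psi>), snd \<psi>)"
  "base_obj E_mc = 0" "base_arr E_mc n = (replicate n 0, 0)"
  by (simp_all add: E_mc_def base_obj_def base_arr_def)

lemma E_arr_iff [simp]:
  "(as, b) \<in> mArr E_mc \<longleftrightarrow> set as \<subseteq> {0, 1} \<and> b \<in> {0, 1} \<and> sum_list as = b"
  by (auto simp: E_mc_def)

text \<open>Natural numbers with sum 0 all vanish, so an arrow with target 0 is a basepoint arrow.
  Based multifunctors are fixed on those, and only target 1 needs an argument.\<close>

lemma E_arr_cases:
  assumes "\<psi> \<in> mArr E_mc"
  obtains (base) n where "\<psi> = base_arr E_mc n"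
  | (unital) as where "\<psi> = (as, 1)" "(as, 1) \<in> mArr E_mc"
proof (cases \<psi>)
  case (Pair as b)
  then have *: "b = 0 \<or> b = 1" "sum_list as = b" using assms by auto
  show thesis
  proof (cases "b = 0")
    case True
    then have "as = replicate (length as) 0" using * by (intro replicate_eqI) auto
    then show thesis using base[of "length as"] Pair True by simp
  qed (use * Pair assms unital in blast)
qed

text \<open>Exactly one entry is 1 and the others are 0, so entries are idempotent and the grid of
  products is diagonal.\<close>

lemma sum_list_1_mult:
  fixes as :: "nat list"
  assumes "sum_list as = 1" "i < length as" "j < length as"
  shows "as ! i * as ! j = (if i = j then as ! i else 0)"
proof -
  have s: "(\<Sum>k<length as. as ! k) = 1" using assms(1) by (simp add: sum_list_sum_nth atLeast0LessThan)
  have "as ! i \<le> 1" using member_le_sum[of i "{..<length as}" "(!) as"] s assms by simp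
  then have "as ! i = 0 \<or> as ! i = 1" by linarith
  moreover have "as ! i = 0 \<or> as ! j = 0" if "i \<noteq> j"
  proof -
    have "sum ((!) as) {i, j} \<le> (\<Sum>k<length as. as ! k)"
      using assms by (intro sum_mono2) auto
    then show ?thesis using s that by auto
  qed
  ultimately show ?thesis by auto
qed

lemma concat_map_if_eq: "i < n \<Longrightarrow> concat (map (\<lambda>j. if i = j then [c] else []) [0..<n]) = [c]"
proof (induction n)
  case (Suc n)
  have "concat (map (\<lambda>j. if i = j then [c] else []) [0..<n]) = []" if "i = n" using that by simp
  then show ?case using Suc by (cases "i = n") auto
qed simp

lemma concat_concat: "concat (concat xss) = concat (map concat xss)"
  by (induction xss) simp_all

lemma concat_diagonal:
  "concat (concat (map (\<lambda>i. map (\<lambda>j. if i = j then [f i] else []) [0..<n]) [0..<n])) = map f [0..<n]"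
proof -
  have "concat (concat (map (\<lambda>i. map (\<lambda>j. if i = j then [f i] else []) [0..<n]) [0..<n])) =
      concat (map (\<lambda>i. concat (map (\<lambda>j. if i = j then [f i] else []) [0..<n])) [0..<n])"
    by (simp add: concat_concat o_def)
  also have "\<dots> = concat (map (\<lambda>i. [f i]) [0..<n])"
    by (intro arg_cong[where f = concat] map_cong refl concat_map_if_eq) simp
  finally show ?thesis by simp
qed

lemma permutes_eq_id_if_permute_upt:
  assumes "p permutes {..<n}" "permute_list p [0..<n] = [0..<n]"
  shows "p = id"
proof
  fix i show "p i = id i"
  proof (cases "i < n")
    case True
    then show ?thesis using permute_list_nth[of p "[0..<n]" i] assms permutes_in_image[OF assms(1), of i] by simp
  qed (use assms(1) in \<open>simp add: permutes_def\<close>)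
qed

lemma permute_list_transpose_symmetric:
  assumes "\<And>i j. x i j = x j i"
  shows "permute_list (transpose_perm n n) (concat (map (\<lambda>i. map (x i) [0..<n]) [0..<n])) =
    concat (map (\<lambda>i. map (x i) [0..<n]) [0..<n])"
  unfolding permute_list_transpose_perm by (subst assms) (rule refl)

text \<open>Transposing a grid with one input in each diagonal block and none elsewhere moves only
  empty blocks, so the order of the inputs is unchanged. This removes the permutation of the
  interchange law in \<open>commuting_from_E_eq\<close>.\<close>

lemma block_perm_transpose_diagonal:
  "block_perm (transpose_perm n n)
    (concat (map (\<lambda>i. map (\<lambda>j. if i = j then 1 else 0) [0..<n]) [0..<n])) = id"
proof -
  \<comment> \<open>Labelling the diagonal input of row \<open>i\<close> by \<open>i\<close> makes
    the concatenated grid \<open>[0..<n]\<close>, a list that only the identity fixes.\<close>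
  let ?x = "\<lambda>i j :: nat. if i = j then [i] else []"
  let ?xss = "concat (map (\<lambda>i. map (?x i) [0..<n]) [0..<n])"
  let ?ms = "concat (map (\<lambda>i. map (\<lambda>j. if i = j then 1 else 0 :: nat) [0..<n]) [0..<n])"
  have ms: "?ms = map length ?xss" by (simp add: map_concat o_def if_distrib cong: if_cong)
  have t: "transpose_perm n n permutes {..<length ?xss}"
    using transpose_perm_permutes[of n n] by (simp add: length_concat o_def sum_list_triv)
  have c: "concat ?xss = [0..<n]" using concat_diagonal[of "\<lambda>i. i" n] by simp
  have "permute_list (block_perm (transpose_perm n n) ?ms) (concat ?xss) = concat (permute_list (transpose_perm n n) ?xss)"
    unfolding ms using t by (rule permute_list_block_perm)
  also have "permute_list (transpose_perm n n) ?xss = ?xss"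
    by (rule permute_list_transpose_symmetric) auto
  finally have "permute_list (block_perm (transpose_perm n n) ?ms) [0..<n] = [0..<n]" unfolding c .
  moreover have "block_perm (transpose_perm n n) ?ms permutes {..<n}"
  proof -
    have "sum_list ?ms = n" unfolding ms length_concat[symmetric] c by simp
    moreover have "transpose_perm n n permutes {..<length ?ms}" using t unfolding ms length_map .
    ultimately show ?thesis using block_perm_permutes by metis
  qed
  ultimately show ?thesis by (intro permutes_eq_id_if_permute_upt)
qed

locale based_multifunctor_from_E = based_multifunctor E_mc Q F
  for Q :: "('q, 'c, 'z) based_multicat_scheme" and F :: "(nat, nat list \<times> nat, 'q, 'c) mfun"
begin

text \<open>
  Multiplying the inputs of \<open>as\<close> by \<open>as ! i\<close> gives the arrow \<open>(as, 1)\<close> itself if \<open>as ! i = 1\<close> and the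
  basepoint arrow if \<open>as ! i = 0\<close>; in both cases its inputs other than \<open>i\<close> are the basepoint.
\<close>

lemma comp_row:
  assumes "(as, 1) \<in> mArr E_mc" "i < length as"
  defines "\<chi> \<equiv> fArr F (map ((*) (as ! i)) as, as ! i)"
  defines "row \<equiv> map (\<lambda>j. if i = j then mId Q (fObj F (as ! i)) else base_arr Q 0) [0..<length as]"
  shows "\<chi> \<in> mArr Q" "mTgt Q \<chi> = fObj F (as ! i)"
    "composable Q \<chi> row" "mComp Q \<chi> row = mId Q (fObj F (as ! i))"
proof -
  \<comment> \<open>The row is built in \<open>E\<close>, where an arrow is determined by its inputs
    and target, and then mapped along \<open>F\<close>: the unit at \<open>as ! i\<close> in
    position \<open>i\<close>, the nullary arrow \<open>([], 0)\<close> elsewhere.\<close>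
  let ?a = "as ! i" and ?row = "map (\<lambda>j. if i = j then ([as ! i], as ! i) else ([], 0)) [0..<length as]"
  have a: "?a \<in> {0, 1}" using assms(1,2) nth_mem[of i as] by (auto simp del: nth_mem)
  have m: "map ((*) ?a) as = map (\<lambda>j. if i = j then ?a else 0) [0..<length as]"
    using assms(1,2) sum_list_1_mult[of as i] by (intro nth_equalityI) auto
  have "sum_list (map ((*) ?a) as) = ?a" using assms(1) by (simp add: sum_list_const_mult)
  then have \<psi>: "(map ((*) ?a) as, ?a) \<in> mArr E_mc" using a assms(1) by auto
  show "\<chi> \<in> mArr Q" "mTgt Q \<chi> = fObj F ?a"
    unfolding \<chi>_def using fun_arr[OF \<psi>] fun_tgt[OF \<psi>] by simp_all
  have "set ?row \<subseteq> mArr E_mc" using a by auto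
  moreover have "map (mTgt E_mc) ?row = map ((*) ?a) as"
    unfolding m by (simp add: if_distrib cong: if_cong)
  ultimately have c: "composable E_mc (map ((*) ?a) as, ?a) ?row"
    using \<psi> by (simp add: composable_def del: E_arr_iff map_map)
  have id: "fArr F ([?a], ?a) = mId Q (fObj F ?a)" using fun_id[of ?a] a by simp
  have "fArr F ([], 0) = base_arr Q 0" using fun_base_arr[of 0] by simp
  then have row: "map (fArr F) ?row = row" using id by (simp add: row_def)
  show "composable Q \<chi> row" using fun_composable[OF c] by (simp only: row \<chi>_def)
  have "concat (map fst ?row) = [?a]"
    using concat_map_if_eq[OF assms(2), of ?a] by (simp add: o_def if_distrib cong: if_cong)
  then show "mComp Q \<chi> row = mId Q (fObj F ?a)"
    using fun_comp[OF c] row id by (simp add: \<chi>_def del: map_map)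
qed

end

text \<open>By \<open>comp_row\<close> each row of \<open>D\<close> collapses the matching arrow of
  \<open>\<chi>s\<close> to a unit. Associativity lets the rows act first, and
  \<open>fArr F (as, 1)\<close> with units plugged in remains.\<close>

lemma comp_comp_diagonal:
  assumes "based_multifunctor E_mc Q F" "based_multifunctor E_mc Q G"
    and 1: "fObj F 1 = fObj G 1" and as: "(as, 1) \<in> mArr E_mc"
  defines "\<chi>s \<equiv> map (\<lambda>a. fArr G (map ((*) a) as, a)) as"
  defines "D \<equiv> map (\<lambda>i. map (\<lambda>j. if i = j then mId Q (fObj F (as ! i)) else base_arr Q 0)
      [0..<length as]) [0..<length as]"
  shows "composable Q (fArr F (as, 1)) \<chi>s"
    and "composable Q (mComp Q (fArr F (as, 1)) \<chi>s) (concat D)"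
    and "mComp Q (mComp Q (fArr F (as, 1)) \<chi>s) (concat D) = fArr F (as, 1)"
proof -
  interpret F: based_multifunctor E_mc Q F by fact
  interpret G: based_multifunctor E_mc Q G by fact
  interpret G: based_multifunctor_from_E Q G by unfold_locales
  \<comment> \<open>Both send 0 to the basepoint and agree at 1, so they agree on all
    objects.\<close>
  have FG: "fObj G (as ! i) = fObj F (as ! i)" if "i < length as" for i
  proof -
    have "as ! i = 0 \<or> as ! i = 1" using as nth_mem[OF that] by auto
    then show ?thesis using 1 F.fun_base_obj G.fun_base_obj by auto
  qed
  have c: "composable Q (\<chi>s ! i) (D ! i)" "mComp Q (\<chi>s ! i) (D ! i) = mId Q (fObj F (as ! i))"
    "\<chi>s ! i \<in> mArr Q" "mTgt Q (\<chi>s ! i) = fObj F (as ! i)" if "i < length as" for i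
    using G.comp_row[OF as that] that by (simp_all add: \<chi>s_def D_def FG cong: if_cong)
  have l: "length \<chi>s = length as" "length D = length as" by (simp_all add: \<chi>s_def D_def)
  have "map (mTgt Q) \<chi>s = map (fObj F) as" using c l by (intro nth_equalityI) simp_all
  moreover have "set \<chi>s \<subseteq> mArr Q" using c(3) l by (auto simp: in_set_conv_nth)
  ultimately show C: "composable Q (fArr F (as, 1)) \<chi>s"
    using F.fun_arr[OF as] F.fun_src[OF as] by (simp add: composable_def)
  have "mComp Q (mComp Q (fArr F (as, 1)) \<chi>s) (concat D) = mComp Q (fArr F (as, 1)) (map2 (mComp Q) \<chi>s D)"
    using C l c(1) by (intro F.target.comp_assoc) simp_all
  also have "map2 (mComp Q) \<chi>s D = map (mId Q) (mSrc Q (fArr F (as, 1)))"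
    using c l F.fun_src[OF as] by (intro nth_equalityI) simp_all
  also have "mComp Q (fArr F (as, 1)) \<dots> = fArr F (as, 1)"
    using F.fun_arr[OF as] by (rule F.target.comp_id_right)
  finally show "mComp Q (mComp Q (fArr F (as, 1)) \<chi>s) (concat D) = fArr F (as, 1)" .
  have "map (map (mTgt Q)) D = map (mSrc Q) \<chi>s"
    using c(1) l by (intro nth_equalityI) (simp_all add: composable_def)
  moreover have "\<forall>fs \<in> set D. set fs \<subseteq> mArr Q"
    using c(1) l by (metis composable_def in_set_conv_nth)
  ultimately show "composable Q (mComp Q (fArr F (as, 1)) \<chi>s) (concat D)"
    using F.target.comp_arr[OF C] F.target.comp_src[OF C] by (auto simp: composable_def map_concat)
qed

text \<open>The diagonal grid is invariant under transposition. Substituting it into both sides of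
  \<open>commute\<close> leaves \<open>F\<close> on one side and \<open>G\<close> on the other, up
  to a block permutation that is the identity.\<close>

lemma commuting_from_E_eq:
  assumes F: "based_multifunctor E_mc Q F" and G: "based_multifunctor E_mc Q G"
    and 1: "fObj F 1 = fObj G 1" and as: "(as, 1) \<in> mArr E_mc"
    and commute: "mComp Q (fArr F (as, 1)) (map (\<lambda>a. fArr G (map ((*) a) as, a)) as) =
      mAct Q (transpose_perm (length as) (length as))
        (mComp Q (fArr G (as, 1)) (map (\<lambda>a. fArr F (map ((*) a) as, a)) as))"
  shows "fArr F (as, 1) = fArr G (as, 1)"
proof -
  interpret F: based_multifunctor E_mc Q F by fact
  interpret G: based_multifunctor E_mc Q G by fact
  let ?n = "length as"
  let ?x = "\<lambda>i j. if i = j then mId Q (fObj F (as ! i)) else base_arr Q 0"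
  let ?D = "concat (map (\<lambda>i. map (?x i) [0..<?n]) [0..<?n])"
  let ?g = "mComp Q (fArr G (as, 1)) (map (\<lambda>a. fArr F (map ((*) a) as, a)) as)"
  let ?t = "transpose_perm ?n ?n"
  have FG: "fObj G (as ! i) = fObj F (as ! i)" and in01: "as ! i \<in> {0, 1}" if "i < ?n" for i
  proof -
    show "as ! i \<in> {0, 1}" using as nth_mem[OF that] by auto
    then show "fObj G (as ! i) = fObj F (as ! i)" using 1 F.fun_base_obj G.fun_base_obj by auto
  qed
  \<comment> \<open>\<open>comp_comp_diagonal\<close> with exchanged roles has units at the values
    of \<open>G\<close>, which coincide with those of \<open>F\<close>.\<close>
  have D: "?D = concat (map (\<lambda>i. map (\<lambda>j. if i = j then mId Q (fObj G (as ! i)) else base_arr Q 0) [0..<?n]) [0..<?n])"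
    by (intro arg_cong[where f = concat] map_cong refl) (simp add: FG)
  have g: "composable Q ?g ?D" "mComp Q ?g ?D = fArr G (as, 1)"
    using comp_comp_diagonal(2,3)[OF G F 1[symmetric] as] unfolding D by simp_all
  have t: "?t permutes {..<length ?D}"
    using transpose_perm_permutes[of ?n ?n] by (simp add: length_concat o_def sum_list_triv)
  have tD: "permute_list ?t ?D = ?D" by (rule permute_list_transpose_symmetric) auto
  \<comment> \<open>Units are unary and \<open>base_arr Q 0\<close> is nullary, so the block sizes
    form the diagonal pattern of \<open>block_perm_transpose_diagonal\<close>.\<close>
  have ar: "map (arity Q) ?D = concat (map (\<lambda>i. map (\<lambda>j. if i = j then 1 else 0) [0..<?n]) [0..<?n])"
  proof -
    have "arity Q (?x i j) = (if i = j then 1 else 0)" if "i < ?n" for i j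
      using F.fun_obj[of "as ! i"] in01[OF that]
      by (auto simp: F.target.base_arr) (simp_all add: arity_def F.target.id_src)
    note x = this
    have "map (arity Q) ?D = concat (map (\<lambda>i. map (\<lambda>j. arity Q (?x i j)) [0..<?n]) [0..<?n])"
      by (simp add: map_concat o_def)
    also have "\<dots> = concat (map (\<lambda>i. map (\<lambda>j. if i = j then 1 else 0) [0..<?n]) [0..<?n])"
      by (intro arg_cong[where f = concat] map_cong refl x) simp
    finally show ?thesis .
  qed
  have "fArr F (as, 1) = mComp Q (mComp Q (fArr F (as, 1)) (map (\<lambda>a. fArr G (map ((*) a) as, a)) as)) ?D"
    using comp_comp_diagonal(3)[OF F G 1 as] by simp
  \<comment> \<open>Replacing the grid by its own transpose gives the composite the shape required
    by \<open>comp_act_outer\<close>.\<close>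
  also have "\<dots> = mComp Q (mAct Q ?t ?g) (permute_list ?t ?D)" unfolding commute tD ..
  also have "\<dots> = mAct Q (block_perm ?t (map (arity Q) ?D)) (mComp Q ?g ?D)"
    using g(1) t by (rule F.target.comp_act_outer)
  also have "\<dots> = fArr G (as, 1)"
    unfolding ar block_perm_transpose_diagonal g(2) using G.fun_arr[OF as] by (rule F.target.act_id)
  finally show ?thesis .
qed

text \<open>Fixing \<open>K 1\<close> in the first variable, or 1 in the second and precomposing
  with \<open>K\<close>, gives two based multifunctors out of \<open>E\<close> with the same value
  at 1. Interchange of \<open>fArr K \<psi>\<close> with \<open>\<psi>\<close> says that they
  commute.\<close>

lemma bilinear_E_right:
  assumes "bilinear M E_mc Q h" "based_multifunctor E_mc M K" "\<psi> \<in> mArr E_mc"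
  shows "bArrR h (fObj K 1) \<psi> = bArrL h (fArr K \<psi>) 1"
proof -
  interpret h: bilinear M E_mc Q h by fact
  interpret K: based_multifunctor E_mc M K by fact
  have K1: "fObj K 1 \<in> mObj M" by (rule K.fun_obj) simp
  show ?thesis
    using assms(3)
  proof (cases rule: E_arr_cases)
    case (base n)
    then show ?thesis
      using K1 h.bArr_base by (simp only: K.fun_base_arr) simp
  next
    case (unital as)
    let ?F = "\<lparr>fObj = bObj h (fObj K 1), fArr = bArrR h (fObj K 1)\<rparr>"
    let ?G = "\<lparr>fObj = \<lambda>a. bObj h a 1, fArr = \<lambda>\<phi>. bArrL h \<phi> 1\<rparr> \<circ>\<^sub>m K"
    have F: "based_multifunctor E_mc Q ?F" using K1 by (rule h.bil_right)
    have G: "based_multifunctor E_mc Q ?G"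
      by (intro based_multifunctor_comp[OF assms(2)] h.bil_left) simp
    note a = unital(2)
    define k where "k = fArr K (as, 1)"
    have K: "k \<in> mArr M" "mSrc M k = map (fObj K) as" "mTgt M k = fObj K 1" "arity M k = length as"
      using K.fun_arr[OF a] K.fun_src[OF a] K.fun_tgt[OF a] by (simp_all add: arity_def k_def)
    have "map ((*) 0) as = replicate (length as) 0" by (rule nth_equalityI) simp_all
    then have z: "(map ((*) 0) as, 0) = base_arr E_mc (length as)" by simp
    have o: "map ((*) 1) as = as" by (rule nth_equalityI) simp_all
    \<comment> \<open>Interchange evaluates \<open>k\<close> at the inputs \<open>b\<close> of
      \<open>as\<close>, while the commutation needs arrows evaluated at 1. At \<open>b = 0\<close>
      both are basepoint arrows, and at \<open>b = 1\<close> nothing changes.\<close>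
    have L: "bArrL h k b = bArrL h (fArr K (map ((*) b) as, b)) 1" if "b \<in> set as" for b
    proof -
      have "b = 0 \<or> b = 1" using a that by auto
      then show ?thesis
      proof
        assume b: "b = 0"
        show ?thesis unfolding b z K.fun_base_arr
          using h.bil_base_right[OF K(1)] h.bArr_base(1)[of 1 "length as"] by (simp add: K(4))
      next
        assume b: "b = 1"
        show ?thesis unfolding b o k_def ..
      qed
    qed
    \<comment> \<open>The same exchange in the other variable: the factor \<open>b\<close> moves
      from the object into the arrow of \<open>E\<close>.\<close>
    have R: "bArrR h (fObj K b) (as, 1) = bArrR h (fObj K 1) (map ((*) b) as, b)" if "b \<in> set as" for b
    proof -
      have "b = 0 \<or> b = 1" using a that by auto
      then show ?thesis
      proof
        assume b: "b = 0"
        show ?thesis unfolding b z h.bArr_base(2)[OF K1]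
          using h.bil_base_left[OF a] K.fun_base_obj by (simp add: arity_def)
      next
        assume b: "b = 1"
        show ?thesis unfolding b o ..
      qed
    qed
    have Ls: "map (bArrL h k) as = map (\<lambda>a. bArrL h (fArr K (map ((*) a) as, a)) 1) as"
      by (intro map_cong refl L)
    have Rs: "map (\<lambda>a. bArrR h a (as, 1)) (mSrc M k) = map (\<lambda>a. bArrR h (fObj K 1) (map ((*) a) as, a)) as"
      unfolding K list.map_comp comp_def by (intro map_cong refl R)
    have "arity E_mc (as, 1) = length as" by (simp add: arity_def)
    then have "mComp Q (fArr ?F (as, 1)) (map (\<lambda>a. fArr ?G (map ((*) a) as, a)) as) =
      mAct Q (transpose_perm (length as) (length as))
        (mComp Q (fArr ?G (as, 1)) (map (\<lambda>a. fArr ?F (map ((*) a) as, a)) as))"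
      using h.bil_interchange[OF K(1) a] unfolding E_mc_simps fst_conv snd_conv Ls Rs
      unfolding mfun_comp_simps mfun.simps K(3,4) k_def[symmetric] by simp
    from commuting_from_E_eq[OF F G _ a this] show ?thesis using unital(1) by simp
  qed
qed

section \<open>The unit object \<open>u\<close> and the bilinear map behind the right unitor\<close>

section \<open>The unit of the smash product\<close>

lemma unit_mc_simps [simp]:
  "mObj unit_mc = UNIV" "mArr unit_mc = UNIV"
  "mSrc unit_mc (Inl n) = replicate n (Inl ())" "mSrc unit_mc (Inr u) = [Inr ()]"
  "mTgt unit_mc (Inl n) = Inl ()" "mTgt unit_mc (Inr u) = Inr ()"
  "mId unit_mc (Inl u) = Inl 1" "mId unit_mc (Inr u) = Inr ()"
  "mComp unit_mc (Inl n) fs = Inl (sum_list (map projl fs))" "mComp unit_mc (Inr u) fs = Inr ()"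
  "base_obj unit_mc = Inl ()" "base_arr unit_mc n = Inl n"
  by (simp_all add: unit_mc_def coprod_mc_def terminal_mc_def point_mc_def multicat.defs
      based_multicat.defs base_obj_def base_arr_def split: sum.split)

lemma mAct_unit_mc [simp]: "mAct unit_mc \<sigma> f = f"
  by (cases f) (simp_all add: unit_mc_def coprod_mc_def terminal_mc_def point_mc_def multicat.defs)

lemma arity_unit_mc [simp]: "arity unit_mc (Inl n) = n" "arity unit_mc (Inr u) = 1"
  by (simp_all add: arity_def)

text \<open>The target of an arrow reveals its summand, so a composable family never mixes the
  basepoint part with \<open>[0]\<close>.\<close>

lemma composable_unit_mc:
  "composable unit_mc (Inl n) fs \<longleftrightarrow> (\<exists>ms. fs = map Inl ms \<and> length ms = n)"
  "composable unit_mc (Inr u) fs \<longleftrightarrow> fs = [Inr ()]"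
proof -
  have t: "mTgt unit_mc f = (case f of Inl _ \<Rightarrow> Inl () | Inr _ \<Rightarrow> Inr ())" for f
    by (simp split: sum.split)
  show "composable unit_mc (Inl n) fs \<longleftrightarrow> (\<exists>ms. fs = map Inl ms \<and> length ms = n)"
  proof
    assume "composable unit_mc (Inl n) fs"
    then have m: "map (mTgt unit_mc) fs = replicate n (Inl ())" by (simp add: composable_def)
    have "f = Inl (projl f)" if "f \<in> set fs" for f
    proof -
      have "mTgt unit_mc f \<in> set (map (mTgt unit_mc) fs)" using that by simp
      then show ?thesis unfolding m t by (auto split: sum.splits)
    qed
    then have "fs = map Inl (map projl fs)" by (auto simp: o_def intro: map_idI[symmetric])
    moreover have "length fs = n" using arg_cong[OF m, of length] by simp
    ultimately show "\<exists>ms. fs = map Inl ms \<and> length ms = n" by (metis length_map)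
  qed (auto simp: composable_def o_def map_replicate_const)
  show "composable unit_mc (Inr u) fs \<longleftrightarrow> fs = [Inr ()]"
    by (auto simp: composable_def t split: sum.splits)
qed

lemma unit_multicategory: "multicategory unit_mc"
proof
  fix f \<sigma> assume "\<sigma> permutes {..<arity unit_mc f}"
  then show "mSrc unit_mc (mAct unit_mc \<sigma> f) = permute_list \<sigma> (mSrc unit_mc f)"
    by (cases f) (simp_all add: permute_list_replicate lessThan_Suc)
next
  fix g fs assume c: "composable unit_mc g fs"
  then show "mSrc unit_mc (mComp unit_mc g fs) = concat (map (mSrc unit_mc) fs)"
  proof (cases g)
    case (Inl n)
    then obtain ms where "fs = map Inl ms" using c composable_unit_mc by blast
    moreover have "replicate (sum_list ms) x = concat (map (\<lambda>m. replicate m x) ms)" for x :: "unit + unit"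
      by (induction ms) (simp_all add: replicate_add)
    ultimately show ?thesis using Inl by (simp add: o_def)
  qed (use c composable_unit_mc in simp)
  show "mTgt unit_mc (mComp unit_mc g fs) = mTgt unit_mc g" by (cases g) simp_all
  {
    fix \<sigma> assume s: "\<sigma> permutes {..<length fs}"
    show "mComp unit_mc (mAct unit_mc \<sigma> g) (permute_list \<sigma> fs) =
        mAct unit_mc (block_perm \<sigma> (map (arity unit_mc) fs)) (mComp unit_mc g fs)"
      using mset_permute_list[of \<sigma> "map projl fs"] s
      by (cases g) (simp_all add: permute_list_map[symmetric] flip: sum_mset_sum_list mset_map)
  next
    fix \<tau>s :: "(nat \<Rightarrow> nat) list" assume "length \<tau>s = length fs"
    then have "map2 (mAct unit_mc) \<tau>s fs = fs" by (intro nth_equalityI) simp_all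
    then show "mComp unit_mc g (map2 (mAct unit_mc) \<tau>s fs) =
        mAct unit_mc (sum_perm \<tau>s (map (arity unit_mc) fs)) (mComp unit_mc g fs)" by simp
  }
next
  fix h gs fss
  assume c: "composable unit_mc h gs" and l: "length fss = length gs"
    and c2: "\<And>i. i < length gs \<Longrightarrow> composable unit_mc (gs ! i) (fss ! i)"
  show "mComp unit_mc (mComp unit_mc h gs) (concat fss) = mComp unit_mc h (map2 (mComp unit_mc) gs fss)"
  proof (cases h)
    case (Inl n)
    then obtain ms where gs: "gs = map Inl ms" using c composable_unit_mc by blast
    have "map projl (map2 (mComp unit_mc) gs fss) = map (\<lambda>fs. sum_list (map projl fs)) fss"
      using l gs by (intro nth_equalityI) simp_all
    moreover have "sum_list (map projl (concat fss)) = sum_list (map (\<lambda>fs. sum_list (map projl fs)) fss)"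
      by (induction fss) simp_all
    ultimately show ?thesis using gs Inl by (simp del: map_map)
  qed simp
next
  fix f
  show "mComp unit_mc f (map (mId unit_mc) (mSrc unit_mc f)) = f"
    by (cases f) (simp_all add: sum_list_replicate)
  show "mComp unit_mc (mId unit_mc (mTgt unit_mc f)) [f] = f"
    by (cases f) simp_all
next
  fix a :: "unit + unit"
  show "mSrc unit_mc (mId unit_mc a) = [a]" "mTgt unit_mc (mId unit_mc a) = a"
    by (cases a; simp)+
qed simp_all

lemma unit_based: "based_multicategory unit_mc"
proof -
  interpret T: multicategory terminal_mc by (rule terminal_multicategory)
  interpret U: multicategory unit_mc by (rule unit_multicategory)
  have b: "base unit_mc = \<lparr>fObj = Inl, fArr = Inl\<rparr>"
    by (simp add: unit_mc_def multicat.defs based_multicat.defs)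
  show ?thesis
    by unfold_locales (simp_all add: b terminal_mc_def o_def)
qed

context based_multicategory begin

lemma base_comp_const:
  "mComp M (base_arr M n) (map (\<lambda>_. base_arr M k) xs) = base_arr M (n * k)" if "length xs = n"
  using base_comp[of "replicate n k"] that by (simp add: map_replicate_const sum_list_replicate)

text \<open>Besides the basepoint, \<open>u\<close> is free on one object, so any \<open>a\<close>
  defines such a multifunctor. It is a slice of the unitor and, for the object 1 of
  \<open>E\<close>, gives \<open>E_unit\<close>.\<close>

lemma from_unit_based_multifunctor:
  assumes a: "a \<in> mObj M"
  shows "based_multifunctor unit_mc M \<lparr>fObj = case_sum (\<lambda>_. base_obj M) (\<lambda>_. a),
    fArr = case_sum (base_arr M) (\<lambda>_. mId M a)\<rparr>" (is "based_multifunctor _ _ ?F")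
proof -
  interpret U: based_multicategory unit_mc by (rule unit_based)
  show ?thesis
  proof
    fix g fs assume c: "composable unit_mc g fs"
    show "fArr ?F (mComp unit_mc g fs) = mComp M (fArr ?F g) (map (fArr ?F) fs)"
    proof (cases g)
      case (Inl n)
      then obtain ms where "fs = map Inl ms" "length ms = n" using c composable_unit_mc(1) by blast
      then show ?thesis using base_comp[of ms] Inl by (simp add: o_def)
    next
      case (Inr u)
      then have "fs = [Inr ()]" using c composable_unit_mc(2) by simp
      then show ?thesis using comp_id_left[OF id_arr[OF a]] a by (simp add: Inr id_tgt)
    qed
  next
    fix f \<sigma> assume "\<sigma> permutes {..<arity unit_mc f}"
    then show "fArr ?F (mAct unit_mc \<sigma> f) = mAct M \<sigma> (fArr ?F f)"
      using act_id[OF id_arr[OF a]] by (cases f) (simp_all add: base_act lessThan_Suc)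
  next
    fix x :: "unit + unit"
    show "fObj ?F x \<in> mObj M" "fArr ?F (mId unit_mc x) = mId M (fObj ?F x)"
      by (cases x; simp add: a base_obj_in base_id)+
  next
    fix f :: "nat + unit"
    show "fArr ?F f \<in> mArr M" "mSrc M (fArr ?F f) = map (fObj ?F) (mSrc unit_mc f)"
      "mTgt M (fArr ?F f) = fObj ?F (mTgt unit_mc f)"
      by (cases f; simp add: a base_arr id_arr id_src id_tgt)+
  qed (simp_all add: mfun_eq_base_iff)
qed

end

text \<open>A grid with a single column reads the same by rows and by columns. This settles
  interchange with the unary arrow of \<open>[0]\<close>.\<close>

lemma transpose_perm_1: "transpose_perm k 1 = id"
proof (rule permutes_eq_id_if_permute_upt)
  show "transpose_perm k 1 permutes {..<k}" using transpose_perm_permutes[of k 1] by simp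
  show "permute_list (transpose_perm k 1) [0..<k] = [0..<k]"
    using permute_list_transpose_perm[of k 1 "\<lambda>i _. i"] by simp
qed

text \<open>\<open>smash_unitor\<close> is the lift of this map, and bilinearity makes the rules for
  \<open>smash_lift\<close> available. A second argument in the basepoint part yields basepoint
  values; one in \<open>[0]\<close> yields units or the first argument itself.\<close>

lemma unitor_bilinear:
  assumes "based_multicategory M"
  shows "bilinear M unit_mc M
    \<lparr>bObj = (\<lambda>a. case_sum (\<lambda>_. base_obj M) (\<lambda>_. a)),
     bArrL = (\<lambda>\<phi>. case_sum (\<lambda>_. base_arr M (arity M \<phi>)) (\<lambda>_. \<phi>)),
     bArrR = (\<lambda>a. case_sum (\<lambda>n. base_arr M n) (\<lambda>_. mId M a))\<rparr>" (is "bilinear _ _ _ ?h")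
proof -
  interpret M: based_multicategory M by fact
  show ?thesis
  proof (intro bilinear.intro bilinear_axioms.intro)
    fix b :: "unit + unit"
    show "based_multifunctor M M \<lparr>fObj = \<lambda>a. bObj ?h a b, fArr = \<lambda>\<phi>. bArrL ?h \<phi> b\<rparr>"
      using M.const_based_multifunctor[OF assms] based_multifunctor_id[OF assms]
      by (cases b) (simp_all add: mfun_id_def id_def)
  next
    fix a assume "a \<in> mObj M"
    from M.from_unit_based_multifunctor[OF this]
    show "based_multifunctor unit_mc M \<lparr>fObj = bObj ?h a, fArr = bArrR ?h a\<rparr>" by simp
  next
    fix \<psi>
    show "bArrR ?h (base_obj M) \<psi> = base_arr M (arity unit_mc \<psi>)"
      by (cases \<psi>) (simp_all add: M.base_id)
  next
    fix \<phi> \<psi> assume p: "\<phi> \<in> mArr M"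
    show "mComp M (bArrR ?h (mTgt M \<phi>) \<psi>) (map (bArrL ?h \<phi>) (mSrc unit_mc \<psi>)) =
        mAct M (transpose_perm (arity M \<phi>) (arity unit_mc \<psi>))
          (mComp M (bArrL ?h \<phi> (mTgt unit_mc \<psi>)) (map (\<lambda>a. bArrR ?h a \<psi>) (mSrc M \<phi>)))"
    proof (cases \<psi>)
      case (Inl n)
      \<comment> \<open>Both composites are the basepoint arrow of arity
        \<open>arity M \<phi> * n\<close>, which every permutation fixes.\<close>
      have "transpose_perm (arity M \<phi>) n permutes {..<arity M \<phi> * n}" by (rule transpose_perm_permutes)
      then show ?thesis
        using M.base_comp_const[of "replicate n ()" n "arity M \<phi>"]
          M.base_comp_const[of "mSrc M \<phi>" "arity M \<phi>" n]
        by (simp add: Inl arity_def M.base_act mult.commute map_replicate_const)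
    next
      case (Inr u)
      then show ?thesis
        using p M.comp_id_left[OF p] M.comp_id_right[OF p] M.act_id[OF p]
        by (simp add: transpose_perm_1[unfolded One_nat_def])
    qed
  qed (simp_all add: assms unit_based)
qed

lemma E_unit_based_multifunctor: "based_multifunctor unit_mc E_mc E_unit"
proof -
  interpret E: based_multicategory E_mc by (rule E_based)
  show ?thesis
    using E.from_unit_based_multifunctor[of 1]
    unfolding E_unit_def by (simp add: E_mc_simps(8)[abs_def] del: E_mc_simps(8))
qed


section \<open>The transpose of a bilinear map, with values in the internal hom\<close>

section \<open>Currying\<close>

text \<open>Restricted to the carriers because the objects of \<open>hom_mc\<close> are extensional
  records.\<close>

definition curry_obj ::
    "('p, 'b, 'y) based_multicat_scheme \<Rightarrow> ('o, 'a, 'p, 'b, 'q, 'c) bimap \<Rightarrow> 'o \<Rightarrow> ('p, 'b, 'q, 'c) mfun" where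
  "curry_obj N h a = \<lparr>fObj = (\<lambda>b \<in> mObj N. bObj h a b), fArr = (\<lambda>\<psi> \<in> mArr N. bArrR h a \<psi>)\<rparr>"

definition curry_mfun ::
    "('o, 'a, 'x) based_multicat_scheme \<Rightarrow> ('p, 'b, 'y) based_multicat_scheme \<Rightarrow>
     ('o, 'a, 'p, 'b, 'q, 'c) bimap \<Rightarrow>
     ('o, 'a, ('p, 'b, 'q, 'c) mfun, ('p, 'b, 'q, 'c) hom_arrow) mfun" where
  "curry_mfun M N h = \<lparr>fObj = curry_obj N h,
     fArr = (\<lambda>\<phi>. (map (curry_obj N h) (mSrc M \<phi>), curry_obj N h (mTgt M \<phi>),
       \<lambda>b \<in> mObj N. bArrL h \<phi> b))\<rparr>"

context bilinear begin

abbreviation "C \<equiv> curry_mfun M N h"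

lemma curry_obj_in: "a \<in> mObj M \<Longrightarrow> curry_obj N h a \<in> based_multifunctors N Q"
  unfolding based_multifunctors_def
  by (auto simp: curry_obj_def mfun_eq_def intro!: based_multifunctor_cong[OF bil_right])

text \<open>Up to restriction to the carriers, interchange for \<open>h\<close> is the compatibility
  condition on the components, and \<open>bil_base_right\<close> is the condition at the
  basepoint.\<close>

lemma curry_arr_in:
  assumes \<phi>: "\<phi> \<in> mArr M"
  shows "fArr C \<phi> \<in> hom_arrows N Q"
proof -
  have "mSrc Q (bArrL h \<phi> b) = map (\<lambda>F. fObj F b) (map (curry_obj N h) (mSrc M \<phi>))"
    if "b \<in> mObj N" for b
    using that multifunctor.fun_src[OF bl[OF that] \<phi>] by (simp add: curry_obj_def o_def)
  moreover have "bArrL h \<phi> b \<in> mArr Q" "mTgt Q (bArrL h \<phi> b) = fObj (curry_obj N h (mTgt M \<phi>)) b"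
    if "b \<in> mObj N" for b
    using that multifunctor.fun_arr[OF bl[OF that] \<phi>] multifunctor.fun_tgt[OF bl[OF that] \<phi>]
    by (simp_all add: curry_obj_def)
  moreover have "mComp Q (fArr (curry_obj N h (mTgt M \<phi>)) \<psi>)
        (map (\<lambda>b \<in> mObj N. bArrL h \<phi> b) (mSrc N \<psi>)) =
      mAct Q (transpose_perm (length (map (curry_obj N h) (mSrc M \<phi>))) (arity N \<psi>))
        (mComp Q ((\<lambda>b \<in> mObj N. bArrL h \<phi> b) (mTgt N \<psi>))
          (map (\<lambda>F. fArr F \<psi>) (map (curry_obj N h) (mSrc M \<phi>))))"
    if \<psi>: "\<psi> \<in> mArr N" for \<psi>
  proof -
    have "map (\<lambda>b \<in> mObj N. bArrL h \<phi> b) (mSrc N \<psi>) = map (bArrL h \<phi>) (mSrc N \<psi>)"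
      using right.src_closed[OF \<psi>] by (intro map_cong) auto
    then show ?thesis
      using bil_interchange[OF \<phi> \<psi>] \<psi> right.tgt_closed[OF \<psi>]
      by (simp add: curry_obj_def o_def arity_def del: map_eq_conv)
  qed
  ultimately show ?thesis
    unfolding hom_arrows_def curry_mfun_def
    using left.src_closed[OF \<phi>] left.tgt_closed[OF \<phi>] curry_obj_in bil_base_right[OF \<phi>]
    by (auto simp: right.base_obj_in arity_def)
qed

text \<open>The operations of \<open>hom_mc\<close> are componentwise, so each law reduces to
  functoriality of \<open>h\<close> in the first variable at a fixed object of \<open>N\<close>.
  Bijectivity lets \<open>hom_mc N Q\<close> inherit the multicategory axioms from
  \<open>M\<close>.\<close>

lemma curry_iso:
  assumes obj: "bij_betw (curry_obj N h) (mObj M) (based_multifunctors N Q)"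
    and arr: "bij_betw (fArr C) (mArr M) (hom_arrows N Q)"
  shows "based_iso M (hom_mc N Q) C"
proof -
  let ?H = "hom_mc N Q"
  have arrC: "fArr C \<phi> = (map (curry_obj N h) (mSrc M \<phi>), curry_obj N h (mTgt M \<phi>),
       \<lambda>b \<in> mObj N. bArrL h \<phi> b)" for \<phi>
    by (simp add: curry_mfun_def)
  have "multifunctor M ?H C"
  proof (rule multifunctor_transport)
    show "multicategory M" by unfold_locales
    show "bij_betw (fObj C) (mObj M) (mObj ?H)" "fArr C ` mArr M = mArr ?H"
      using obj arr by (simp_all add: curry_mfun_def hom_mc_def bij_betw_def)
    show "mSrc ?H (fArr C f) = map (fObj C) (mSrc M f)" "mTgt ?H (fArr C f) = fObj C (mTgt M f)" for f
      by (simp_all add: curry_mfun_def hom_mc_def)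
    show "fArr C (mId M a) = mId ?H (fObj C a)" if a: "a \<in> mObj M" for a
    proof -
      have "bArrL h (mId M a) b = mId Q (bObj h a b)" if "b \<in> mObj N" for b
        using multifunctor.fun_id[OF bl[OF that] a] by simp
      then show ?thesis using a
        by (auto simp: curry_mfun_def hom_mc_def curry_obj_def left.id_src left.id_tgt)
    qed
    show "fArr C (mComp M g fs) = mComp ?H (fArr C g) (map (fArr C) fs)"
      if c: "composable M g fs" for g fs
    proof -
      have "bArrL h (mComp M g fs) b = mComp Q (bArrL h g b) (map (\<lambda>f. bArrL h f b) fs)"
        if "b \<in> mObj N" for b
        using multifunctor.fun_comp[OF bl[OF that] c] by (simp add: o_def)
      then show ?thesis
        unfolding arrC hom_mc_def
        by (auto simp: left.comp_src[OF c] left.comp_tgt[OF c] map_concat o_def)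
    qed
    show "fArr C (mAct M \<sigma> f) = mAct ?H \<sigma> (fArr C f)"
      if f: "f \<in> mArr M" "\<sigma> permutes {..<arity M f}" for f \<sigma>
    proof -
      have "bArrL h (mAct M \<sigma> f) b = mAct Q \<sigma> (bArrL h f b)" if "b \<in> mObj N" for b
        using multifunctor.fun_act[OF bl[OF that] f] by simp
      then show ?thesis
        using f unfolding arrC hom_mc_def
        by (auto simp: left.act_src left.act_tgt permute_list_map arity_def)
    qed
  qed
  then interpret C: multifunctor M ?H C .
  have base_obj: "curry_obj N h (base_obj M) = const_base N Q"
    by (auto simp: curry_obj_def const_base_def bObj_base bil_base_left)
  have base_arr: "fArr C (base_arr M n) =
      (replicate n (const_base N Q), const_base N Q, \<lambda>b \<in> mObj N. base_arr Q n)" for n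
    unfolding arrC by (auto simp: left.base_arr base_obj bArr_base)
  \<comment> \<open>The basepoint of the hom is the image of that of \<open>M\<close>, hence a
    multifunctor as a composite.\<close>
  have base: "base ?H = C \<circ>\<^sub>m base M"
    using base_obj base_arr
    by (simp add: hom_mc_def mfun_comp_def curry_mfun_def base_obj_def base_arr_def fun_eq_iff o_def)
  have "multifunctor terminal_mc ?H (base ?H)"
    unfolding base using left.basepoint.multifunctor_axioms C.multifunctor_axioms
    by (rule multifunctor_comp)
  then interpret H: based_multicategory ?H
    by (intro based_multicategory.intro C.target.multicategory_axioms)
  have "based_multifunctor M ?H C"
    by unfold_locales (simp add: base mfun_eq_def)
  then show ?thesis
    using obj arr by (intro based_iso_bij_betw) (simp_all add: hom_mc_def curry_mfun_def)
qed

end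

section \<open>The two isomorphisms, with the hom and with the smash product\<close>

section \<open>E-modules\<close>

text \<open>Evaluate the unit axiom on generators with second entry \<open>Inr ()\<close>:
  \<open>E_unit\<close> sends this object to 1, and the unitor returns the first entry.\<close>

lemma E_module_unit:
  assumes "E_module M \<mu>"
  shows "a \<in> mObj M \<Longrightarrow> fObj \<mu> (bObj (smash_univ M E_mc) a 1) = a"
    and "\<phi> \<in> mArr M \<Longrightarrow> fArr \<mu> (bArrL (smash_univ M E_mc) \<phi> 1) = \<phi>"
proof -
  interpret mu: smash_module E_mc E_mult E_unit M \<mu> by fact
  interpret E: based_multicategory E_mc by (rule E_based)
  interpret f: smash_factors M E_mc by unfold_locales
  let ?h = "\<lparr>bObj = \<lambda>a b. bObj (smash_univ M E_mc) a (fObj E_unit b),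
    bArrL = \<lambda>\<phi> b. bArrL (smash_univ M E_mc) \<phi> (fObj E_unit b),
    bArrR = \<lambda>a \<psi>. bArrR (smash_univ M E_mc) a (fArr E_unit \<psi>)\<rparr>"
  let ?r = "\<lparr>bObj = (\<lambda>a. case_sum (\<lambda>_ :: unit. base_obj M) (\<lambda>_ :: unit. a)),
     bArrL = (\<lambda>\<phi>. case_sum (\<lambda>_. base_arr M (arity M \<phi>)) (\<lambda>_. \<phi>)),
     bArrR = (\<lambda>a. case_sum (\<lambda>n. base_arr M n) (\<lambda>_ :: unit. mId M a))\<rparr>"
  interpret h: bilinear M unit_mc "smash M E_mc" ?h
    using f.smash_univ_bilinear E_unit_based_multifunctor by (rule bilinear_precomp_right)
  interpret r: bilinear M unit_mc M ?r
    using mu.action.target.based_multicategory_axioms by (rule unitor_bilinear)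
  \<comment> \<open>Both sides of the axiom now involve lifts of bilinear maps, which
    \<open>smash_lift_univ\<close> computes on generators.\<close>
  have map: "smash_map M E_mc mfun_id E_unit = smash_lift (smash M E_mc) ?h"
    by (simp add: smash_map_def smash_univ_def)
  have unit: "mfun_eq (smash M unit_mc) (\<mu> \<circ>\<^sub>m smash_lift (smash M E_mc) ?h) (smash_lift M ?r)"
    using mu.action_unit unfolding map smash_unitor_def .
  have unitO: "fObj \<mu> (fObj (smash_lift (smash M E_mc) ?h) x) = fObj (smash_lift M ?r) x"
    if "x \<in> mObj (smash M unit_mc)" for x
    using unit that by (simp add: mfun_eq_def)
  have unitA: "fArr \<mu> (fArr (smash_lift (smash M E_mc) ?h) f) = fArr (smash_lift M ?r) f"
    if "f \<in> mArr (smash M unit_mc)" for f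
    using unit that by (simp add: mfun_eq_def)
  have i: "Inr () \<in> mObj unit_mc" by simp
  interpret u: bilinear M unit_mc "smash M unit_mc" "smash_univ M unit_mc"
    by (rule h.smash_univ_bilinear)
  have e: "fObj E_unit (Inr ()) = 1" by (simp add: E_unit_def)
  show "fObj \<mu> (bObj (smash_univ M E_mc) a 1) = a" if a: "a \<in> mObj M"
  proof -
    have "bObj (smash_univ M unit_mc) a (Inr ()) \<in> mObj (smash M unit_mc)"
      using multifunctor.fun_obj[OF u.bl a, of "Inr ()"] by simp
    then show ?thesis
      using unitO[of "bObj (smash_univ M unit_mc) a (Inr ())"]
      unfolding h.smash_lift_univ(1)[OF a i] r.smash_lift_univ(1)[OF a i] by (simp add: e)
  qed
  show "fArr \<mu> (bArrL (smash_univ M E_mc) \<phi> 1) = \<phi>" if \<phi>: "\<phi> \<in> mArr M"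
  proof -
    have "bArrL (smash_univ M unit_mc) \<phi> (Inr ()) \<in> mArr (smash M unit_mc)"
      using multifunctor.fun_arr[OF u.bl \<phi>, of "Inr ()"] by simp
    then show ?thesis
      using unitA[of "bArrL (smash_univ M unit_mc) \<phi> (Inr ())"]
      unfolding h.smash_lift_univ(2)[OF \<phi> i] r.smash_lift_univ(2)[OF \<phi> i] by (simp add: e)
  qed
qed

text \<open>Evaluation at 1 is a left inverse by \<open>obj1\<close> and \<open>arr1\<close>. It is
  a right inverse because multifunctors out of \<open>E\<close>, and the arrows between them, are
  determined at 1.\<close>

lemma hom_iso:
  assumes "bilinear M E_mc M h"
    and obj1: "\<And>a. a \<in> mObj M \<Longrightarrow> bObj h a 1 = a"
    and arr1: "\<And>\<phi>. \<phi> \<in> mArr M \<Longrightarrow> bArrL h \<phi> 1 = \<phi>"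
  shows "based_iso M (hom_mc E_mc M) (curry_mfun M E_mc h)"
proof -
  interpret h: bilinear M E_mc M h by fact
  let ?c = "curry_obj E_mc h"
  have F: "?c (fObj F 1) = F" "fObj F 1 \<in> mObj M" if "F \<in> based_multifunctors E_mc M" for F
  proof -
    interpret F: based_multifunctor E_mc M F using that by (simp add: based_multifunctors_def)
    show 1: "fObj F 1 \<in> mObj M" by (rule F.fun_obj) simp
    have ext: "fObj F \<in> extensional (mObj E_mc)" "fArr F \<in> extensional (mArr E_mc)"
      using that by (simp_all add: based_multifunctors_def)
    have "bObj h (fObj F 1) b = fObj F b" if "b \<in> mObj E_mc" for b
    proof -
      have "b = 0 \<or> b = 1" using that by simp
      then show ?thesis using obj1[OF 1] h.bObj_base(2)[OF 1] F.fun_base_obj by auto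
    qed
    then have "(\<lambda>b \<in> mObj E_mc. bObj h (fObj F 1) b) = fObj F"
      by (intro extensionalityI[OF restrict_extensional ext(1)]) simp
    \<comment> \<open>With \<open>K = F\<close>, \<open>bilinear_E_right\<close> gives
      \<open>bArrL h (fArr F \<psi>) 1\<close>, which \<open>arr1\<close> turns into
      \<open>fArr F \<psi>\<close>.\<close>
    moreover have "bArrR h (fObj F 1) \<psi> = fArr F \<psi>" if "\<psi> \<in> mArr E_mc" for \<psi>
      using bilinear_E_right[OF assms(1) F.based_multifunctor_axioms that] arr1[OF F.fun_arr[OF that]]
      by simp
    then have "(\<lambda>\<psi> \<in> mArr E_mc. bArrR h (fObj F 1) \<psi>) = fArr F"
      by (intro extensionalityI[OF restrict_extensional ext(2)]) simp
    ultimately show "?c (fObj F 1) = F" by (simp add: curry_obj_def)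
  qed
  show ?thesis
  proof (rule h.curry_iso)
    show "bij_betw ?c (mObj M) (based_multifunctors E_mc M)"
    proof (rule bij_betw_byWitness[where f' = "\<lambda>F. fObj F 1"])
      show "\<forall>a\<in>mObj M. fObj (?c a) 1 = a" using obj1 by (simp add: curry_obj_def)
    qed (use F h.curry_obj_in in auto)
    show "bij_betw (fArr (curry_mfun M E_mc h)) (mArr M) (hom_arrows E_mc M)"
    proof (rule bij_betw_byWitness[where f' = "\<lambda>(Fs, G, \<phi>). \<phi> 1"])
      show "\<forall>f\<in>mArr M. (case fArr (curry_mfun M E_mc h) f of (Fs, G, \<phi>) \<Rightarrow> \<phi> 1) = f"
        using arr1 by (simp add: curry_mfun_def)
      have *: "\<phi> 1 \<in> mArr M \<and> fArr (curry_mfun M E_mc h) (\<phi> 1) = (Fs, G, \<phi>)"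
        if "(Fs, G, \<phi>) \<in> hom_arrows E_mc M" for Fs G \<phi>
      proof -
        have p: "set Fs \<subseteq> based_multifunctors E_mc M" "G \<in> based_multifunctors E_mc M"
          "\<phi> \<in> extensional (mObj E_mc)" "\<phi> 1 \<in> mArr M" "mSrc M (\<phi> 1) = map (\<lambda>F. fObj F 1) Fs"
          "mTgt M (\<phi> 1) = fObj G 1" "\<phi> 0 = base_arr M (length Fs)"
          using that by (simp_all add: hom_arrows_def)
        \<comment> \<open>\<open>Fs\<close> and \<open>G\<close> are recovered from their values at
          1, which are the sources and the target of \<open>\<phi> 1\<close>.\<close>
        have "map (\<lambda>F. ?c (fObj F 1)) Fs = Fs"
          using p(1) F(1) by (intro map_idI) auto
        then have s: "map ?c (mSrc M (\<phi> 1)) = Fs" by (simp only: p(5) list.map_comp comp_def)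
        \<comment> \<open>At 0 both are the basepoint arrow of arity
          \<open>length Fs\<close>.\<close>
        have "bArrL h (\<phi> 1) b = \<phi> b" if "b \<in> mObj E_mc" for b
        proof -
          have "b = 0 \<or> b = 1" using that by simp
          moreover have "arity M (\<phi> 1) = length Fs" by (simp only: arity_def p(5) length_map)
          ultimately show ?thesis
            using arr1[OF p(4)] h.bil_base_right[OF p(4)] p(7) by auto
        qed
        then have "(\<lambda>b \<in> mObj E_mc. bArrL h (\<phi> 1) b) = \<phi>"
          by (intro extensionalityI[OF restrict_extensional p(3)]) simp
        moreover have "?c (mTgt M (\<phi> 1)) = G" using F(1)[OF p(2)] by (simp only: p(6))
        ultimately show ?thesis using p(4) s by (simp add: curry_mfun_def)
      qed
      show "\<forall>x\<in>hom_arrows E_mc M. fArr (curry_mfun M E_mc h) (case x of (Fs, G, \<phi>) \<Rightarrow> \<phi> 1) = x"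
        using * by auto
      show "(\<lambda>(Fs, G, \<phi>). \<phi> 1) ` hom_arrows E_mc M \<subseteq> mArr M" using * by auto
    qed (use h.curry_arr_in in auto)
  qed
qed

text \<open>By the universal property, the composite on the smash product need only be compared with
  the identity on generators. Those from arrows of \<open>M\<close> reduce to the unit laws, those
  from arrows of \<open>E\<close> to \<open>bilinear_E_right\<close>.\<close>

lemma smash_iso:
  assumes "based_multifunctor (smash M E_mc) M \<mu>"
    and obj1: "\<And>a. a \<in> mObj M \<Longrightarrow> fObj \<mu> (bObj (smash_univ M E_mc) a 1) = a"
    and arr1: "\<And>\<phi>. \<phi> \<in> mArr M \<Longrightarrow> fArr \<mu> (bArrL (smash_univ M E_mc) \<phi> 1) = \<phi>"
  shows "based_iso (smash M E_mc) M \<mu>"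
proof -
  interpret mu: based_multifunctor "smash M E_mc" M \<mu> by fact
  interpret E: based_multicategory E_mc by (rule E_based)
  interpret f: smash_factors M E_mc by unfold_locales
  let ?u = "smash_univ M E_mc"
  interpret u: bilinear M E_mc "smash M E_mc" ?u by (rule f.smash_univ_bilinear)
  let ?h = "\<lparr>bObj = \<lambda>a b. fObj \<mu> (bObj ?u a b),
    bArrL = \<lambda>\<phi> b. fArr \<mu> (bArrL ?u \<phi> b), bArrR = \<lambda>a \<psi>. fArr \<mu> (bArrR ?u a \<psi>)\<rparr>"
  interpret h: bilinear M E_mc M ?h
    using u.bilinear_axioms assms(1) by (rule bilinear_postcomp)
  let ?I = "\<lparr>fObj = \<lambda>a. bObj ?u a 1, fArr = \<lambda>\<phi>. bArrL ?u \<phi> 1\<rparr>"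
  have I: "based_multifunctor M (smash M E_mc) ?I" by (rule u.bil_left) simp
  have "mfun_eq (smash M E_mc) (?I \<circ>\<^sub>m \<mu>) mfun_id"
  proof (rule f.smash_univ_unique)
    show "based_multifunctor (smash M E_mc) (smash M E_mc) (?I \<circ>\<^sub>m \<mu>)"
      using assms(1) I by (rule based_multifunctor_comp)
    show "based_multifunctor (smash M E_mc) (smash M E_mc) mfun_id"
      by (rule based_multifunctor_id) unfold_locales
    show "fArr (?I \<circ>\<^sub>m \<mu>) (bArrL ?u \<phi> b) = fArr mfun_id (bArrL ?u \<phi> b)"
      if "\<phi> \<in> mArr M" "b \<in> mObj E_mc" for \<phi> b
    proof -
      have "b = 0 \<or> b = 1" using that by simp
      then show ?thesis
      proof
        assume b: "b = 0"
        show ?thesis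
          using u.bil_base_right[OF that(1)] u.bArr_base(1)[of 1]
          by (simp add: b mu.fun_base_arr)
      qed (simp add: arr1[OF that(1), simplified])
    qed
    \<comment> \<open>Let \<open>K\<close> be the action on \<open>a\<close>. As
      \<open>K 1 = a\<close>, the principle identifies the generator of \<open>a\<close> and
      \<open>\<psi>\<close> with that of \<open>K \<psi>\<close> and 1.\<close>
    show "fArr (?I \<circ>\<^sub>m \<mu>) (bArrR ?u a \<psi>) = fArr mfun_id (bArrR ?u a \<psi>)"
      if "a \<in> mObj M" "\<psi> \<in> mArr E_mc" for a \<psi>
      using bilinear_E_right[OF u.bilinear_axioms h.bil_right[OF that(1)] that(2)] obj1[OF that(1)]
      by simp
  qed
  moreover have "mfun_eq M (\<mu> \<circ>\<^sub>m ?I) mfun_id"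
    using obj1 arr1 by (simp add: mfun_eq_def)
  ultimately show ?thesis using assms(1) I unfolding based_iso_def by blast
qed

theorem proposition3p3:
  fixes M :: "('o, 'a) based_multicat"
    and \<mu> :: "('o \<times> nat, ('o, 'a, nat, nat list \<times> nat) smash_term set, 'o, 'a) mfun"
  assumes "E_module M \<mu>"
  shows "(\<exists>F. based_iso M (hom_mc E_mc M) F) \<and>
    ((\<exists>F. based_iso (smash M E_mc) M F) \<and> (\<exists>F. based_iso M (hom_mc E_mc M) F))"
proof -
  interpret mu: smash_module E_mc E_mult E_unit M \<mu> by fact
  interpret E: based_multicategory E_mc by (rule E_based)
  interpret f: smash_factors M E_mc by unfold_locales
  have "based_iso (smash M E_mc) M \<mu>"
    using mu.action.based_multifunctor_axioms E_module_unit[OF assms] by (rule smash_iso)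
  \<comment> \<open>The action becomes bilinear by composing \<open>\<mu>\<close> with the universal
    bilinear map.\<close>
  moreover have "\<exists>F. based_iso M (hom_mc E_mc M) F"
    using hom_iso[OF bilinear_postcomp[OF f.smash_univ_bilinear mu.action.based_multifunctor_axioms]]
      E_module_unit[OF assms] by fastforce
  ultimately show ?thesis by blast
qed

end
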